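(* Let $d\ge2$, $n\ge1$, and set $\alpha=(d-2)/2$. Let $\sigma_d$ denote the normalized surface measure on $\mathbb{S}^d$, and let $\mu_{d-1}$ be its polar part, the measure on $\mathbb{R}/\mathbb{Z}$ given by $d\mu_{d-1}(\theta)=C_d|\sin(2\pi\theta)|^{d-1}d\theta$ with $C_d>0$ a dimensional constant. Then: (i) $\rho(d,\sigma_d,2n-1)=2\pi\rho(\mu_{d-1},2n-1)=\arccos(x_{n,n})$, where $x_{n,n}$ is the largest zero of the Jacobi polynomial $P_n^{(\alpha,\alpha)}(x)$; (ii) $\rho(d,\sigma_d,2n)=2\pi\rho(\mu_{d-1},2n)=\arccos(\xi_{n,n})$, where $\xi_{n,n}$ is the largest zero of the Jacobi polynomial $P_n^{(\alpha,\alpha+1)}(x)$.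
   Context: Radius of last sign change. Let $\mathbb{X}$ be $\mathbb{R}/\mathbb{Z}$ (usual distance, distinguished point $x^*=0$) or $\mathbb{S}^d\subset\mathbb{R}^{d+1}$ (geodesic distance, distinguished point $x^*=\mathbf{v}=(0,\dots,0,1)$). $B_r(x^* )$ is the open ball. $f:\mathbb{X}\to\mathbb{R}$ is eventually non-negative if $f\ge0$ on $\mathbb{X}\setminus B_r(x^* )$ for some $r>0$, and $\mathrm{r}(f)=\inf\{r>0:f\ge0\text{ on }\mathbb{X}\setminus B_r(x^* )\}$. For an even finite Borel measure $\nu$ on $\mathbb{R}/\mathbb{Z}$ and $N\ge1$, $\mathcal{T}(\nu,N)$ is the set of real-valued, eventually non-negative trigonometric polynomials $f(x)=\sum_{|n|\le N}\widehat f(n)e^{2\pi inx}$ with $\int f\,d\nu\le0$, and $\rho(\nu,N)=\inf_{0\not\equiv f\in\mathcal{T}(\nu,N)}\mathrm{r}(f)$. For a finite Borel measure $\mu$ on $\mathbb{S}^d$ invariant under all rotations fixing $\mathbf{v}$, $\mathcal{T}(d,\mu,N)$ is the set of eventually non-negative $f:\mathbb{S}^d\to\mathbb{R}$ of the form $f=\sum_{k=0}^NY_k$, with $Y_k$ a spherical harmonic of degree $k$ on $\mathbb{S}^d$, such that $\int_{\mathbb{S}^d}f\,d\mu\le0$; and $\rho(d,\mu,N)=\inf_{0\not\equiv f\in\mathcal{T}(d,\mu,N)}\mathrm{r}(f)$. The Jacobi polynomials, for $\alpha,\beta>-1$, are $$P_n^{(\alpha,\beta)}(x)=\frac{(-1)^n}{2^nn!}(1-x)^{-\alpha}(1+x)^{-\beta}\frac{d^n}{dx^n}\left[(1-x)^{n+\alpha}(1+x)^{n+\beta}\right],\quad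 x\in(-1,1);$$ they are orthogonal with respect to $(1-x)^\alpha(1+x)^\beta dx$ on $(-1,1)$. *)

theory Defs
  imports "HOL-Analysis.Analysis" "HOL-Computational_Algebra.Polynomial"
begin

text \<open>
  The radius of last sign change is defined for a set \<open>X\<close> with a distance function \<open>\<delta>\<close> and a
  distinguished point \<open>p\<close>; it is used for the circle and for the sphere.
\<close>

definition nonneg_outside ::
  "'a set \<Rightarrow> ('a \<Rightarrow> 'a \<Rightarrow> real) \<Rightarrow> 'a \<Rightarrow> ('a \<Rightarrow> real) \<Rightarrow> real \<Rightarrow> bool"
  where "nonneg_outside X \<delta> p f r \<longleftrightarrow> (\<forall>x \<in> X - {y \<in> X. \<delta> p y < r}. f x \<ge> 0)"

definition eventually_nonneg ::
  "'a set \<Rightarrow> ('a \<Rightarrow> 'a \<Rightarrow> real) \<Rightarrow> 'a \<Rightarrow> ('a \<Rightarrow> real) \<Rightarrow> bool"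
  where "eventually_nonneg X \<delta> p f \<longleftrightarrow> (\<exists>r>0. nonneg_outside X \<delta> p f r)"

definition last_sign_change ::
  "'a set \<Rightarrow> ('a \<Rightarrow> 'a \<Rightarrow> real) \<Rightarrow> 'a \<Rightarrow> ('a \<Rightarrow> real) \<Rightarrow> real"
  where "last_sign_change X \<delta> p f = Inf {r. r > 0 \<and> nonneg_outside X \<delta> p f r}"


text \<open>
  Functions on \<open>\<real>/\<int>\<close> are represented by 1-periodic functions on \<^typ>\<open>real\<close>, so that the points of
  \<open>\<real>/\<int>\<close> are represented by all reals and the quotient distance becomes a pseudometric. Measures on
  \<open>\<real>/\<int>\<close> are represented by measures on the fundamental domain \<open>[0,1)\<close>.
\<close>

definition circle_dist :: "real \<Rightarrow> real \<Rightarrow> real"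
  where "circle_dist x y = infdist (x - y) \<int>"

definition trig_poly :: "nat \<Rightarrow> (real \<Rightarrow> real) \<Rightarrow> bool"
  where "trig_poly N f \<longleftrightarrow> (\<exists>c :: int \<Rightarrow> complex. \<forall>x.
    complex_of_real (f x) =
      (\<Sum>n = - int N..int N. c n * exp (2 * complex_of_real pi * \<i> * of_int n * of_real x)))"

definition circle_class :: "real measure \<Rightarrow> nat \<Rightarrow> (real \<Rightarrow> real) set"
  where "circle_class \<nu> N = {f. trig_poly N f \<and> eventually_nonneg UNIV circle_dist 0 f
    \<and> (\<integral>x. f x \<partial>\<nu>) \<le> 0}"

definition circle_rho :: "real measure \<Rightarrow> nat \<Rightarrow> real"
  where "circle_rho \<nu> N =
    (INF f \<in> {f \<in> circle_class \<nu> N. \<exists>x. f x \<noteq> 0}. last_sign_change UNIV circle_dist 0 f)"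

definition polar_measure :: "real \<Rightarrow> nat \<Rightarrow> real measure"
  where "polar_measure C m =
    density (restrict_space lborel {0..<1}) (\<lambda>\<theta>. ennreal (C * \<bar>sin (2 * pi * \<theta>)\<bar> ^ m))"


text \<open>
  The sphere \<open>S\<^sup>d\<close> is the unit sphere of \<open>\<real>\<^sup>d \<times> \<real>\<close>, with \<open>d = CARD('d)\<close>. Functions on the sphere
  are represented by functions on the ambient space of which only the values on the sphere matter.
\<close>

definition pole :: "(real ^ 'd) \<times> real"
  where "pole = (0, 1)"

definition geodesic_dist :: "'a::real_inner \<Rightarrow> 'a \<Rightarrow> real"
  where "geodesic_dist x y = arccos (x \<bullet> y)"

definition laplacian :: "('a::euclidean_space \<Rightarrow> real) \<Rightarrow> 'a \<Rightarrow> real"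
  where "laplacian p x = (\<Sum>b\<in>Basis. (deriv ^^ 2) (\<lambda>t. p (x + t *\<^sub>R b)) 0)"

definition spherical_harmonic :: "nat \<Rightarrow> ('a::euclidean_space \<Rightarrow> real) \<Rightarrow> bool"
  where "spherical_harmonic k Y \<longleftrightarrow> (\<exists>p. real_polynomial_function p
    \<and> (\<forall>c x. p (c *\<^sub>R x) = c ^ k * p x)
    \<and> (\<forall>x. laplacian p x = 0)
    \<and> (\<forall>x \<in> sphere 0 1. Y x = p x))"

definition sphere_class ::
  "((real ^ 'd) \<times> real) measure \<Rightarrow> nat \<Rightarrow> ((real ^ 'd) \<times> real \<Rightarrow> real) set"
  where "sphere_class \<mu> N = {f.
    (\<exists>Y. (\<forall>k\<le>N. spherical_harmonic k (Y k)) \<and> (\<forall>x \<in> sphere 0 1. f x = (\<Sum>k\<le>N. Y k x)))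
    \<and> eventually_nonneg (sphere 0 1) geodesic_dist pole f
    \<and> (\<integral>x. f x \<partial>\<mu>) \<le> 0}"

definition sphere_rho :: "((real ^ 'd) \<times> real) measure \<Rightarrow> nat \<Rightarrow> real"
  where "sphere_rho \<mu> N =
    (INF f \<in> {f \<in> sphere_class \<mu> N. \<exists>x \<in> sphere 0 1. f x \<noteq> 0}.
      last_sign_change (sphere 0 1) geodesic_dist pole f)"

text \<open>
  The normalized surface measure of a set \<open>A\<close> of unit vectors is the proportion of the unit ball
  filled by the cone \<open>{t *\<^sub>R a | t a. 0 < t < 1 \<and> a \<in> A}\<close>; note that \<open>sgn x = x /\<^sub>R norm x\<close>.
\<close>

definition surface_measure :: "'a::euclidean_space measure"
  where "surface_measure =
    restrict_space (distr (uniform_measure lborel (ball 0 1)) borel sgn) (sphere 0 1)"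

lemma space_surface_measure: "space surface_measure = sphere 0 1"
  by (simp add: surface_measure_def space_restrict_space)

lemma sets_surface_measure:
  "sets surface_measure = sets (restrict_space borel (sphere 0 1))"
  by (simp add: surface_measure_def sets_restrict_space)

lemma emeasure_surface_measure:
  fixes A :: "'a::euclidean_space set"
  assumes "A \<in> sets borel" "A \<subseteq> sphere 0 1"
  shows "emeasure surface_measure A =
    emeasure lborel {t *\<^sub>R a | t a. 0 < t \<and> t < 1 \<and> a \<in> A} / emeasure lborel (ball (0::'a) 1)"
proof -
  have sgn_meas: "sgn \<in> borel_measurable (borel :: 'a measure)"
    unfolding sgn_div_norm[abs_def] by measurable
  have eq: "ball 0 1 \<inter> sgn -` A = {t *\<^sub>R a | t a. 0 < t \<and> t < 1 \<and> a \<in> A}" (is "?L = ?R")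
  proof
    show "?L \<subseteq> ?R"
    proof
      fix x assume x: "x \<in> ?L"
      then have "x \<noteq> 0" using assms(2) by auto
      then have "x = norm x *\<^sub>R sgn x" by (simp add: sgn_div_norm)
      with x \<open>x \<noteq> 0\<close> show "x \<in> ?R"
        by (auto intro!: exI[of _ "norm x"] exI[of _ "sgn x"])
    qed
    show "?R \<subseteq> ?L"
    proof
      fix x assume "x \<in> ?R"
      then obtain t a where "x = t *\<^sub>R a" "0 < t" "t < 1" "a \<in> A" by blast
      moreover from this have "norm a = 1" using assms(2) by auto
      ultimately show "x \<in> ?L" by (simp add: sgn_div_norm)
    qed
  qed
  have "emeasure surface_measure A =
      emeasure (distr (uniform_measure lborel (ball 0 1)) borel sgn) A"
    unfolding surface_measure_def using assms by (intro emeasure_restrict_space) auto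
  also have "\<dots> = emeasure (uniform_measure lborel (ball 0 1)) (sgn -` A)"
    using sgn_meas assms(1) by (subst emeasure_distr) auto
  also have "\<dots> = emeasure lborel (ball 0 1 \<inter> sgn -` A) / emeasure lborel (ball (0::'a) 1)"
    using measurable_sets[OF sgn_meas assms(1)] by (intro emeasure_uniform_measure) auto
  finally show ?thesis unfolding eq .
qed


text \<open>
  The Rodrigues formula defines the Jacobi polynomial only on \<open>(-1,1)\<close>; \<open>jacobi_poly\<close> is the
  polynomial that agrees with it there.
\<close>

definition rodrigues :: "nat \<Rightarrow> real \<Rightarrow> real \<Rightarrow> real \<Rightarrow> real"
  where "rodrigues n \<alpha> \<beta> x =
    (-1) ^ n / (2 ^ n * fact n) * (1 - x) powr (- \<alpha>) * (1 + x) powr (- \<beta>)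
      * (deriv ^^ n) (\<lambda>t. (1 - t) powr (real n + \<alpha>) * (1 + t) powr (real n + \<beta>)) x"

definition jacobi_poly :: "nat \<Rightarrow> real \<Rightarrow> real \<Rightarrow> real poly"
  where "jacobi_poly n \<alpha> \<beta> = (THE p. \<forall>x \<in> {-1<..<1}. poly p x = rodrigues n \<alpha> \<beta> x)"

lemma higher_deriv_jacobi_weight:
  fixes a b :: real
  shows "\<exists>p. \<forall>x \<in> {-1<..<1}. (deriv ^^ k) (\<lambda>t. (1 - t) powr a * (1 + t) powr b) x =
    (1 - x) powr (a - real k) * (1 + x) powr (b - real k) * poly p x"
proof (induction k)
  case 0
  show ?case by (intro exI[of _ 1]) simp
next
  case (Suc k)
  then obtain p where p: "\<And>x. x \<in> {-1<..<1} \<Longrightarrow>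
      (deriv ^^ k) (\<lambda>t. (1 - t) powr a * (1 + t) powr b) x =
      (1 - x) powr (a - real k) * (1 + x) powr (b - real k) * poly p x" by blast
  define q where "q = pderiv p * [:1, 0, -1:] - smult (a - real k) ([:1, 1:] * p)
    + smult (b - real k) ([:1, -1:] * p)"
  have "(deriv ^^ Suc k) (\<lambda>t. (1 - t) powr a * (1 + t) powr b) x =
      (1 - x) powr (a - real (Suc k)) * (1 + x) powr (b - real (Suc k)) * poly q x"
    if x: "x \<in> {-1<..<1}" for x
  proof -
    define u v where "u = (1 - x) powr (a - real (Suc k))" and "v = (1 + x) powr (b - real (Suc k))"
    have uv: "(1 - x) powr (a - real k) = (1 - x) * u" "(1 + x) powr (b - real k) = (1 + x) * v"
      using x powr_add[of "1 - x" 1 "a - real (Suc k)"] powr_add[of "1 + x" 1 "b - real (Suc k)"]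
      by (simp_all add: u_def v_def)
    have uv': "(1 - x) powr (a - real k - 1) = u" "(1 + x) powr (b - real k - 1) = v"
      "(1 - x) powr (a - (1 + real k)) = u" "(1 + x) powr (b - (1 + real k)) = v"
      by (simp_all add: u_def v_def algebra_simps)
    have "((\<lambda>t. (1 - t) powr (a - real k) * (1 + t) powr (b - real k) * poly p t)
        has_field_derivative u * v * poly q x) (at x)"
      using x by (auto intro!: derivative_eq_intros poly_DERIV)
        (simp add: uv uv' q_def algebra_simps)
    then have "((deriv ^^ k) (\<lambda>t. (1 - t) powr a * (1 + t) powr b)
        has_field_derivative u * v * poly q x) (at x)"
      by (rule has_field_derivative_transform_within_open[of _ _ _ "{-1<..<1}"]) (use x p in auto)
    then show ?thesis
      by (simp add: DERIV_imp_deriv u_def v_def)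
  qed
  then show ?case by blast
qed

lemma poly_jacobi_poly:
  assumes "x \<in> {-1<..<1}"
  shows "poly (jacobi_poly n \<alpha> \<beta>) x = rodrigues n \<alpha> \<beta> x"
proof -
  obtain p where p: "\<And>x. x \<in> {-1<..<1} \<Longrightarrow>
      (deriv ^^ n) (\<lambda>t. (1 - t) powr (real n + \<alpha>) * (1 + t) powr (real n + \<beta>)) x =
      (1 - x) powr \<alpha> * (1 + x) powr \<beta> * poly p x"
    using higher_deriv_jacobi_weight[of n "real n + \<alpha>" "real n + \<beta>"] by auto
  define q where "q = smult ((-1) ^ n / (2 ^ n * fact n)) p"
  have q: "\<forall>x \<in> {-1<..<1}. poly q x = rodrigues n \<alpha> \<beta> x"
  proof
    fix x :: real assume x: "x \<in> {-1<..<1}"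
    then have "(1 - x) powr \<alpha> \<noteq> 0" "(1 + x) powr \<beta> \<noteq> 0" by auto
    then show "poly q x = rodrigues n \<alpha> \<beta> x"
      unfolding rodrigues_def p[OF x] q_def powr_minus by (simp add: divide_simps)
  qed
  have "\<exists>!p. \<forall>x \<in> {-1<..<1}. poly p x = rodrigues n \<alpha> \<beta> x"
  proof (rule ex1I[of _ q])
    fix r assume r: "\<forall>x \<in> {-1<..<1}. poly r x = rodrigues n \<alpha> \<beta> x"
    show "r = q"
    proof (rule ccontr)
      assume "r \<noteq> q"
      then have "finite {x. poly (r - q) x = 0}" by (intro poly_roots_finite) simp
      moreover have "{-1<..<1} \<subseteq> {x. poly (r - q) x = 0}" using q r by auto
      ultimately have "finite {-1<..<1::real}" by (rule rev_finite_subset)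
      then show False using infinite_Ioo[of "-1::real" 1] by simp
    qed
  qed (rule q)
  from theI'[OF this] assms show ?thesis unfolding jacobi_poly_def by blast
qed

definition largest_zero :: "real poly \<Rightarrow> real"
  where "largest_zero p = Max {x. poly p x = 0}"

end

theory Submission
  imports Defs
begin

text \<open>
  Let \<open>m = d - 2\<close> and \<open>w t = (1 - t\<^sup>2) powr (m / 2)\<close>. Both extremal problems are the same problem about
  real polynomials on \<open>[-1, 1]\<close>, where \<open>t\<close> is the cosine of the angle to the distinguished point
  (the angle is the distance on the sphere, and \<open>2 \<pi>\<close> times the distance on the circle):
  among the nonzero \<open>p\<close> of degree at most \<open>N\<close> with \<open>p \<ge> 0\<close> on \<open>[-1, s]\<close> and \<open>\<integral> p w \<le> 0\<close>, how large
  can \<open>s\<close> be? The answer \<open>z\<close> of this problem is what the predicate \<open>extremal w N z\<close> records, and the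
  angle sought is \<open>arccos z\<close>.

  On the interval, Gauss quadrature decides. Let \<open>P\<close> have degree \<open>n\<close> and be orthogonal for the weight \<open>w\<close>
  to all polynomials of smaller degree. A polynomial of degree at most \<open>2 n - 1\<close> has the integral
  \<open>\<Sum> l a * p a\<close> over the zeros \<open>a\<close> of \<open>P\<close>, with positive \<open>l a\<close>. If \<open>p \<ge> 0\<close> on \<open>[-1, s]\<close> for some
  \<open>s\<close> beyond all nodes and \<open>\<integral> p w \<le> 0\<close>, then \<open>p\<close> vanishes at every node, to second order because it does not change sign
  there, and \<open>2 n\<close> zeros are too many. Equality is attained by \<open>P\<^sup>2 / (z - t)\<close> with \<open>z\<close> the largest
  zero. For even \<open>N = 2 n\<close> the same works with \<open>-1\<close> as an additional node (Gauss--Radau), and the other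
  nodes are the zeros of the orthogonal polynomial for the weight \<open>(1 + t) w t\<close>. By the Rodrigues formula
  and integration by parts, these orthogonal polynomials are the Jacobi polynomials with parameters
  \<open>(\<alpha>, \<alpha>)\<close> and \<open>(\<alpha>, \<alpha> + 1)\<close>, where \<open>\<alpha> = m / 2\<close>.

  On the circle, the even part of a trigonometric polynomial is \<open>p (cos (2 \<pi> x))\<close>; it keeps the integral
  and the sign condition, and the substitution \<open>t = cos (2 \<pi> x)\<close> gives \<open>circle_rho_eq\<close>. On the sphere,
  averaging over the latitudes does the same job: the average at height \<open>t\<close> is \<open>p t\<close> with a
  polynomial \<open>p\<close> of degree at most \<open>N\<close>, and \<open>\<integral> f d\<sigma>\<close> is a fixed positive multiple of \<open>\<integral> p w\<close>
  (\<open>latitude_average\<close>). Conversely a polynomial in the last coordinate is a sum of spherical harmonics,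
  because the zonal harmonics have one member of each degree. This gives \<open>sphere_rho_eq\<close>.

  The averaging may annihilate a nonzero \<open>f\<close>. In that case the nonnegative \<open>f\<close> has average zero on every
  latitude outside the ball, so it vanishes there; being a trigonometric polynomial along each meridian,
  it then vanishes identically.
\<close>

section \<open>Polynomials whose integral against a weight is nonpositive\<close>

lemma poly_zero_on_interval:
  fixes p :: "real poly"
  assumes "a < b" "\<And>t. t \<in> {a<..<b} \<Longrightarrow> poly p t = 0"
  shows "p = 0"
proof (rule ccontr)
  assume "p \<noteq> 0"
  then have "finite {t. poly p t = 0}" by (rule poly_roots_finite)
  moreover have "{a<..<b} \<subseteq> {t. poly p t = 0}" using assms(2) by blast
  ultimately have "finite {a<..<b}" using finite_subset by blast
  then show False using infinite_Ioo[OF assms(1)] by blast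
qed

definition weighted_integral :: "(real \<Rightarrow> real) \<Rightarrow> real poly \<Rightarrow> real"
  where "weighted_integral w p = integral {-1..1} (\<lambda>t. poly p t * w t)"

text \<open>
  The weights vanish at an endpoint of the interval when the exponent there is positive, hence positivity
  is required in the interior only.
\<close>

definition weight :: "(real \<Rightarrow> real) \<Rightarrow> bool"
  where "weight w \<longleftrightarrow> continuous_on {-1..1} w \<and> (\<forall>t\<in>{-1<..<1}. w t > 0)"

lemma weighted_integral_integrable:
  assumes "weight w"
  shows "(\<lambda>t. poly p t * w t) integrable_on {-1..1}"
  using assms unfolding weight_def
  by (intro integrable_continuous_real continuous_intros) auto

lemma weighted_integral_add: "weight w \<Longrightarrow> weighted_integral w (p + q) = weighted_integral w p + weighted_integral w q"
  unfolding weighted_integral_def using weighted_integral_integrable[of w p] weighted_integral_integrable[of w q]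
  by (simp add: ring_distribs integral_add)

lemma weighted_integral_smult: "weighted_integral w (smult c p) = c * weighted_integral w p"
  unfolding weighted_integral_def by (simp add: mult.assoc)

lemma weighted_integral_0: "weighted_integral w 0 = 0"
  unfolding weighted_integral_def by simp

lemma weighted_integral_sum: "weight w \<Longrightarrow> weighted_integral w (\<Sum>i\<in>I. p i) = (\<Sum>i\<in>I. weighted_integral w (p i))"
  by (induction I rule: infinite_finite_induct) (auto simp: weighted_integral_0 weighted_integral_add)

lemma weighted_integral_pos:
  assumes w: "weight w" and p: "p \<noteq> 0" and nn: "\<And>t. t \<in> {-1<..<1} \<Longrightarrow> poly p t \<ge> 0"
  shows "weighted_integral w p > 0"
proof -
  let ?f = "\<lambda>t. poly p t * w t"
  have c: "continuous_on {-1..1} ?f"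
    using w unfolding weight_def by (intro continuous_intros) auto
  have nn': "?f t \<ge> 0" if "t \<in> {-1<..<1}" for t
    using w that nn[OF that] unfolding weight_def by (simp add: less_imp_le)
  have int: "?f integrable_on {-1..1}" by (rule weighted_integral_integrable[OF w])
  have "integral {-1<..<1} ?f \<ge> 0"
    using nn' int by (intro integral_nonneg) (auto simp: integrable_on_open_interval_real)
  then have "weighted_integral w p \<ge> 0"
    unfolding weighted_integral_def by (simp add: integral_open_interval_real)
  moreover have "weighted_integral w p \<noteq> 0"
  proof
    assume "weighted_integral w p = 0"
    then have "(?f has_integral 0) {-1..1}"
      using int unfolding weighted_integral_def by (simp add: has_integral_integral)
    then have 0: "?f t = 0" if "t \<in> {-1<..<1}" for t
      using has_integral_0_cbox_imp_0[of "-1" 1 ?f t] c nn' that by simp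
    have "poly p t = 0" if "t \<in> {-1<..<1}" for t
    proof -
      have "w t > 0" using w that unfolding weight_def by blast
      with 0[OF that] show ?thesis by simp
    qed
    then have "p = 0" by (intro poly_zero_on_interval[of "-1" 1]) auto
    with p show False ..
  qed
  ultimately show ?thesis by simp
qed

text \<open>
  The nodal polynomial of a set of quadrature nodes.
\<close>

definition node_poly :: "real set \<Rightarrow> real poly"
  where "node_poly A = (\<Prod>a\<in>A. [:-a, 1:])"

text \<open>
  The roots of odd multiplicity in \<open>(-1, 1)\<close> form such a set \<open>A\<close>. Multiplicities are avoided by splitting
  off one root at a time: a root that is already in the set \<open>A\<close> of the cofactor leaves it, any other
  root enters it. The factor \<open>s\<close> is the constant sign of the product, up to a positive scalar.
\<close>

lemma sign_change_roots:
  fixes p :: "real poly"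
  assumes "p \<noteq> 0"
  shows "\<exists>A s. finite A \<and> A \<subseteq> {-1<..<1} \<and> node_poly A dvd p \<and> s \<noteq> 0
    \<and> (\<forall>t\<in>{-1<..<1}. s * poly (p * node_poly A) t \<ge> 0)"
  using assms
proof (induction "degree p" arbitrary: p rule: less_induct)
  case less
  show ?case
  proof (cases "\<exists>a\<in>{-1<..<1}. poly p a = 0")
    case True
    then obtain a p1 where a: "a \<in> {-1<..<1}" and p: "p = [:-a, 1:] * p1"
      by (auto simp: poly_eq_0_iff_dvd elim!: dvdE)
    with less.prems have p1: "p1 \<noteq> 0" by auto
    then have "degree p1 < degree p"
      unfolding p by (subst degree_mult_eq) auto
    then obtain A s where A: "finite A" "A \<subseteq> {-1<..<1}" "node_poly A dvd p1" "s \<noteq> 0"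
      and pos: "\<And>t. t \<in> {-1<..<1} \<Longrightarrow> s * poly (p1 * node_poly A) t \<ge> 0"
      using less.hyps[OF _ p1] by blast
    show ?thesis
    proof (cases "a \<in> A")
      case True
      then have *: "node_poly A = [:-a, 1:] * node_poly (A - {a})"
        using A(1) by (simp add: node_poly_def prod.remove)
      then have "node_poly (A - {a}) dvd p"
        using A(3) unfolding p by (metis dvd_mult dvd_mult_right)
      moreover have "p * node_poly (A - {a}) = p1 * node_poly A"
        unfolding * p by (simp only: mult_ac)
      ultimately show ?thesis
        using A pos by (intro exI[of _ "A - {a}"] exI[of _ s]) auto
    next
      case False
      then have *: "node_poly (insert a A) = [:-a, 1:] * node_poly A"
        using A(1) by (simp add: node_poly_def)
      have "p * node_poly (insert a A) = [:-a, 1:]^2 * (p1 * node_poly A)"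
        unfolding * p by (simp only: mult_ac power2_eq_square)
      then have "s * poly (p * node_poly (insert a A)) t
          = (t - a)^2 * (s * poly (p1 * node_poly A) t)" for t
        by (simp add: poly_power algebra_simps)
      then have "\<forall>t\<in>{-1<..<1}. s * poly (p * node_poly (insert a A)) t \<ge> 0"
        using pos by (metis mult_nonneg_nonneg zero_le_power2)
      moreover have "node_poly (insert a A) dvd p"
        unfolding * p using A(3) by (intro mult_dvd_mono) auto
      ultimately show ?thesis
        using A a by (intro exI[of _ "insert a A"] exI[of _ s]) auto
    qed
  next
    case False
    have "s * t > 0" if "s = poly p 0" "t = poly p x" "x \<in> {-1<..<1}" for s t x
    proof (rule ccontr)
      assume "\<not> s * t > 0"
      moreover have "s * t \<noteq> 0" using False that by auto
      ultimately have "s * t < 0" by linarith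
      then have st: "poly p 0 * poly p x < 0" by (simp only: that)
      then have "x \<noteq> 0" using not_square_less_zero[of "poly p 0"] by auto
      then consider "0 < x" | "x < 0" by linarith
      then show False
      proof cases
        case 1
        then obtain y where "y > 0" "y < x" "poly p y = 0"
          using poly_IVT[OF 1 st] by blast
        then show False using False that by force
      next
        case 2
        then obtain y where "y > x" "y < 0" "poly p y = 0"
          using poly_IVT[OF 2, of p] st by (auto simp: mult.commute)
        then show False using False that by force
      qed
    qed
    then have "\<forall>t\<in>{-1<..<1}. poly p 0 * poly p t \<ge> 0" by (auto simp: less_imp_le)
    moreover have "poly p 0 \<noteq> 0" using False by auto
    ultimately show ?thesis
      by (intro exI[of _ "{}"] exI[of _ "poly p 0"]) (auto simp: node_poly_def)
  qed
qed

lemma poly_node_poly: "poly (node_poly A) x = (\<Prod>a\<in>A. x - a)"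
  by (simp add: node_poly_def poly_prod)

lemma degree_node_poly: "degree (node_poly A) = card A"
  unfolding node_poly_def by (subst degree_prod_eq_sum_degree) auto

lemma node_poly_neq_0: "node_poly A \<noteq> 0"
  by (cases "finite A") (auto simp: node_poly_def)

lemma node_poly_dvd:
  assumes "finite A" "\<And>a. a \<in> A \<Longrightarrow> poly p a = 0"
  shows "node_poly A dvd p"
  using assms
proof (induction A arbitrary: p rule: finite_induct)
  case (insert a A)
  then have "[:-a, 1:] dvd p" by (simp add: poly_eq_0_iff_dvd)
  then obtain q where p: "p = [:-a, 1:] * q" by (elim dvdE)
  have "poly q b = 0" if "b \<in> A" for b
    using insert.prems[of b] insert.hyps that by (auto simp: p)
  then have "node_poly A dvd q" by (rule insert.IH)
  then show ?case using insert.hyps by (simp add: node_poly_def p mult_dvd_mono del: mult_pCons_left)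
qed (simp add: node_poly_def)

text \<open>
  With fewer than \<open>n\<close> sign changes, the nodal polynomial of the sign changes would be a legitimate test
  polynomial, and the integral of a function of constant sign would be zero.
\<close>

lemma orthogonal_poly_roots:
  assumes w: "weight w" and P: "P \<noteq> 0" "degree P \<le> n"
    and orth: "\<And>q. degree q < n \<Longrightarrow> weighted_integral w (P * q) = 0"
  obtains A c where "finite A" "A \<subseteq> {-1<..<1}" "card A = n" "c \<noteq> 0" "P = smult c (node_poly A)"
proof -
  obtain A s where A: "finite A" "A \<subseteq> {-1<..<1}" "node_poly A dvd P" "s \<noteq> 0"
    and pos: "\<And>t. t \<in> {-1<..<1} \<Longrightarrow> s * poly (P * node_poly A) t \<ge> 0"
    using sign_change_roots[OF P(1)] by blast
  have "card A \<ge> n"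
  proof (rule ccontr)
    assume "\<not> card A \<ge> n"
    then have "weighted_integral w (smult s (P * node_poly A)) = 0"
      using orth[of "node_poly A"] by (simp add: weighted_integral_smult degree_node_poly)
    moreover have "weighted_integral w (smult s (P * node_poly A)) > 0"
      using pos A(4) P(1) node_poly_neq_0 by (intro weighted_integral_pos[OF w]) auto
    ultimately show False by simp
  qed
  obtain g where g: "P = node_poly A * g" using A(3) by (elim dvdE)
  with P(1) have "g \<noteq> 0" by auto
  with g have "degree P = card A + degree g"
    by (simp add: degree_mult_eq node_poly_neq_0 degree_node_poly)
  with P(2) \<open>card A \<ge> n\<close> have dg: "degree g = 0" "card A = n" by auto
  obtain c where c: "g = [:c:]" using dg(1) degree_eq_zeroE by blast
  show thesis
  proof (rule that[OF A(1,2) dg(2)])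
    show "c \<noteq> 0" using c \<open>g \<noteq> 0\<close> by auto
    show "P = smult c (node_poly A)" unfolding g c by simp
  qed
qed

text \<open>
  Division by the nodal polynomial reduces the exactness to the remainder, which Lagrange interpolation
  at the nodes recovers. The weight of a node is the integral of its Lagrange polynomial; exactness for the
  square of this polynomial, which has degree below \<open>2 * card A\<close>, shows that the weight is positive.
\<close>

lemma gauss_quadrature:
  assumes w: "weight w" and A: "finite A"
    and orth: "\<And>q. degree q < card A \<Longrightarrow> weighted_integral w (node_poly A * q) = 0"
  obtains l where "\<And>a. a \<in> A \<Longrightarrow> l a > 0"
    "\<And>p. degree p < 2 * card A \<Longrightarrow> weighted_integral w p = (\<Sum>a\<in>A. l a * poly p a)"
proof (cases "A = {}")
  case True
  then show ?thesis using that[of "\<lambda>_. 1"] by simp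
next
  case False
  \<comment> \<open>the Lagrange polynomials of the nodes\<close>
  define e where "e a = smult (1 / poly (node_poly (A - {a})) a) (node_poly (A - {a}))" for a
  have e: "poly (e a) b = (if a = b then 1 else 0)" if "a \<in> A" "b \<in> A" for a b
    using A that by (auto simp: e_def poly_node_poly)
  have de: "degree (e a) < card A" if "a \<in> A" for a
    using that A card_gt_0_iff[of A] by (auto simp: e_def degree_node_poly)
  have quad: "weighted_integral w p = (\<Sum>a\<in>A. weighted_integral w (e a) * poly p a)" if p: "degree p < 2 * card A" for p
  proof -
    define q r where "q = p div node_poly A" and "r = p mod node_poly A"
    have p_eq: "p = node_poly A * q + r" by (simp add: q_def r_def)
    have "card A > 0" using A False by (simp add: card_gt_0_iff)
    have dr: "degree r < card A"
      using degree_mod_less[of "node_poly A" p] node_poly_neq_0 \<open>card A > 0\<close>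
      by (auto simp: r_def degree_node_poly)
    have dq: "degree q < card A"
    proof (rule ccontr)
      assume "\<not> degree q < card A"
      then have "q \<noteq> 0" using \<open>card A > 0\<close> by auto
      then have "degree (node_poly A * q) = card A + degree q"
        by (simp add: degree_mult_eq node_poly_neq_0 degree_node_poly)
      moreover have "degree (node_poly A * q) = degree p"
        using dr calculation by (subst p_eq, subst degree_add_eq_left) auto
      ultimately show False using p \<open>\<not> degree q < card A\<close> by linarith
    qed
    have r_eq: "r = (\<Sum>a\<in>A. smult (poly p a) (e a))"
    proof (rule poly_eqI_degree[of A])
      fix b assume b: "b \<in> A"
      have "poly (\<Sum>a\<in>A. smult (poly p a) (e a)) b = (\<Sum>a\<in>A. if a = b then poly p b else 0)"
        unfolding poly_sum using e b by (intro sum.cong) auto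
      also have "\<dots> = poly p b" using A b by simp
      also have "poly p b = poly r b"
        using b A by (subst p_eq) (auto simp: poly_node_poly)
      finally show "poly r b = poly (\<Sum>a\<in>A. smult (poly p a) (e a)) b" by simp
    next
      show "card A > degree (\<Sum>a\<in>A. smult (poly p a) (e a))"
        using de \<open>card A > 0\<close>
        by (intro degree_sum_less) (auto intro: le_less_trans[OF degree_smult_le])
    qed (rule dr)
    have "weighted_integral w p = weighted_integral w r"
      using orth[OF dq] by (subst p_eq) (simp add: weighted_integral_add[OF w])
    also have "\<dots> = (\<Sum>a\<in>A. weighted_integral w (e a) * poly p a)"
      by (subst r_eq) (simp add: weighted_integral_sum[OF w] weighted_integral_smult mult.commute)
    finally show ?thesis .
  qed
  have "weighted_integral w (e a) > 0" if a: "a \<in> A" for a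
  proof -
    have "degree (e a * e a) < 2 * card A"
      using de[OF a] degree_mult_le[of "e a" "e a"] by linarith
    then have "weighted_integral w (e a * e a) = (\<Sum>b\<in>A. weighted_integral w (e b) * (poly (e a) b * poly (e a) b))"
      by (simp add: quad)
    also have "\<dots> = (\<Sum>b\<in>A. if b = a then weighted_integral w (e a) else 0)"
      using e a by (intro sum.cong) auto
    also have "\<dots> = weighted_integral w (e a)" using A a by simp
    finally have "weighted_integral w (e a) = weighted_integral w (e a * e a)" ..
    moreover have "e a \<noteq> 0" using e[OF a a] by auto
    ultimately show ?thesis by (auto intro!: weighted_integral_pos[OF w])
  qed
  then show ?thesis using quad by (rule that[of "\<lambda>a. weighted_integral w (e a)"])
qed

text \<open>
  A zero at which \<open>p\<close> does not change sign is a local minimum, so \<open>p\<close> has a double zero at each point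
  of \<open>A\<close>, more zeros than its degree permits.
\<close>

lemma double_zeros_imp_0:
  fixes A :: "real set"
  assumes A: "finite A" and p: "degree p < 2 * card A"
    and nn: "\<And>a. a \<in> A \<Longrightarrow> poly p a = 0 \<and> (\<exists>u<a. \<exists>v>a. \<forall>t\<in>{u<..<v}. poly p t \<ge> 0)"
  shows "p = 0"
proof -
  have "node_poly A dvd p" using node_poly_dvd[OF A, of p] nn by simp
  then obtain g where g: "p = node_poly A * g" by (elim dvdE)
  have "poly g a = 0" if a: "a \<in> A" for a
  proof -
    obtain u v where uv: "u < a" "a < v" "\<forall>t\<in>{u<..<v}. poly p t \<ge> 0" using nn[OF a] by blast
    have "poly (pderiv p) a = 0"
    proof (rule DERIV_local_min[OF poly_DERIV])
      show "0 < min (a - u) (v - a)" using uv by auto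
      show "\<forall>y. \<bar>a - y\<bar> < min (a - u) (v - a) \<longrightarrow> poly p a \<le> poly p y"
        using uv nn[OF a] by (auto simp: abs_less_iff)
    qed
    moreover have "p = [:-a, 1:] * (node_poly (A - {a}) * g)"
      by (simp only: g node_poly_def prod.remove[OF A a] mult.assoc)
    ultimately have "poly (node_poly (A - {a}) * g) a = 0"
      by (simp add: pderiv_mult pderiv_pCons del: mult_pCons_left)
    then show ?thesis using A by (auto simp: poly_node_poly)
  qed
  show ?thesis
  proof (rule ccontr)
    assume "p \<noteq> 0"
    then have "g \<noteq> 0" using g by auto
    then have "degree p = card A + degree g"
      by (simp add: g degree_mult_eq node_poly_neq_0 degree_node_poly)
    with p have "degree g < card A" by simp
    then have "g = 0" using \<open>\<And>a. a \<in> A \<Longrightarrow> poly g a = 0\<close>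
      by (intro poly_eqI_degree[of A]) auto
    with \<open>g \<noteq> 0\<close> show False ..
  qed
qed

text \<open>
  The point \<open>z\<close> is the largest possible left endpoint of the region of free sign: beyond \<open>z\<close> only the zero
  polynomial qualifies, and \<open>z\<close> itself is attained.
\<close>

definition extremal :: "(real \<Rightarrow> real) \<Rightarrow> nat \<Rightarrow> real \<Rightarrow> bool"
  where "extremal w N z \<longleftrightarrow> -1 < z \<and> z < 1
    \<and> (\<forall>p s. degree p \<le> N \<longrightarrow> z < s \<longrightarrow> (\<forall>t\<in>{-1..1}. t \<le> s \<longrightarrow> poly p t \<ge> 0)
        \<longrightarrow> weighted_integral w p \<le> 0 \<longrightarrow> p = 0)
    \<and> (\<exists>p. p \<noteq> 0 \<and> degree p \<le> N \<and> (\<forall>t\<in>{-1..1}. t \<le> z \<longrightarrow> poly p t \<ge> 0) \<and> weighted_integral w p \<le> 0)"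

text \<open>
  The endpoint \<open>-1\<close> is left out of the sign condition so that the lemma also applies to a quotient by
  \<open>1 + t\<close>.
\<close>

lemma gauss_lower_bound:
  assumes w: "weight w" and A: "finite A" "A \<subseteq> {-1<..<1}"
    and orth: "\<And>q. degree q < card A \<Longrightarrow> weighted_integral w (node_poly A * q) = 0"
    and p: "degree p < 2 * card A" "weighted_integral w p \<le> 0"
    and s: "\<And>a. a \<in> A \<Longrightarrow> a < s" "\<And>t. t \<in> {-1<..<1} \<Longrightarrow> t \<le> s \<Longrightarrow> poly p t \<ge> 0"
  shows "p = 0"
proof (rule double_zeros_imp_0[OF A(1) p(1)])
  fix a assume a: "a \<in> A"
  obtain l where l: "\<And>a. a \<in> A \<Longrightarrow> l a > 0"
    "weighted_integral w p = (\<Sum>a\<in>A. l a * poly p a)"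
  proof (rule gauss_quadrature[OF w A(1) orth])
    fix l
    assume "\<And>a. a \<in> A \<Longrightarrow> l a > 0"
      "\<And>p. degree p < 2 * card A \<Longrightarrow> weighted_integral w p = (\<Sum>a\<in>A. l a * poly p a)"
    with p(1) show thesis by (intro that[of l]) auto
  qed
  have pos: "poly p b \<ge> 0" if "b \<in> A" for b
    using A s that by (auto simp: less_imp_le)
  have "(\<Sum>a\<in>A. l a * poly p a) = 0"
    using l p(2) pos by (intro antisym sum_nonneg) (auto simp: less_imp_le)
  then have "l a * poly p a = 0"
    using A(1) a l(1) pos by (subst (asm) sum_nonneg_eq_0_iff) (auto simp: less_imp_le)
  then have "poly p a = 0" using l(1)[OF a] by simp
  moreover have "\<exists>u<a. \<exists>v>a. \<forall>t\<in>{u<..<v}. poly p t \<ge> 0"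
    using A(2) a s by (intro exI[of _ "-1"] conjI exI[of _ "min 1 s"]) auto
  ultimately show "poly p a = 0 \<and> (\<exists>u<a. \<exists>v>a. \<forall>t\<in>{u<..<v}. poly p t \<ge> 0)" by blast
qed

lemma largest_zero_orthogonal:
  assumes "finite A" "A \<noteq> {}" "c \<noteq> 0" "P = smult c (node_poly A)"
  shows "largest_zero P \<in> A" "\<And>a. a \<in> A \<Longrightarrow> a \<le> largest_zero P"
proof -
  have "{x. poly P x = 0} = A"
    using assms by (auto simp: poly_node_poly)
  then show "largest_zero P \<in> A" "\<And>a. a \<in> A \<Longrightarrow> a \<le> largest_zero P"
    using assms unfolding largest_zero_def by auto
qed

text \<open>
  The extremal polynomial is a constant multiple of \<open>P\<^sup>2 / (z - t)\<close>; its integral vanishes because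
  \<open>P / (z - t)\<close> has degree below \<open>n\<close>.
\<close>

lemma extremal_gauss:
  assumes w: "weight w" and P: "P \<noteq> 0" "degree P \<le> n" and n: "n \<ge> 1"
    and orth: "\<And>q. degree q < n \<Longrightarrow> weighted_integral w (P * q) = 0"
  shows "extremal w (2 * n - 1) (largest_zero P)"
proof -
  obtain A c where A: "finite A" "A \<subseteq> {-1<..<1}" "card A = n" and c: "c \<noteq> 0"
    and PA: "P = smult c (node_poly A)"
    using orthogonal_poly_roots[OF w P orth] by blast
  have "A \<noteq> {}" using A n by auto
  define z where "z = largest_zero P"
  have z: "z \<in> A" "\<And>a. a \<in> A \<Longrightarrow> a \<le> z"
    using largest_zero_orthogonal[OF A(1) \<open>A \<noteq> {}\<close> c PA] by (auto simp: z_def)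
  have orth': "weighted_integral w (node_poly A * q) = 0" if "degree q < card A" for q
    using orth[of q] that c A(3) by (simp add: PA weighted_integral_smult)
  have lower: "p = 0" if "degree p \<le> 2 * n - 1" "z < s" "\<forall>t\<in>{-1..1}. t \<le> s \<longrightarrow> poly p t \<ge> 0"
    "weighted_integral w p \<le> 0" for p s
    by (rule gauss_lower_bound[OF w A(1,2) orth', of p s]) (use that z A n in \<open>auto intro: le_less_trans\<close>)
  define B where "B = node_poly (A - {z})"
  have NA: "node_poly A = [:-z, 1:] * B"
    using A z by (simp add: node_poly_def prod.remove B_def)
  have dB: "degree B < card A"
    using z A n by (auto simp: B_def degree_node_poly)
  define p where "p = - (node_poly A * B)"
  have "degree p = n + (n - 1)"
    using A z by (simp add: p_def degree_mult_eq node_poly_neq_0 degree_node_poly B_def)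
  then have "degree p \<le> 2 * n - 1" using n by simp
  moreover have "p \<noteq> 0" using node_poly_neq_0 by (simp add: p_def B_def)
  moreover have "weighted_integral w p = 0"
    using orth'[of "-B"] dB by (simp add: p_def)
  moreover have "poly p t \<ge> 0" if "t \<in> {-1..1}" "t \<le> z" for t
  proof -
    have "poly p t = (z - t) * (poly B t)^2"
      by (simp add: p_def NA algebra_simps power2_eq_square)
    with that show ?thesis by simp
  qed
  ultimately have "\<exists>p. p \<noteq> 0 \<and> degree p \<le> 2 * n - 1 \<and> (\<forall>t\<in>{-1..1}. t \<le> z \<longrightarrow> poly p t \<ge> 0) \<and> weighted_integral w p \<le> 0"
    by (intro exI[of _ p]) simp
  moreover have "-1 < z" "z < 1" using z A(2) by auto
  ultimately show ?thesis
    using lower unfolding extremal_def z_def[symmetric] by blast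
qed

text \<open>
  Here \<open>P\<close> is orthogonal for the weight \<open>(1 + t) * w t\<close>. Subtracting a multiple of the square of the nodal
  polynomial makes \<open>p\<close> vanish at \<open>-1\<close>; the quotient by \<open>1 + t\<close> is then within the reach of Gauss
  quadrature for the new weight. The extremal polynomial is a multiple of \<open>(1 + t) P\<^sup>2 / (z - t)\<close>.
\<close>

lemma extremal_radau:
  assumes w: "weight w" and P: "P \<noteq> 0" "degree P \<le> n" and n: "n \<ge> 1"
    and orth: "\<And>q. degree q < n \<Longrightarrow> weighted_integral (\<lambda>t. (1 + t) * w t) (P * q) = 0"
  shows "extremal w (2 * n) (largest_zero P)"
proof -
  define w' where "w' = (\<lambda>t. (1 + t) * w t)"
  have w': "weight w'"
    using w unfolding weight_def w'_def by (auto intro!: continuous_intros)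
  have shift: "weighted_integral w' q = weighted_integral w ([:1, 1:] * q)" for q
    unfolding weighted_integral_def w'_def by (simp add: algebra_simps)
  note orth = orth[folded w'_def]
  obtain A c where A: "finite A" "A \<subseteq> {-1<..<1}" "card A = n" and c: "c \<noteq> 0"
    and PA: "P = smult c (node_poly A)"
    using orthogonal_poly_roots[OF w' P orth] by blast
  have "A \<noteq> {}" using A n by auto
  define z where "z = largest_zero P"
  have z: "z \<in> A" "\<And>a. a \<in> A \<Longrightarrow> a \<le> z"
    using largest_zero_orthogonal[OF A(1) \<open>A \<noteq> {}\<close> c PA] by (auto simp: z_def)
  have orth': "weighted_integral w' (node_poly A * q) = 0" if "degree q < card A" for q
    using orth[of q] that c A(3) by (simp add: PA weighted_integral_smult)
  have deg1: "degree ([:1, 1:] * q) = Suc (degree q)" if "q \<noteq> 0" for q :: "real poly"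
    using that by (simp add: degree_mult_eq del: mult_pCons_left)
  have lower: "p = 0" if p: "degree p \<le> 2 * n" "z < s" "\<forall>t\<in>{-1..1}. t \<le> s \<longrightarrow> poly p t \<ge> 0"
    "weighted_integral w p \<le> 0" for p s
  proof -
    define b where "b = poly (node_poly A * node_poly A) (-1)"
    have "b > 0"
      using A by (auto simp: b_def poly_node_poly zero_less_mult_iff less_le)
    \<comment> \<open>nonnegative, of degree \<open>2 * n\<close>, with value 1 at \<open>-1\<close> and 0 at the other nodes: its integral is the
      quadrature weight of \<open>-1\<close>\<close>
    define e where "e = smult (1 / b) (node_poly A * node_poly A)"
    have e: "poly e (-1) = 1" "weighted_integral w e > 0"
      using \<open>b > 0\<close> node_poly_neq_0 by (auto simp: e_def b_def intro!: weighted_integral_pos[OF w])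
    have ea: "poly e a = 0" if "a \<in> A" for a
      using A that by (auto simp: e_def poly_node_poly)
    have "poly (p - smult (poly p (-1)) e) (-1) = 0" using e by simp
    then obtain q where "p - smult (poly p (-1)) e = [:-(-1), 1:] * q"
      unfolding poly_eq_0_iff_dvd by (elim dvdE)
    then have q: "p = smult (poly p (-1)) e + [:1, 1:] * q" by (simp add: algebra_simps)
    have "degree (p - smult (poly p (-1)) e) \<le> 2 * n"
      using p(1) A(3) \<open>b > 0\<close>
      by (intro degree_diff_le order_trans[OF degree_smult_le])
        (auto simp: e_def degree_mult_eq node_poly_neq_0 degree_node_poly)
    then have dq: "degree q < 2 * card A"
      using deg1[of q] n A(3) \<open>p - smult (poly p (-1)) e = [:-(-1), 1:] * q\<close>
      by (cases "q = 0") (auto simp del: mult_pCons_left)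
    have wp: "weighted_integral w p = poly p (-1) * weighted_integral w e + weighted_integral w' q"
      by (subst q) (simp add: weighted_integral_add[OF w] weighted_integral_smult shift del: mult_pCons_left)
    obtain l where l: "\<And>a. a \<in> A \<Longrightarrow> l a > 0" "weighted_integral w' q = (\<Sum>a\<in>A. l a * poly q a)"
    proof (rule gauss_quadrature[OF w' A(1) orth'])
      fix l
      assume "\<And>a. a \<in> A \<Longrightarrow> l a > 0"
        "\<And>p. degree p < 2 * card A \<Longrightarrow> weighted_integral w' p = (\<Sum>a\<in>A. l a * poly p a)"
      with dq show thesis by (intro that[of l]) auto
    qed
    have "poly q a \<ge> 0" if "a \<in> A" for a
    proof -
      have a: "-1 < a" "a < 1" "a \<le> s" using z(2)[OF that] p(2) A(2) that by auto
      then have "poly p a \<ge> 0" using p(3) by simp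
      also have "poly p a = (1 + a) * poly q a"
        using ea[OF that] by (subst q) (simp add: algebra_simps)
      finally show ?thesis using a by (simp add: zero_le_mult_iff)
    qed
    then have "weighted_integral w' q \<ge> 0" unfolding l(2) using l(1) by (intro sum_nonneg) (auto simp: less_imp_le)
    moreover have "poly p (-1) \<ge> 0" using p(2,3) z A(2) by auto
    ultimately have p1: "poly p (-1) = 0"
      using wp p(4) e(2) by (smt (verit) mult_pos_pos)
    have pq: "p = [:1, 1:] * q" using q p1 by simp
    have "q = 0"
    proof (rule gauss_lower_bound[OF w' A(1,2) orth' dq, of s])
      show "weighted_integral w' q \<le> 0" using wp p(4) p1 by simp
      show "a < s" if "a \<in> A" for a using z(2)[OF that] p(2) by simp
      show "poly q t \<ge> 0" if "t \<in> {-1<..<1}" "t \<le> s" for t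
      proof -
        have "poly p t \<ge> 0" using that p(3) by simp
        also have "poly p t = (1 + t) * poly q t" by (subst pq) (simp add: algebra_simps)
        finally show ?thesis using that by (simp add: zero_le_mult_iff)
      qed
    qed
    then show ?thesis using pq by simp
  qed
  define B where "B = node_poly (A - {z})"
  have NA: "node_poly A = [:-z, 1:] * B"
    using A z by (simp add: node_poly_def prod.remove B_def)
  have dB: "degree B < card A"
    using z A n by (auto simp: B_def degree_node_poly)
  define p where "p = [:1, 1:] * (node_poly A * - B)"
  have "degree p = Suc (n + (n - 1))"
    using A z node_poly_neq_0 unfolding p_def
    by (subst deg1) (auto simp: degree_mult_eq degree_node_poly B_def)
  then have "degree p \<le> 2 * n" using n by simp
  moreover have "p \<noteq> 0" using node_poly_neq_0 by (simp add: p_def B_def del: mult_pCons_left)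
  moreover have "weighted_integral w p = 0"
    using orth'[of "-B"] dB by (simp only: p_def shift[symmetric] degree_minus)
  moreover have "poly p t \<ge> 0" if "t \<in> {-1..1}" "t \<le> z" for t
  proof -
    have "poly p t = (1 + t) * ((z - t) * (poly B t)^2)"
      by (simp add: p_def NA algebra_simps power2_eq_square)
    with that show ?thesis by simp
  qed
  ultimately have "\<exists>p. p \<noteq> 0 \<and> degree p \<le> 2 * n \<and> (\<forall>t\<in>{-1..1}. t \<le> z \<longrightarrow> poly p t \<ge> 0) \<and> weighted_integral w p \<le> 0"
    by (intro exI[of _ p]) simp
  moreover have "-1 < z" "z < 1" using z A(2) by auto
  ultimately show ?thesis
    using lower unfolding extremal_def z_def[symmetric] by blast
qed

section \<open>Jacobi polynomials\<close>

text \<open>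
  The exponent is kept a natural number and the square root is taken inside, which makes the weight
  continuous up to the endpoints also for \<open>m = 0\<close>, where \<open>0 powr 0 = 0\<close> would spoil it.
\<close>

definition zonal_weight :: "nat \<Rightarrow> real \<Rightarrow> real"
  where "zonal_weight m t = sqrt (1 - t\<^sup>2) ^ m"

lemma weight_zonal_weight: "weight (zonal_weight m)"
  unfolding weight_def
proof (intro conjI ballI)
  show "continuous_on {-1..1} (zonal_weight m)"
    unfolding zonal_weight_def[abs_def] by (intro continuous_intros)
  fix t :: real assume "t \<in> {-1<..<1}"
  then have "t\<^sup>2 < 1" by (simp add: abs_square_less_1 abs_less_iff)
  then show "zonal_weight m t > 0" by (simp add: zonal_weight_def)
qed

text \<open>
  The polynomial that remains when the powers of \<open>1 - t\<close> and \<open>1 + t\<close> are split off from the \<open>k\<close>-th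
  derivative of \<open>(1 - t) powr a * (1 + t) powr b\<close>; the recursion is the product rule.
\<close>

fun rodrigues_factor :: "real \<Rightarrow> real \<Rightarrow> nat \<Rightarrow> real poly" where
  "rodrigues_factor a b 0 = 1"
| "rodrigues_factor a b (Suc k) = pderiv (rodrigues_factor a b k) * [:1, 0, -1:]
     - smult (a - real k) ([:1, 1:] * rodrigues_factor a b k)
     + smult (b - real k) ([:1, -1:] * rodrigues_factor a b k)"

definition rodrigues_deriv :: "real \<Rightarrow> real \<Rightarrow> nat \<Rightarrow> real \<Rightarrow> real"
  where "rodrigues_deriv a b k t =
    (1 - t) powr (a - real k) * (1 + t) powr (b - real k) * poly (rodrigues_factor a b k) t"

lemma DERIV_rodrigues_deriv:
  assumes x: "x \<in> {-1<..<1}"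
  shows "(rodrigues_deriv a b k has_field_derivative rodrigues_deriv a b (Suc k) x) (at x)"
proof -
  define p where "p = rodrigues_factor a b k"
  define q where "q = pderiv p * [:1, 0, -1:] - smult (a - real k) ([:1, 1:] * p)
    + smult (b - real k) ([:1, -1:] * p)"
  have q: "rodrigues_factor a b (Suc k) = q" by (simp add: q_def p_def)
  define u v where "u = (1 - x) powr (a - real (Suc k))" and "v = (1 + x) powr (b - real (Suc k))"
  have uv: "(1 - x) powr (a - real k) = (1 - x) * u" "(1 + x) powr (b - real k) = (1 + x) * v"
    using x powr_add[of "1 - x" 1 "a - real (Suc k)"] powr_add[of "1 + x" 1 "b - real (Suc k)"]
    by (simp_all add: u_def v_def)
  have uv': "(1 - x) powr (a - real k - 1) = u" "(1 + x) powr (b - real k - 1) = v"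
    "(1 - x) powr (a - (1 + real k)) = u" "(1 + x) powr (b - (1 + real k)) = v"
    by (simp_all add: u_def v_def algebra_simps)
  have "((\<lambda>t. (1 - t) powr (a - real k) * (1 + t) powr (b - real k) * poly p t)
      has_field_derivative u * v * poly q x) (at x)"
    using x by (auto intro!: derivative_eq_intros poly_DERIV)
      (simp add: uv uv' q_def algebra_simps)
  then show ?thesis
    by (simp only: rodrigues_deriv_def[abs_def] q p_def[symmetric] u_def v_def)
qed

lemma higher_deriv_rodrigues:
  assumes "x \<in> {-1<..<1}"
  shows "(deriv ^^ k) (\<lambda>t. (1 - t) powr a * (1 + t) powr b) x = rodrigues_deriv a b k x"
  using assms
proof (induction k arbitrary: x)
  case 0
  then show ?case by (simp add: rodrigues_deriv_def)
next
  case (Suc k)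
  have "((deriv ^^ k) (\<lambda>t. (1 - t) powr a * (1 + t) powr b)
      has_field_derivative rodrigues_deriv a b (Suc k) x) (at x)"
    by (rule has_field_derivative_transform_within_open[OF DERIV_rodrigues_deriv, of _ "{-1<..<1}"])
      (use Suc in auto)
  then show ?case by (simp add: DERIV_imp_deriv)
qed

lemma degree_rodrigues_factor: "degree (rodrigues_factor a b k) \<le> k"
proof (induction k)
  case (Suc k)
  let ?p = "rodrigues_factor a b k"
  have "degree (pderiv ?p * [:1, 0, -1:]) \<le> Suc k"
  proof (cases "degree ?p = 0")
    case True
    then show ?thesis by (simp add: pderiv_eq_0_iff[THEN iffD2])
  next
    case False
    then show ?thesis
      using degree_mult_le[of "pderiv ?p" "[:1, 0, -1:]"] Suc by (simp add: degree_pderiv)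
  qed
  moreover have "degree ([:1, 1:] * ?p) \<le> Suc k" "degree ([:1, -1:] * ?p) \<le> Suc k"
    using degree_mult_le[of "[:1, 1:]" ?p] degree_mult_le[of "[:1, -1:]" ?p] Suc
    by (simp_all del: mult_pCons_left)
  ultimately show ?case
    by (auto intro!: degree_add_le degree_diff_le order_trans[OF degree_smult_le]
        simp del: mult_pCons_left mult_pCons_right)
qed simp

text \<open>
  At the point 1 the recursion degenerates to a product, which is the easiest way to see that Jacobi
  polynomials do not vanish identically.
\<close>

lemma poly_rodrigues_factor_1: "poly (rodrigues_factor a b k) 1 = (\<Prod>i<k. -2 * (a - real i))"
  by (induction k) (simp_all add: algebra_simps)

lemma rodrigues_deriv_endpoint_continuous:
  assumes "real k < a" "real k < b"
  shows "continuous_on {-1..1} (rodrigues_deriv a b k)"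
  unfolding rodrigues_deriv_def[abs_def] using assms
  by (intro continuous_intros continuous_on_powr') auto

text \<open>
  Integration by parts lowers the order of the derivative and the degree of \<open>q\<close> at the same time; the
  boundary terms vanish since the remaining exponents are positive.
\<close>

lemma rodrigues_deriv_orthogonal:
  assumes "real k < a + 1" "real k < b + 1" "q = 0 \<or> degree q < k"
  shows "((\<lambda>t. rodrigues_deriv a b k t * poly q t) has_integral 0) {-1..1}"
  using assms
proof (induction k arbitrary: q)
  case 0
  then show ?case by simp
next
  case (Suc k)
  let ?F = "\<lambda>t. rodrigues_deriv a b k t * poly q t"
  have k: "real k < a" "real k < b" using Suc.prems by auto
  have 1: "((\<lambda>t. rodrigues_deriv a b (Suc k) t * poly q t + rodrigues_deriv a b k t * poly (pderiv q) t)
      has_integral (?F 1 - ?F (-1))) {-1..1}"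
  proof (rule fundamental_theorem_of_calculus_interior)
    show "continuous_on {-1..1} ?F"
      by (intro continuous_intros rodrigues_deriv_endpoint_continuous k)
    fix x :: real assume "x \<in> {-1<..<1}"
    then show "(?F has_vector_derivative
        rodrigues_deriv a b (Suc k) x * poly q x + rodrigues_deriv a b k x * poly (pderiv q) x) (at x)"
      unfolding has_real_derivative_iff_has_vector_derivative[symmetric]
      by (auto intro!: derivative_eq_intros DERIV_rodrigues_deriv poly_DERIV)
  qed simp
  have 2: "?F 1 = 0" "?F (-1) = 0" by (simp_all add: rodrigues_deriv_def)
  have 3: "((\<lambda>t. rodrigues_deriv a b k t * poly (pderiv q) t) has_integral 0) {-1..1}"
  proof (rule Suc.IH)
    show "pderiv q = 0 \<or> degree (pderiv q) < k"
      using Suc.prems(3) by (cases "degree q = 0") (auto simp: degree_pderiv pderiv_eq_0_iff)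
  qed (use k in auto)
  show ?case using has_integral_diff[OF 1 3] unfolding 2 by simp
qed

lemma jacobi_poly_eq:
  "jacobi_poly n \<alpha> \<beta> = smult ((-1) ^ n / (2 ^ n * fact n))
     (rodrigues_factor (real n + \<alpha>) (real n + \<beta>) n)" (is "_ = ?q")
proof -
  have eq: "poly (jacobi_poly n \<alpha> \<beta>) x = poly ?q x" if x: "x \<in> {-1<..<1}" for x
  proof -
    have "(1 - x) powr \<alpha> \<noteq> 0" "(1 + x) powr \<beta> \<noteq> 0" using x by auto
    then show ?thesis
      unfolding poly_jacobi_poly[OF x] rodrigues_def higher_deriv_rodrigues[OF x]
        rodrigues_deriv_def powr_minus
      by (simp add: divide_simps)
  qed
  have "jacobi_poly n \<alpha> \<beta> - ?q = 0"
  proof (rule poly_zero_on_interval[of "-1" 1])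
    fix t :: real assume t: "t \<in> {-1<..<1}"
    show "poly (jacobi_poly n \<alpha> \<beta> - ?q) t = 0"
      unfolding poly_diff eq[OF t] by (rule diff_self)
  qed simp
  then show ?thesis by simp
qed

lemma degree_jacobi_poly: "degree (jacobi_poly n \<alpha> \<beta>) \<le> n"
  unfolding jacobi_poly_eq using degree_rodrigues_factor by simp

lemma jacobi_poly_neq_0:
  assumes "\<alpha> > -1"
  shows "jacobi_poly n \<alpha> \<beta> \<noteq> 0"
proof -
  have "poly (rodrigues_factor (real n + \<alpha>) (real n + \<beta>) n) 1 \<noteq> 0"
    using assms by (auto simp: poly_rodrigues_factor_1)
  then have "rodrigues_factor (real n + \<alpha>) (real n + \<beta>) n \<noteq> 0" by auto
  then show ?thesis unfolding jacobi_poly_eq by simp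
qed

lemma jacobi_poly_orthogonal:
  assumes "\<alpha> > -1" "\<beta> > -1" "degree q < n"
  shows "((\<lambda>t. poly (jacobi_poly n \<alpha> \<beta> * q) t * ((1 - t) powr \<alpha> * (1 + t) powr \<beta>)) has_integral 0) {-1..1}"
proof -
  have "((\<lambda>t. (-1) ^ n / (2 ^ n * fact n) *
      (rodrigues_deriv (real n + \<alpha>) (real n + \<beta>) n t * poly q t)) has_integral
      (-1) ^ n / (2 ^ n * fact n) * 0) {-1..1}"
    using assms by (intro has_integral_mult_right rodrigues_deriv_orthogonal) auto
  then show ?thesis
    by (simp add: jacobi_poly_eq rodrigues_deriv_def algebra_simps)
qed

text \<open>
  Only in the open interval: at the endpoints the two sides differ for \<open>m = 0\<close>.
\<close>

lemma powr_half_zonal_weight: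
  assumes t: "t \<in> {-1<..<1}" and \<alpha>: "\<alpha> = real m / 2"
  shows "(1 - t) powr \<alpha> * (1 + t) powr \<alpha> = zonal_weight m t"
proof -
  have "1 - t > 0" "1 + t > 0" using t by auto
  then have "(1 - t) powr \<alpha> * (1 + t) powr \<alpha> = ((1 - t) * (1 + t)) powr \<alpha>"
    by (simp add: powr_mult)
  also have "(1 - t) * (1 + t) = 1 - t\<^sup>2" by (simp add: power2_eq_square algebra_simps)
  also have "(1 - t\<^sup>2) powr \<alpha> = ((1 - t\<^sup>2) powr (1/2)) powr real m"
    by (simp add: powr_powr \<alpha>)
  also have "\<dots> = sqrt (1 - t\<^sup>2) powr real m"
    using t by (subst powr_half_sqrt) (auto simp: abs_square_le_1 abs_le_iff)
  also have "\<dots> = sqrt (1 - t\<^sup>2) ^ m"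
    using t by (intro powr_realpow) (auto simp: abs_square_less_1 abs_less_iff)
  finally show ?thesis by (simp add: zonal_weight_def)
qed

lemma weighted_integral_jacobi_eq_0:
  assumes \<alpha>: "\<alpha> > -1" "\<beta> > -1" and q: "degree q < n"
    and w: "\<And>t. t \<in> {-1<..<1} \<Longrightarrow> w t = (1 - t) powr \<alpha> * (1 + t) powr \<beta>"
  shows "weighted_integral w (jacobi_poly n \<alpha> \<beta> * q) = 0"
  unfolding weighted_integral_def
proof (rule integral_unique)
  show "((\<lambda>t. poly (jacobi_poly n \<alpha> \<beta> * q) t * w t) has_integral 0) {-1..1}"
    by (rule has_integral_spike_finite[OF _ _ jacobi_poly_orthogonal[OF \<alpha> q], of "{-1, 1}"])
      (auto simp: w)
qed

section \<open>Trigonometric polynomials on the circle\<close>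

text \<open>
  Common frame of the two problems: a lower bound for every admissible radius of every function in the
  class, together with one function that attains it.
\<close>

lemma INF_last_sign_change_eq:
  assumes lower: "\<And>f r. f \<in> F \<Longrightarrow> r > 0 \<Longrightarrow> nonneg_outside X \<delta> p f r \<Longrightarrow> r0 \<le> r"
    and ev: "\<And>f. f \<in> F \<Longrightarrow> eventually_nonneg X \<delta> p f"
    and g: "g \<in> F" "r0 > 0" "nonneg_outside X \<delta> p g r0"
  shows "(INF f \<in> F. last_sign_change X \<delta> p f) = r0"
proof -
  have ge: "r0 \<le> last_sign_change X \<delta> p f" if "f \<in> F" for f
    unfolding last_sign_change_def
    by (rule cInf_greatest) (use lower ev that in \<open>auto simp: eventually_nonneg_def\<close>)
  have "last_sign_change X \<delta> p g \<le> r0"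
    unfolding last_sign_change_def
    by (rule cInf_lower) (use g in \<open>auto intro!: bdd_belowI[of _ 0]\<close>)
  then have "(INF f \<in> F. last_sign_change X \<delta> p f) \<le> r0"
    by (intro cINF_lower2[OF _ g(1)]) (use ge in \<open>auto intro!: bdd_belowI2[of _ r0]\<close>)
  moreover have "r0 \<le> (INF f \<in> F. last_sign_change X \<delta> p f)"
    by (rule cINF_greatest) (use ge g in auto)
  ultimately show ?thesis by simp
qed

fun chebyshev_T :: "nat \<Rightarrow> real poly" where
  "chebyshev_T 0 = 1"
| "chebyshev_T (Suc 0) = [:0, 1:]"
| "chebyshev_T (Suc (Suc n)) = [:0, 2:] * chebyshev_T (Suc n) - chebyshev_T n"

text \<open>
  The Chebyshev polynomials of the second kind with the index shifted by one, so that
  \<open>sin (n t) = sin t * V n (cos t)\<close> also makes sense for \<open>n = 0\<close>.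
\<close>

fun chebyshev_V :: "nat \<Rightarrow> real poly" where
  "chebyshev_V 0 = 0"
| "chebyshev_V (Suc 0) = 1"
| "chebyshev_V (Suc (Suc n)) = [:0, 2:] * chebyshev_V (Suc n) - chebyshev_V n"

lemma degree_chebyshev_T: "degree (chebyshev_T n) \<le> n"
proof (induction n rule: chebyshev_T.induct)
  case (3 n)
  have "degree ([:0, 2:] * chebyshev_T (Suc n)) \<le> Suc (Suc n)"
    using degree_mult_le[of "[:0, 2:]" "chebyshev_T (Suc n)"] 3(1) by (simp del: mult_pCons_left)
  with 3(2) show ?case by (auto intro!: degree_diff_le simp del: mult_pCons_left)
qed auto

lemma cos_chebyshev_T: "cos (real n * t) = poly (chebyshev_T n) (cos t)"
proof (induction n rule: chebyshev_T.induct)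
  case (3 n)
  have "cos (real (Suc (Suc n)) * t) = 2 * cos t * cos (real (Suc n) * t) - cos (real n * t)"
    using cos_add[of "real (Suc n) * t" t] cos_diff[of "real (Suc n) * t" t]
    by (simp add: algebra_simps)
  then show ?case by (simp only: 3) simp
qed auto

lemma sin_chebyshev_V: "sin (real n * t) = sin t * poly (chebyshev_V n) (cos t)"
proof (induction n rule: chebyshev_V.induct)
  case (3 n)
  have "sin (real (Suc (Suc n)) * t) = 2 * cos t * sin (real (Suc n) * t) - sin (real n * t)"
    using sin_add[of "real (Suc n) * t" t] sin_diff[of "real (Suc n) * t" t]
    by (simp add: algebra_simps)
  then show ?case by (simp only: 3) (simp add: algebra_simps)
qed auto

lemma trig_poly_even_odd:
  assumes "trig_poly N f"
  obtains p q where "degree p \<le> N"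
    "\<And>x. f x = poly p (cos (2 * pi * x)) + sin (2 * pi * x) * poly q (cos (2 * pi * x))"
proof -
  obtain c :: "int \<Rightarrow> complex" where c: "\<And>x. complex_of_real (f x) =
      (\<Sum>n = - int N..int N. c n * exp (2 * complex_of_real pi * \<i> * of_int n * of_real x))"
    using assms unfolding trig_poly_def by blast
  define p where "p = (\<Sum>n = - int N..int N. smult (Re (c n)) (chebyshev_T (nat \<bar>n\<bar>)))"
  define q where "q = (\<Sum>n = - int N..int N. smult (- (Im (c n) * of_int (sgn n))) (chebyshev_V (nat \<bar>n\<bar>)))"
  have "degree p \<le> N"
    unfolding p_def
    by (intro degree_sum_le order_trans[OF degree_smult_le] order_trans[OF degree_chebyshev_T]) auto
  moreover have "f x = poly p (cos (2 * pi * x)) + sin (2 * pi * x) * poly q (cos (2 * pi * x))" for x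
  proof -
    define t where "t = 2 * pi * x"
    have summand: "Re (c n * exp (2 * complex_of_real pi * \<i> * of_int n * of_real x)) =
        Re (c n) * poly (chebyshev_T (nat \<bar>n\<bar>)) (cos t)
        + sin t * (- (Im (c n) * of_int (sgn n)) * poly (chebyshev_V (nat \<bar>n\<bar>)) (cos t))" for n
    proof -
      have "2 * complex_of_real pi * \<i> * of_int n * of_real x = \<i> * of_real (of_int n * t)"
        by (simp add: t_def)
      then have "exp (2 * complex_of_real pi * \<i> * of_int n * of_real x) = cis (of_int n * t)"
        by (simp only: cis_conv_exp)
      moreover have "cos (of_int n * t) = poly (chebyshev_T (nat \<bar>n\<bar>)) (cos t)"
        using cos_chebyshev_T[of "nat \<bar>n\<bar>" t] by (cases "n \<ge> 0") auto
      moreover have "sin (of_int n * t) = of_int (sgn n) * (sin t * poly (chebyshev_V (nat \<bar>n\<bar>)) (cos t))"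
        using sin_chebyshev_V[of "nat \<bar>n\<bar>" t] by (cases n "0 :: int" rule: linorder_cases) auto
      ultimately show ?thesis by simp
    qed
    have "f x = Re (complex_of_real (f x))" by simp
    also have "\<dots> = (\<Sum>n = - int N..int N. Re (c n * exp (2 * complex_of_real pi * \<i> * of_int n * of_real x)))"
      unfolding c by simp
    also have "\<dots> = poly p (cos t) + sin t * poly q (cos t)"
      unfolding summand p_def q_def poly_sum sum.distrib sum_distrib_left by simp
    finally show ?thesis unfolding t_def .
  qed
  ultimately show thesis by (rule that)
qed

lemma trig_poly_const: "trig_poly N (\<lambda>x. a)"
proof -
  have "(\<Sum>n = - int N..int N. (if n = 0 then complex_of_real a else 0)
      * exp (2 * complex_of_real pi * \<i> * of_int n * of_real x)) = complex_of_real a" for x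
    by (subst sum.mono_neutral_right[of _ "{0}"]) auto
  then show ?thesis
    unfolding trig_poly_def by (intro exI[of _ "\<lambda>n. if n = 0 then complex_of_real a else 0"]) simp
qed

lemma trig_poly_add:
  assumes "trig_poly N f" "trig_poly N g"
  shows "trig_poly N (\<lambda>x. f x + g x)"
proof -
  obtain c d :: "int \<Rightarrow> complex" where
    "\<And>x. complex_of_real (f x) =
      (\<Sum>n = - int N..int N. c n * exp (2 * complex_of_real pi * \<i> * of_int n * of_real x))"
    "\<And>x. complex_of_real (g x) =
      (\<Sum>n = - int N..int N. d n * exp (2 * complex_of_real pi * \<i> * of_int n * of_real x))"
    using assms unfolding trig_poly_def by blast
  then show ?thesis unfolding trig_poly_def
    by (intro exI[of _ "\<lambda>n. c n + d n"]) (simp add: ring_distribs sum.distrib)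
qed

text \<open>
  Multiplication by a cosine shifts the frequencies by one in both directions.
\<close>

lemma trig_poly_cos_mult:
  assumes "trig_poly N f"
  shows "trig_poly (Suc N) (\<lambda>x. cos (2 * pi * x) * f x)"
proof -
  define e where "e n x = exp (2 * complex_of_real pi * \<i> * of_int n * of_real x)" for n :: int and x :: real
  obtain c :: "int \<Rightarrow> complex" where c:
    "\<And>x. complex_of_real (f x) = (\<Sum>n = - int N..int N. c n * e n x)"
    using assms unfolding trig_poly_def e_def by blast
  \<comment> \<open>outside the range of summation \<open>c\<close> is arbitrary, so it has to be cut off before shifting\<close>
  define d where "d n = (if \<bar>n\<bar> \<le> int N then c n else 0)" for n
  have shift: "(\<Sum>n = - int (Suc N)..int (Suc N). d (n + k) * e n x) = (\<Sum>n = - int N..int N. c n * e (n - k) x)"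
    if k: "\<bar>k\<bar> = 1" for k x
  proof -
    have "(\<Sum>n = - int (Suc N)..int (Suc N). d (n + k) * e n x)
        = (\<Sum>n = - int N - k..int N - k. d (n + k) * e n x)"
      using k by (intro sum.mono_neutral_right) (auto simp: d_def)
    also have "\<dots> = (\<Sum>n = - int N..int N. d n * e (n - k) x)"
      by (rule sum.reindex_bij_witness[of _ "\<lambda>n. n - k" "\<lambda>n. n + k"]) auto
    also have "\<dots> = (\<Sum>n = - int N..int N. c n * e (n - k) x)"
      by (intro sum.cong) (auto simp: d_def)
    finally show ?thesis .
  qed
  have "complex_of_real (cos (2 * pi * x) * f x) =
      (\<Sum>n = - int (Suc N)..int (Suc N). (d (n + 1) + d (n + (-1))) / 2 * e n x)" for x
  proof -
    have "complex_of_real (cos (2 * pi * x)) = (e 1 x + e (-1) x) / 2"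
      by (simp add: e_def cos_of_real[symmetric] cos_exp_eq algebra_simps)
    moreover have "e (n - 1) x = e n x * e (-1) x" "e (n + 1) x = e n x * e 1 x" for n
      by (simp_all add: e_def exp_add[symmetric] algebra_simps)
    ultimately have "complex_of_real (cos (2 * pi * x) * f x) =
       ((\<Sum>n = - int N..int N. c n * e (n - 1) x) + (\<Sum>n = - int N..int N. c n * e (n - (-1)) x)) / 2"
      by (simp add: c sum_distrib_left sum.distrib[symmetric] algebra_simps add_divide_distrib sum_divide_distrib)
    also have "\<dots> = (\<Sum>n = - int (Suc N)..int (Suc N). (d (n + 1) + d (n + (-1))) / 2 * e n x)"
      by (subst (1 2) shift[symmetric]) (simp_all add: sum.distrib[symmetric] sum_divide_distrib algebra_simps add_divide_distrib)
    finally show ?thesis .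
  qed
  then have "\<forall>x. complex_of_real (cos (2 * pi * x) * f x) =
      (\<Sum>n = - int (Suc N)..int (Suc N). (d (n + 1) + d (n + (-1))) / 2 * e n x)" by (rule allI)
  then show ?thesis unfolding trig_poly_def e_def
    by (rule exI[of _ "\<lambda>n. (d (n + 1) + d (n + (-1))) / 2"])
qed

lemma trig_poly_cos_poly:
  "degree p \<le> N \<Longrightarrow> trig_poly N (\<lambda>x. poly p (cos (2 * pi * x)))"
proof (induction N arbitrary: p)
  case 0
  then obtain a where "p = [:a:]" using degree_eq_zeroE by blast
  then show ?case by (simp add: trig_poly_const)
next
  case (Suc N)
  obtain a q where p: "p = pCons a q" by (rule pCons_cases)
  with Suc.prems have "degree q \<le> N" by (cases "q = 0") auto
  then show ?case
    using trig_poly_add[OF trig_poly_const[of "Suc N" a] trig_poly_cos_mult[OF Suc.IH]] by (simp add: p)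
qed

lemma circle_dist_0_half:
  assumes "0 \<le> y" "y \<le> 1/2"
  shows "circle_dist 0 y = y" "circle_dist 0 (- y) = y"
proof -
  have ge: "y \<le> \<bar>s - of_int k\<bar>" if "s = y \<or> s = - y" for s and k :: int
  proof (cases "k = 0")
    case False
    then have "\<bar>of_int k\<bar> \<ge> (1::real)" by linarith
    then show ?thesis using that assms by linarith
  qed (use that assms in auto)
  have ne: "(\<int> :: real set) \<noteq> {}" using Ints_0 by blast
  have "infdist s \<int> = y" if "s = y \<or> s = - y" for s :: real
  proof (rule antisym)
    show "infdist s \<int> \<le> y"
      using infdist_le[of 0 "\<int>" s] that assms by (auto simp: dist_real_def)
    show "y \<le> infdist s \<int>"
      unfolding infdist_notempty[OF ne]
      using ge[OF that] by (intro cINF_greatest) (auto simp: dist_real_def elim!: Ints_cases)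
  qed
  then show "circle_dist 0 y = y" "circle_dist 0 (- y) = y"
    by (auto simp: circle_dist_def)
qed

text \<open>
  The representative \<open>z\<close> of \<open>x\<close> closest to 0 has \<open>r \<le> \<bar>z\<bar> \<le> 1/2\<close>, and the cosine decreases on half a
  period.
\<close>

lemma circle_dist_ge_imp_cos_le:
  assumes "circle_dist 0 x \<ge> r" "0 \<le> r"
  shows "cos (2 * pi * x) \<le> cos (2 * pi * r)"
proof -
  define z where "z = x - of_int (round x)"
  have z: "\<bar>z\<bar> \<le> 1/2"
    using of_int_round_abs_le[of x] by (simp add: z_def abs_minus_commute)
  have "circle_dist 0 x \<le> \<bar>z\<bar>"
    using infdist_le[of "- of_int (round x)" "\<int>" "- x"]
    by (simp add: circle_dist_def z_def dist_real_def)
  then have rz: "r \<le> \<bar>z\<bar>" using assms by simp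
  have "2 * pi * x = 2 * pi * z + 2 * pi * of_int (round x)"
    by (simp add: z_def algebra_simps)
  then have "cos (2 * pi * x) = cos (2 * pi * z)"
    using cos.plus_of_int[of "2 * pi * z" "round x"] by (simp add: mult.commute)
  also have "\<dots> = cos \<bar>2 * pi * z\<bar>" by simp
  also have "\<bar>2 * pi * z\<bar> = 2 * pi * \<bar>z\<bar>" by (simp add: abs_mult)
  also have "cos (2 * pi * \<bar>z\<bar>) \<le> cos (2 * pi * r)"
    using rz z assms by (intro cos_monotone_0_pi_le) auto
  finally show ?thesis .
qed

text \<open>
  Substitution \<open>t = cos (2 \<pi> x)\<close> on the two halves of the period separately. An antiderivative of \<open>v\<close> is
  differentiable in the open interval only, so the fundamental theorem is used with continuity at the
  endpoints.
\<close>

lemma has_integral_cos_substitution: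
  fixes v :: "real \<Rightarrow> real"
  assumes v: "continuous_on {-1..1} v"
  defines "I \<equiv> integral {-1..1} v / (2 * pi)"
  shows "((\<lambda>x. v (cos (2 * pi * x)) * \<bar>sin (2 * pi * x)\<bar>) has_integral I) {0..1/2}"
    and "((\<lambda>x. v (cos (2 * pi * x)) * \<bar>sin (2 * pi * x)\<bar>) has_integral I) {1/2..1}"
proof -
  define V where "V t = integral {-1..t} v" for t
  have contV: "continuous_on {-1..1} V"
    unfolding V_def by (rule indefinite_integral_continuous_1) (rule integrable_continuous_real[OF v])
  have derivV: "(V has_field_derivative v t) (at t)" if "t \<in> {-1<..<1}" for t
  proof -
    have "(V has_vector_derivative v t) (at t within {-1..1})"
      unfolding V_def using that by (intro integral_has_vector_derivative[OF v]) auto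
    moreover have "at t within {-1..1} = at t"
      using that by (intro at_within_interior) auto
    ultimately show ?thesis by (simp add: has_real_derivative_iff_has_vector_derivative)
  qed
  have deriv: "((\<lambda>x. V (cos (2 * pi * x)) / (2 * pi)) has_field_derivative
      - v (cos (2 * pi * x)) * sin (2 * pi * x)) (at x)" if "sin (2 * pi * x) \<noteq> 0" for x
  proof -
    have "(sin (2 * pi * x))\<^sup>2 > 0" using that by simp
    then have "(cos (2 * pi * x))\<^sup>2 < 1" unfolding sin_squared_eq by linarith
    then have "cos (2 * pi * x) \<in> {-1<..<1}" by (auto simp: abs_square_less_1 abs_less_iff)
    then show ?thesis
      by (auto intro!: derivative_eq_intros DERIV_chain2[OF derivV])
  qed
  have cont: "continuous_on S (\<lambda>x. V (cos (2 * pi * x)) / (2 * pi))" for S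
    by (intro continuous_intros continuous_on_compose2[OF contV]) auto
  have V: "V 1 / (2 * pi) = I" "V (-1) = 0" by (simp_all add: V_def I_def)
  have "((\<lambda>x. v (cos (2 * pi * x)) * \<bar>sin (2 * pi * x)\<bar>) has_integral
      (- (V (cos (2 * pi * (1/2))) / (2 * pi)) - (- (V (cos (2 * pi * 0)) / (2 * pi))))) {0..1/2}"
  proof (rule fundamental_theorem_of_calculus_interior)
    fix x :: real assume x: "x \<in> {0<..<1/2}"
    then have "sin (2 * pi * x) > 0" by (intro sin_gt_zero) auto
    then show "((\<lambda>x. - (V (cos (2 * pi * x)) / (2 * pi))) has_vector_derivative
        v (cos (2 * pi * x)) * \<bar>sin (2 * pi * x)\<bar>) (at x)"
      unfolding has_real_derivative_iff_has_vector_derivative[symmetric]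
      using DERIV_minus[OF deriv[of x]] by simp
  qed (auto intro!: continuous_on_minus cont)
  then show "((\<lambda>x. v (cos (2 * pi * x)) * \<bar>sin (2 * pi * x)\<bar>) has_integral I) {0..1/2}"
    by (simp add: V)
  have "((\<lambda>x. v (cos (2 * pi * x)) * \<bar>sin (2 * pi * x)\<bar>) has_integral
      (V (cos (2 * pi * 1)) / (2 * pi) - (V (cos (2 * pi * (1/2))) / (2 * pi)))) {1/2..1}"
  proof (rule fundamental_theorem_of_calculus_interior)
    fix x :: real assume x: "x \<in> {1/2<..<1}"
    then have "sin (2 * pi * x) < 0" by (intro sin_lt_zero) auto
    then show "((\<lambda>x. V (cos (2 * pi * x)) / (2 * pi)) has_vector_derivative
        v (cos (2 * pi * x)) * \<bar>sin (2 * pi * x)\<bar>) (at x)"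
      unfolding has_real_derivative_iff_has_vector_derivative[symmetric]
      using deriv[of x] by simp
  qed (auto intro!: cont)
  then show "((\<lambda>x. v (cos (2 * pi * x)) * \<bar>sin (2 * pi * x)\<bar>) has_integral I) {1/2..1}"
    by (simp add: V)
qed

lemma zonal_weight_cos: "zonal_weight m (cos t) = \<bar>sin t\<bar> ^ m"
  by (simp add: zonal_weight_def sin_squared_eq[symmetric])

text \<open>
  The odd part contributes \<open>J\<close> on the first half of the period and \<open>- J\<close> on the second.
\<close>

lemma has_integral_circle:
  assumes f: "\<And>x. f x = poly p (cos (2 * pi * x)) + sin (2 * pi * x) * poly q (cos (2 * pi * x))"
  shows "((\<lambda>x. f x * \<bar>sin (2 * pi * x)\<bar> ^ Suc m) has_integral weighted_integral (zonal_weight m) p / pi) {0..1}"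
proof -
  let ?c = "\<lambda>x. cos (2 * pi * x)" and ?s = "\<lambda>x. \<bar>sin (2 * pi * x)\<bar>"
  define u v where "u t = poly p t * zonal_weight m t" and "v t = poly q t * zonal_weight (Suc m) t" for t
  have cw: "continuous_on {-1..1} (zonal_weight k)" for k
    using weight_zonal_weight[of k] unfolding weight_def by blast
  have cont: "continuous_on {-1..1} u" "continuous_on {-1..1} v"
    unfolding u_def[abs_def] v_def[abs_def] by (intro continuous_intros cw)+
  have u: "integral {-1..1} u = weighted_integral (zonal_weight m) p"
    by (simp add: u_def[abs_def] weighted_integral_def)
  define J where "J = integral {-1..1} v / (2 * pi)"
  have "((\<lambda>x. u (?c x) * ?s x + v (?c x) * ?s x) has_integral
      weighted_integral (zonal_weight m) p / (2 * pi) + J) {0..1/2}"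
    unfolding J_def u[symmetric] by (intro has_integral_add has_integral_cos_substitution cont)
  moreover have "u (?c x) * ?s x + v (?c x) * ?s x = f x * ?s x ^ Suc m" if "x \<in> {0..1/2}" for x
  proof -
    have "sin (2 * pi * x) \<ge> 0" using that by (intro sin_ge_zero) auto
    then show ?thesis by (simp add: u_def v_def zonal_weight_cos f algebra_simps)
  qed
  ultimately have 1: "((\<lambda>x. f x * ?s x ^ Suc m) has_integral
      weighted_integral (zonal_weight m) p / (2 * pi) + J) {0..1/2}"
    by (rule has_integral_eq[rotated])
  have "((\<lambda>x. u (?c x) * ?s x - v (?c x) * ?s x) has_integral
      weighted_integral (zonal_weight m) p / (2 * pi) - J) {1/2..1}"
    unfolding J_def u[symmetric] by (intro has_integral_diff has_integral_cos_substitution cont)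
  moreover have "u (?c x) * ?s x - v (?c x) * ?s x = f x * ?s x ^ Suc m" if "x \<in> {1/2..1}" for x
  proof -
    have "sin (2 * pi * x - pi) \<ge> 0" using that by (intro sin_ge_zero) auto
    then have "sin (2 * pi * x) \<le> 0" by (simp add: sin_diff)
    then show ?thesis by (simp add: u_def v_def zonal_weight_cos f algebra_simps)
  qed
  ultimately have 2: "((\<lambda>x. f x * ?s x ^ Suc m) has_integral
      weighted_integral (zonal_weight m) p / (2 * pi) - J) {1/2..1}"
    by (rule has_integral_eq[rotated])
  have "((\<lambda>x. f x * ?s x ^ Suc m) has_integral
      (weighted_integral (zonal_weight m) p / (2 * pi) + J) + (weighted_integral (zonal_weight m) p / (2 * pi) - J)) {0..1}"
    by (rule has_integral_combine[OF _ _ 1 2]) auto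
  then show ?thesis by simp
qed

lemma integral_polar_measure:
  assumes C: "C > 0"
    and f: "\<And>x. f x = poly p (cos (2 * pi * x)) + sin (2 * pi * x) * poly q (cos (2 * pi * x))"
  shows "(\<integral>x. f x \<partial>polar_measure C (Suc m)) = C / pi * weighted_integral (zonal_weight m) p"
proof -
  let ?g = "\<lambda>x. f x * \<bar>sin (2 * pi * x)\<bar> ^ Suc m"
  have fc: "continuous_on S f" for S
    unfolding f[abs_def] by (intro continuous_intros)
  have fm [measurable]: "f \<in> borel_measurable borel"
    by (intro borel_measurable_continuous_onI fc)
  have gc: "continuous_on S ?g" for S
    by (intro continuous_intros fc)
  have "set_integrable lborel {0..1} ?g"
    by (intro borel_integrable_atLeastAtMost' gc)
  then have gi: "set_integrable lborel {0..<1} ?g"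
    by (rule set_integrable_subset) auto
  have "(\<integral>x. f x \<partial>polar_measure C (Suc m)) =
      (\<integral>x. (C * \<bar>sin (2 * pi * x)\<bar> ^ Suc m) *\<^sub>R f x \<partial>restrict_space lborel {0..<1})"
    unfolding polar_measure_def using C
    by (subst integral_density) (auto intro!: measurable_restrict_space1 AE_I2)
  also have "\<dots> = (\<integral>x. C * ?g x \<partial>restrict_space lborel {0..<1})"
    by (intro Bochner_Integration.integral_cong) auto
  also have "\<dots> = C * (LINT x:{0..<1}|lborel. ?g x)"
    by (simp add: integral_restrict_space set_lebesgue_integral_def)
  also have "(LINT x:{0..<1}|lborel. ?g x) = integral {0..<1} ?g"
    by (rule set_borel_integral_eq_integral[OF gi])
  also have "integral {0..<1} ?g = integral {0..1} ?g"
    by (rule integral_subset_negligible) (auto intro: negligible_subset[of "{1}"])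
  also have "\<dots> = weighted_integral (zonal_weight m) p / pi"
    using has_integral_circle[OF f, of m] by (rule integral_unique)
  finally show ?thesis by simp
qed

text \<open>
  A competitor with radius \<open>r\<close> gives \<open>f (y) + f (- y) = 2 p (cos (2 \<pi> y))\<close>, a polynomial that is
  nonnegative up to \<open>cos (2 \<pi> r)\<close>.
\<close>

lemma circle_rho_eq:
  assumes C: "C > 0" and z: "extremal (zonal_weight m) N z"
  shows "circle_rho (polar_measure C (Suc m)) N = arccos z / (2 * pi)"
proof -
  have z1: "-1 < z" "z < 1" using z unfolding extremal_def by blast+
  obtain g where g: "g \<noteq> 0" "degree g \<le> N" "weighted_integral (zonal_weight m) g \<le> 0"
    "\<And>t. t \<in> {-1..1} \<Longrightarrow> t \<le> z \<Longrightarrow> poly g t \<ge> 0"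
    using z unfolding extremal_def by blast
  let ?g = "\<lambda>x. poly g (cos (2 * pi * x))"
  have pos: "arccos z / (2 * pi) > 0"
    using z1 arccos_less_arccos[of z 1] by simp
  have nn: "nonneg_outside UNIV circle_dist 0 ?g (arccos z / (2 * pi))"
    unfolding nonneg_outside_def
  proof
    fix x assume "x \<in> UNIV - {y \<in> UNIV. circle_dist 0 y < arccos z / (2 * pi)}"
    then have "cos (2 * pi * x) \<le> cos (2 * pi * (arccos z / (2 * pi)))"
      using z1 by (intro circle_dist_ge_imp_cos_le) (auto simp: arccos_lbound)
    also have "\<dots> = z" using z1 by simp
    finally show "?g x \<ge> 0" by (intro g(4)) auto
  qed
  have g0: "\<exists>x. ?g x \<noteq> 0"
  proof (rule ccontr)
    assume "\<nexists>x. ?g x \<noteq> 0"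
    then have 0: "poly g (cos (2 * pi * x)) = 0" for x by blast
    have "poly g t = 0" if "t \<in> {-1..1}" for t
      using 0[of "arccos t / (2 * pi)"] that by simp
    then have "g = 0" by (intro poly_zero_on_interval[of "-1" 1]) auto
    with g(1) show False ..
  qed
  have "(\<integral>x. ?g x \<partial>polar_measure C (Suc m)) = C / pi * weighted_integral (zonal_weight m) g"
    by (rule integral_polar_measure[OF C, of _ _ 0]) simp
  then have "(\<integral>x. ?g x \<partial>polar_measure C (Suc m)) \<le> 0"
    using g(3) C by (simp add: mult_le_0_iff divide_le_0_iff)
  moreover have "eventually_nonneg UNIV circle_dist 0 ?g"
    unfolding eventually_nonneg_def using nn pos by blast
  ultimately have "?g \<in> {f \<in> circle_class (polar_measure C (Suc m)) N. \<exists>x. f x \<noteq> 0}"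
    using trig_poly_cos_poly[OF g(2)] g0 unfolding circle_class_def by simp
  note attained = this pos nn
  have lower: "arccos z / (2 * pi) \<le> r"
    if "f \<in> {f \<in> circle_class (polar_measure C (Suc m)) N. \<exists>x. f x \<noteq> 0}"
      and r: "r > 0" and nn: "nonneg_outside UNIV circle_dist 0 f r" for f r
  proof -
    have f: "trig_poly N f" "(\<integral>x. f x \<partial>polar_measure C (Suc m)) \<le> 0" "\<exists>x. f x \<noteq> 0"
      using that(1) by (simp_all add: circle_class_def)
    obtain p q where p: "degree p \<le> N" and
      feq: "\<And>x. f x = poly p (cos (2 * pi * x)) + sin (2 * pi * x) * poly q (cos (2 * pi * x))"
      using trig_poly_even_odd[OF f(1)] by blast
    show "arccos z / (2 * pi) \<le> r"
    proof (rule ccontr)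
      assume "\<not> arccos z / (2 * pi) \<le> r"
      then have rz: "2 * pi * r < arccos z" by (simp add: field_simps)
      have "arccos z \<le> pi" using z1 by (intro arccos_ubound) auto
      with rz have "2 * pi * r \<le> pi" by linarith
      define s where "s = cos (2 * pi * r)"
      have "z < s"
        using cos_monotone_0_pi[of "2 * pi * r" "arccos z"] rz r z1 \<open>arccos z \<le> pi\<close>
        by (simp add: s_def)
      have pm: "poly p t + sqrt (1 - t\<^sup>2) * poly q t \<ge> 0" "poly p t - sqrt (1 - t\<^sup>2) * poly q t \<ge> 0"
        if t: "t \<in> {-1..1}" "t \<le> s" for t
      proof -
        define y where "y = arccos t / (2 * pi)"
        have y: "2 * pi * y = arccos t" by (simp add: y_def)
        have "y \<ge> 0" "y \<le> 1/2"
          using arccos_lbound[of t] arccos_ubound[of t] t by (simp_all add: y_def field_simps)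
        have "arccos s = 2 * pi * r" using r \<open>2 * pi * r \<le> pi\<close> by (simp add: s_def arccos_cos)
        moreover have "arccos s \<le> arccos t" using t by (intro arccos_le_arccos) (auto simp: s_def)
        ultimately have "r \<le> y" unfolding y[symmetric] by simp
        then have "f y \<ge> 0" "f (- y) \<ge> 0"
          using nn circle_dist_0_half[OF \<open>y \<ge> 0\<close> \<open>y \<le> 1/2\<close>] by (auto simp: nonneg_outside_def)
        then show "poly p t + sqrt (1 - t\<^sup>2) * poly q t \<ge> 0" "poly p t - sqrt (1 - t\<^sup>2) * poly q t \<ge> 0"
          using t by (simp_all add: feq y sin_arccos)
      qed
      have "weighted_integral (zonal_weight m) p \<le> 0"
        using f(2) divide_pos_pos[OF C pi_gt_zero] unfolding integral_polar_measure[OF C feq]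
        by (meson mult_pos_pos not_less)
      moreover have "\<forall>t\<in>{-1..1}. t \<le> s \<longrightarrow> poly p t \<ge> 0"
      proof (intro ballI impI)
        fix t :: real assume "t \<in> {-1..1}" "t \<le> s"
        from pm[OF this] show "poly p t \<ge> 0" by linarith
      qed
      ultimately have "p = 0"
        using z p \<open>z < s\<close> unfolding extremal_def by blast
      \<comment> \<open>now \<open>f\<close> is odd and nonnegative on a symmetric set, so it vanishes there\<close>
      have "q = 0"
      proof (rule poly_zero_on_interval[OF z1(1)])
        fix t assume t: "t \<in> {-1<..<z}"
        then have "t\<^sup>2 < 1" using z1 by (simp add: abs_square_less_1 abs_less_iff)
        then have "sqrt (1 - t\<^sup>2) \<noteq> 0" by simp
        moreover have "sqrt (1 - t\<^sup>2) * poly q t = 0"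
          using pm[of t] t z1 \<open>z < s\<close> \<open>p = 0\<close> by simp
        ultimately show "poly q t = 0" by simp
      qed
      with \<open>p = 0\<close> feq f(3) show False by simp
    qed
  qed
  show ?thesis
    unfolding circle_rho_def
    by (rule INF_last_sign_change_eq[OF lower _ attained]) (auto simp: circle_class_def)
qed

section \<open>Integrals of homogeneous functions over balls and slices\<close>

text \<open>
  Integration over the unit sphere up to a constant: \<open>f\<close> is extended from the sphere to the ball as a
  function that is constant along rays.
\<close>

definition radial_int :: "('a::euclidean_space \<Rightarrow> real) \<Rightarrow> real"
  where "radial_int f = (LINT x:ball 0 1|lborel. f (sgn x))"

definition homogeneous :: "nat \<Rightarrow> ('a::real_vector \<Rightarrow> real) \<Rightarrow> bool"
  where "homogeneous k f \<longleftrightarrow> (\<forall>c x. f (c *\<^sub>R x) = c ^ k * f x)"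

lemma borel_measurable_sgn [measurable]:
  "(sgn :: 'a::euclidean_space \<Rightarrow> 'a) \<in> borel_measurable borel"
  unfolding sgn_div_norm[abs_def] by measurable

lemma norm_sgn_le_1: "norm (sgn x) \<le> 1" for x :: "'a::euclidean_space"
  by (simp add: norm_sgn)

lemma set_integrable_radial:
  fixes f :: "'a::euclidean_space \<Rightarrow> real"
  assumes f: "continuous_on UNIV f"
  shows "set_integrable lborel (ball 0 1) (\<lambda>x. f (sgn x))"
proof -
  have "bounded (f ` cball 0 1)"
    using f by (intro compact_imp_bounded compact_continuous_image) (auto intro: continuous_on_subset)
  then obtain B where B: "\<And>x. x \<in> cball 0 1 \<Longrightarrow> norm (f x) \<le> B"
    unfolding bounded_iff by blast
  have [measurable]: "f \<in> borel_measurable borel"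
    using f by (rule borel_measurable_continuous_onI)
  show ?thesis
    unfolding set_integrable_def
  proof (rule integrableI_bounded_set_indicator)
    show "AE x in lborel. x \<in> ball 0 1 \<longrightarrow> norm (f (sgn x)) \<le> B"
      using B norm_sgn_le_1 by auto
  qed (auto simp: emeasure_lborel_ball_finite[unfolded infinity_ennreal_def])
qed

lemma lborel_integral_scale:
  fixes f :: "'a::euclidean_space \<Rightarrow> real"
  assumes r: "r > 0" and [measurable]: "f \<in> borel_measurable borel"
  shows "(\<integral>x. f x \<partial>lborel) = r ^ DIM('a) * (\<integral>x. f (r *\<^sub>R x) \<partial>lborel)"
proof -
  have "(\<integral>x. f x \<partial>lborel) =
      (\<integral>x. f x \<partial>density (distr lborel borel (\<lambda>x. 0 + r *\<^sub>R x)) (\<lambda>_. ennreal (\<bar>r\<bar> ^ DIM('a))))"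
    using r by (subst lborel_affine[of r 0]) (auto simp: ennreal_power)
  also have "\<dots> = (\<integral>x. r ^ DIM('a) * f (r *\<^sub>R x) \<partial>lborel)"
    using r by (subst integral_density) (auto simp: integral_distr)
  finally show ?thesis by simp
qed

text \<open>
  This replaces polar coordinates and needs only the effect of dilations on Lebesgue measure: writing
  \<open>1 - norm x ^ k\<close> as the integral of \<open>k * r ^ (k - 1)\<close> over \<open>norm x < r < 1\<close> and exchanging the integrals, the
  integral over the ball of radius \<open>r\<close> of a function constant along rays is \<open>r ^ DIM('a)\<close> times
  that over the unit ball.
\<close>

lemma integral_ball_homogeneous:
  fixes f :: "'a::euclidean_space \<Rightarrow> real"
  assumes f: "continuous_on UNIV f" "homogeneous k f"
  shows "real (DIM('a) + k) * (LINT x:ball 0 1|lborel. f x) = real DIM('a) * radial_int f"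
proof (cases "k = 0")
  case True
  have "f x = f (sgn x)" for x
    using f(2) unfolding homogeneous_def True sgn_div_norm by simp
  then have "(LINT x:ball 0 1|lborel. f x) = radial_int f"
    unfolding radial_int_def by metis
  then show ?thesis using True by simp
next
  case False
  then have k: "k > 0" by simp
  let ?m = "DIM('a)"
  have [measurable]: "f \<in> borel_measurable borel"
    using f(1) by (rule borel_measurable_continuous_onI)
  have "bounded (f ` cball 0 1)"
    using f by (intro compact_imp_bounded compact_continuous_image) (auto intro: continuous_on_subset)
  then obtain B where B: "\<And>x. x \<in> cball 0 1 \<Longrightarrow> norm (f x) \<le> B"
    unfolding bounded_iff by blast
  have "B \<ge> 0" using B[of 0] norm_ge_zero[of "f 0"] by (simp del: norm_ge_zero)
  \<comment> \<open>integrating out \<open>r\<close> gives the difference of the two integrands, integrating out \<open>x\<close> a power of \<open>r\<close>\<close>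
  define h where "h x r = (if norm x < r \<and> r < 1 then f (sgn x) * (real k * r ^ (k - 1)) else 0)"
    for x :: 'a and r :: real
  have hm [measurable]: "(\<lambda>(x, r). h x r) \<in> borel_measurable (borel \<Otimes>\<^sub>M borel)"
    unfolding h_def by measurable
  have hi: "integrable (lborel \<Otimes>\<^sub>M lborel) (\<lambda>(x, r). h x r)"
  proof (rule integrableI_bounded_set[where A = "ball 0 1 \<times> {0..1}" and B = "B * real k"])
    show "(\<lambda>(x, r). h x r) \<in> borel_measurable (lborel \<Otimes>\<^sub>M lborel)"
      using hm by simp
    show "emeasure (lborel \<Otimes>\<^sub>M lborel) (ball (0::'a) 1 \<times> {0..1::real}) < \<infinity>"
      by (subst lborel.emeasure_pair_measure_Times)
        (auto simp: ennreal_mult_less_top emeasure_lborel_ball_finite[unfolded infinity_ennreal_def])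
    have bd: "norm (h x r) \<le> B * real k" for x r
    proof (cases "norm x < r \<and> r < 1")
      case True
      then have "0 \<le> r" using norm_ge_zero[of x] by linarith
      have "norm (f (sgn x)) \<le> B" using B norm_sgn_le_1 by auto
      moreover have "r ^ (k - 1) \<le> 1" using True \<open>0 \<le> r\<close> by (intro power_le_one) auto
      ultimately show ?thesis
        using True \<open>0 \<le> r\<close> \<open>B \<ge> 0\<close> unfolding h_def
        by (simp add: abs_mult) (intro mult_mono mult_left_le, auto)
    qed (use \<open>B \<ge> 0\<close> in \<open>auto simp: h_def\<close>)
    show "AE z in lborel \<Otimes>\<^sub>M lborel. z \<in> ball 0 1 \<times> {0..1} \<longrightarrow> norm (case z of (x, r) \<Rightarrow> h x r) \<le> B * real k"
      using bd by auto
    have "(case z of (x, r) \<Rightarrow> h x r) = 0" if "z \<notin> ball 0 1 \<times> {0..1}" for z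
    proof -
      obtain x r where z: "z = (x, r)" by (rule prod.exhaust)
      have "\<not> (norm x < r \<and> r < 1)"
      proof
        assume a: "norm x < r \<and> r < 1"
        then have "0 \<le> r" using norm_ge_zero[of x] by linarith
        with a that show False by (simp add: z)
      qed
      then have "h x r = 0" unfolding h_def by (rule if_not_P)
      then show ?thesis by (simp add: z)
    qed
    then show "AE z in lborel \<Otimes>\<^sub>M lborel. z \<notin> ball 0 1 \<times> {0..1} \<longrightarrow> (case z of (x, r) \<Rightarrow> h x r) = 0"
      by (intro AE_I2) blast
  qed auto
  have inner_r: "(\<integral>r. h x r \<partial>lborel) = indicator (ball 0 1) x *\<^sub>R f (sgn x) - indicator (ball 0 1) x *\<^sub>R f x" for x
  proof (cases "norm x < 1")
    case True
    have "((\<lambda>r. real k * r ^ (k - 1)) has_integral (1 ^ k - norm x ^ k)) {norm x..1}"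
      using True by (intro fundamental_theorem_of_calculus)
        (auto intro!: derivative_eq_intros simp: has_real_derivative_iff_has_vector_derivative[symmetric])
    then have hi: "((\<lambda>r. real k * r ^ (k - 1)) has_integral (1 - norm x ^ k)) {norm x<..<1}"
      by (simp add: has_integral_Icc_iff_Ioo)
    have si: "set_integrable lborel {norm x<..<1} (\<lambda>r. real k * r ^ (k - 1))"
      by (rule set_integrable_subset[of _ "{norm x..1}"])
        (auto intro!: borel_integrable_atLeastAtMost' continuous_intros)
    have "(LINT r:{norm x<..<1}|lborel. real k * r ^ (k - 1)) = 1 - norm x ^ k"
      using set_borel_integral_eq_integral(2)[OF si] integral_unique[OF hi] by (rule trans)
    moreover have "(\<integral>r. h x r \<partial>lborel) = (\<integral>r. f (sgn x) * (indicator {norm x<..<1} r *\<^sub>R (real k * r ^ (k - 1))) \<partial>lborel)"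
      by (intro Bochner_Integration.integral_cong) (auto simp: h_def)
    ultimately have "(\<integral>r. h x r \<partial>lborel) = f (sgn x) * (1 - norm x ^ k)"
      by (simp only: set_lebesgue_integral_def integral_mult_right_zero)
    moreover have "f x = norm x ^ k * f (sgn x)"
      using f(2)[unfolded homogeneous_def, rule_format, of "norm x" "sgn x"]
      by (cases "x = 0") (simp_all add: sgn_div_norm)
    ultimately show ?thesis using True by (simp add: algebra_simps)
  next
    case False
    then have "h x r = 0" for r by (simp add: h_def)
    with False show ?thesis by simp
  qed
  have inner_x: "(\<integral>x. h x r \<partial>lborel) = indicator {0<..<1} r *\<^sub>R (radial_int f * (real k * r ^ (?m + k - 1)))" for r
  proof (cases "r \<in> {0<..<1}")
    case True
    have "(\<integral>x. h x r \<partial>lborel) = r ^ ?m * (\<integral>x. h (r *\<^sub>R x) r \<partial>lborel)"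
      using True by (intro lborel_integral_scale) (auto simp: h_def)
    also have "(\<integral>x. h (r *\<^sub>R x) r \<partial>lborel) = (\<integral>x. (real k * r ^ (k - 1)) * (indicator (ball 0 1) x *\<^sub>R f (sgn x)) \<partial>lborel)"
      using True by (intro Bochner_Integration.integral_cong)
        (auto simp: h_def sgn_scaleR mult_less_cancel_left2 split: split_indicator)
    also have "\<dots> = real k * r ^ (k - 1) * radial_int f"
      by (simp add: radial_int_def set_lebesgue_integral_def)
    finally show ?thesis using True k by (simp add: power_add[symmetric])
  next
    case False
    have "h x r = 0" for x
    proof -
      have "\<not> (norm x < r \<and> r < 1)"
        using False le_less_trans[OF norm_ge_zero, of x r] by auto
      then show ?thesis unfolding h_def by (rule if_not_P)
    qed
    with False show ?thesis by simp
  qed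
  have "(\<integral>r. indicator {0<..<1} r *\<^sub>R (radial_int f * (real k * r ^ (?m + k - 1))) \<partial>lborel)
      = radial_int f * (real k / real (?m + k))"
  proof -
    have "((\<lambda>r. r ^ (?m + k) / real (?m + k)) has_vector_derivative r ^ (?m + k - 1)) (at r within {0..1})" for r
      using k unfolding has_real_derivative_iff_has_vector_derivative[symmetric]
      by (auto intro!: derivative_eq_intros)
    then have "((\<lambda>r. r ^ (?m + k - 1)) has_integral (1 ^ (?m + k) / real (?m + k) - 0 ^ (?m + k) / real (?m + k))) {0..1}"
      by (intro fundamental_theorem_of_calculus) auto
    then have hi: "((\<lambda>r. r ^ (?m + k - 1)) has_integral 1 / real (?m + k)) {0<..<1}"
      using k by (simp add: has_integral_Icc_iff_Ioo zero_power)
    have si: "set_integrable lborel {0<..<1} (\<lambda>r::real. r ^ (?m + k - 1))"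
      by (rule set_integrable_subset[of _ "{0..1}"])
        (auto intro!: borel_integrable_atLeastAtMost' continuous_intros)
    have "(LINT r:{0<..<1}|lborel. r ^ (?m + k - 1)) = 1 / real (?m + k)"
      using set_borel_integral_eq_integral(2)[OF si] integral_unique[OF hi] by (rule trans)
    moreover have "(\<integral>r. indicator {0<..<1} r *\<^sub>R (radial_int f * (real k * r ^ (?m + k - 1))) \<partial>lborel)
        = (\<integral>r. (radial_int f * real k) * (indicator {0<..<1} r *\<^sub>R (r ^ (?m + k - 1))) \<partial>lborel)"
      by (intro Bochner_Integration.integral_cong) auto
    ultimately show ?thesis by (simp only: set_lebesgue_integral_def integral_mult_right_zero) simp
  qed
  then have "(\<integral>r. (\<integral>x. h x r \<partial>lborel) \<partial>lborel) = radial_int f * (real k / real (?m + k))"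
    unfolding inner_x .
  moreover have "(\<integral>r. (\<integral>x. h x r \<partial>lborel) \<partial>lborel) = (\<integral>x. (\<integral>r. h x r \<partial>lborel) \<partial>lborel)"
    by (rule lborel_pair.Fubini_integral[OF hi])
  moreover have "(\<integral>x. (\<integral>r. h x r \<partial>lborel) \<partial>lborel) = radial_int f - (LINT x:ball 0 1|lborel. f x)"
  proof -
    have "integrable lborel (\<lambda>x. indicator (ball 0 1) x *\<^sub>R f (sgn x))"
      using set_integrable_radial[OF f(1)] unfolding set_integrable_def .
    moreover have "integrable lborel (\<lambda>x. indicator (ball 0 1) x *\<^sub>R f x)"
    proof (rule integrableI_bounded_set_indicator[where B = B])
      show "AE x in lborel. x \<in> ball 0 1 \<longrightarrow> norm (f x) \<le> B" using B by auto
    qed (auto simp: emeasure_lborel_ball_finite[unfolded infinity_ennreal_def])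
    ultimately show ?thesis
      unfolding inner_r radial_int_def set_lebesgue_integral_def by (rule Bochner_Integration.integral_diff)
  qed
  ultimately have "radial_int f - (LINT x:ball 0 1|lborel. f x) = radial_int f * (real k / real (?m + k))"
    by simp
  then show ?thesis using k by (simp add: field_simps)
qed

text \<open>
  A polynomial function on a product with the real line is a sum of powers of the last coordinate with
  homogeneous coefficients. Repetitions in the list are harmless, and this makes sums and products of
  such representations plain list operations.
\<close>

lemma homogeneous_slices:
  fixes f :: "'a::euclidean_space \<times> real \<Rightarrow> real"
  assumes "real_polynomial_function f"
  shows "\<exists>L. (\<forall>(i, j, g) \<in> set L. continuous_on UNIV g \<and> homogeneous j g)
    \<and> (\<forall>y s. f (y, s) = (\<Sum>(i, j, g)\<leftarrow>L. g y * s ^ i))"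
  using assms
proof (induction rule: real_polynomial_function.induct)
  case (linear f)
  then interpret bounded_linear f .
  define h c where "h y = f (y, 0)" and "c = f (0, 1)" for y
  have "f (y, s) = h y + s * c" for y s
    using add[of "(y, 0)" "(0, s)"] scaleR[of s "(0, 1)"] by (simp add: h_def c_def)
  moreover have "continuous_on UNIV h"
    unfolding h_def by (intro continuous_on continuous_intros)
  moreover have "homogeneous 1 h"
    unfolding homogeneous_def h_def using scaleR[of _ "(_, 0)"] by simp
  moreover have "homogeneous 0 (\<lambda>y :: 'a. c)"
    unfolding homogeneous_def by simp
  ultimately show ?case
    by (intro exI[of _ "[(0, 1, h), (1, 0, \<lambda>y. c)]"]) simp
next
  case (const c)
  show ?case by (intro exI[of _ "[(0, 0, \<lambda>y. c)]"]) (simp add: homogeneous_def)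
next
  case (add f1 f2)
  then obtain L1 L2 where
    "\<forall>(i, j, g) \<in> set L1. continuous_on UNIV g \<and> homogeneous j g"
    "\<forall>y s. f1 (y, s) = (\<Sum>(i, j, g)\<leftarrow>L1. g y * s ^ i)"
    "\<forall>(i, j, g) \<in> set L2. continuous_on UNIV g \<and> homogeneous j g"
    "\<forall>y s. f2 (y, s) = (\<Sum>(i, j, g)\<leftarrow>L2. g y * s ^ i)"
    by blast
  then show ?case by (intro exI[of _ "L1 @ L2"]) auto
next
  case (mult f1 f2)
  then obtain L1 L2 where L:
    "\<forall>(i, j, g) \<in> set L1. continuous_on UNIV g \<and> homogeneous j g"
    "\<forall>y s. f1 (y, s) = (\<Sum>(i, j, g)\<leftarrow>L1. g y * s ^ i)"
    "\<forall>(i, j, g) \<in> set L2. continuous_on UNIV g \<and> homogeneous j g"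
    "\<forall>y s. f2 (y, s) = (\<Sum>(i, j, g)\<leftarrow>L2. g y * s ^ i)"
    by blast
  define m where "m = (\<lambda>(i :: nat, j :: nat, g :: 'a \<Rightarrow> real) (i', j', g').
    (i + i', j + j', \<lambda>y. g y * g' y))"
  define L where "L = concat (map (\<lambda>u. map (m u) L2) L1)"
  have "continuous_on UNIV g \<and> homogeneous j g" if u: "(i, j, g) \<in> set L" for i j g
  proof -
    obtain i1 j1 g1 i2 j2 g2 where u12: "(i1, j1, g1) \<in> set L1" "(i2, j2, g2) \<in> set L2"
      "j = j1 + j2" "g = (\<lambda>y. g1 y * g2 y)"
      using u unfolding L_def m_def by auto
    have 1: "continuous_on UNIV g1" "homogeneous j1 g1" using L(1) u12(1) by auto
    have 2: "continuous_on UNIV g2" "homogeneous j2 g2" using L(3) u12(2) by auto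
    have "continuous_on UNIV g" unfolding u12 by (intro continuous_intros 1 2)
    moreover have "homogeneous j g"
      using 1(2) 2(2) unfolding u12 homogeneous_def by (simp add: power_add)
    ultimately show ?thesis ..
  qed
  moreover have "f1 (y, s) * f2 (y, s) = (\<Sum>(i, j, g)\<leftarrow>L. g y * s ^ i)" for y s
  proof -
    define v where "v = (\<lambda>(i :: nat, j :: nat, g :: 'a \<Rightarrow> real). g y * s ^ i)"
    have mv: "v (m a b) = v a * v b" for a b
      by (auto simp: v_def m_def power_add split: prod.splits)
    have "(\<Sum>u\<leftarrow>concat (map (\<lambda>u. map (m u) L2) L1). v u) = (\<Sum>a\<leftarrow>L1. v a) * (\<Sum>b\<leftarrow>L2. v b)"
      by (induction L1) (simp_all add: comp_def mv sum_list_const_mult algebra_simps)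
    then show ?thesis using L(2,4) by (simp add: L_def v_def)
  qed
  ultimately show ?case by (intro exI[of _ L]) auto
qed

text \<open>
  Comparing the coefficients of \<open>c ^ k\<close> in \<open>f (c x) = c ^ k * f x\<close> discards all terms of the wrong total
  degree.
\<close>

lemma homogeneous_slices_degree:
  fixes f :: "'a::euclidean_space \<times> real \<Rightarrow> real"
  assumes f: "real_polynomial_function f" "homogeneous k f"
  obtains L where "\<And>i j g. (i, j, g) \<in> set L \<Longrightarrow> i + j = k \<and> continuous_on UNIV g \<and> homogeneous j g"
    "\<And>y s. f (y, s) = (\<Sum>(i, j, g)\<leftarrow>L. g y * s ^ i)"
proof -
  obtain L where L: "\<And>i j g. (i, j, g) \<in> set L \<Longrightarrow> continuous_on UNIV g \<and> homogeneous j g"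
    "\<And>y s. f (y, s) = (\<Sum>(i, j, g)\<leftarrow>L. g y * s ^ i)"
  proof -
    obtain L where "\<forall>(i, j, g) \<in> set L. continuous_on UNIV g \<and> homogeneous j g"
      "\<forall>y s. f (y, s) = (\<Sum>(i, j, g)\<leftarrow>L. g y * s ^ i)"
      using homogeneous_slices[OF f(1)] by blast
    then show thesis by (intro that[of L]) auto
  qed
  define L' where "L' = filter (\<lambda>(i, j, g). i + j = k) L"
  have "f (y, s) = (\<Sum>(i, j, g)\<leftarrow>L'. g y * s ^ i)" for y s
  proof -
    define P where "P = (\<Sum>(i, j, g)\<leftarrow>L. monom (g y * s ^ i) (i + j))"
    have "poly P c = poly (monom (f (y, s)) k) c" for c
    proof -
      have "poly P c = (\<Sum>u\<leftarrow>L. poly (case u of (i, j, g) \<Rightarrow> monom (g y * s ^ i) (i + j)) c)"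
        unfolding P_def by (induction L) auto
      also have "\<dots> = (\<Sum>(i, j, g)\<leftarrow>L. g (c *\<^sub>R y) * (c * s) ^ i)"
      proof (intro arg_cong[of _ _ sum_list] map_cong refl)
        fix u assume u: "u \<in> set L"
        obtain i j g where uu: "u = (i, j, g)" by (rule prod_cases3)
        have "homogeneous j g" using L(1) u uu by blast
        then show "poly (case u of (i, j, g) \<Rightarrow> monom (g y * s ^ i) (i + j)) c
            = (case u of (i, j, g) \<Rightarrow> g (c *\<^sub>R y) * (c * s) ^ i)"
          by (simp add: uu homogeneous_def poly_monom power_add power_mult_distrib)
      qed
      also have "\<dots> = f (c *\<^sub>R (y, s))" by (simp add: L(2))
      also have "\<dots> = c ^ k * f (y, s)" using f(2) unfolding homogeneous_def by blast
      finally show ?thesis by (simp add: poly_monom)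
    qed
    then have "P = monom (f (y, s)) k" by (intro iffD1[OF poly_eq_poly_eq_iff] ext)
    then have "f (y, s) = coeff P k" by (simp only: coeff_monom simp_thms if_True)
    also have "\<dots> = (\<Sum>u\<leftarrow>L. coeff (case u of (i, j, g) \<Rightarrow> monom (g y * s ^ i) (i + j)) k)"
      unfolding P_def by (induction L) auto
    also have "\<dots> = (\<Sum>(i, j, g)\<leftarrow>L'. g y * s ^ i)"
      unfolding L'_def by (induction L) (auto split: prod.splits)
    finally show ?thesis .
  qed
  then show thesis using L(1) by (intro that[of L']) (auto simp: L'_def)
qed

text \<open>
  A Beta integral in disguise.
\<close>

definition beta_int :: "nat \<Rightarrow> nat \<Rightarrow> real"
  where "beta_int i n = integral {-1..1} (\<lambda>t. t ^ i * sqrt (1 - t\<^sup>2) ^ n)"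

text \<open>
  Integrate the derivative of \<open>t ^ (i + 1) * sqrt (1 - t\<^sup>2) ^ (n + 2)\<close>.
\<close>

lemma beta_int_reduce:
  "real (i + 1 + Suc (Suc n)) * beta_int i (Suc (Suc n)) = real (Suc (Suc n)) * beta_int i n"
proof -
  let ?r = "\<lambda>t :: real. sqrt (1 - t\<^sup>2)"
  have alg: "real (i + 1) * a * R ^ Suc (Suc n) + real (Suc (Suc n)) * (a * (R * R - 1) * R ^ n)
      = real (i + 1 + Suc (Suc n)) * (a * R ^ Suc (Suc n)) - real (Suc (Suc n)) * (a * R ^ n)"
    for a R :: real by (simp add: algebra_simps)
  have deriv: "((\<lambda>t. t ^ (i + 1) * R t ^ Suc (Suc n)) has_real_derivative
      real (i + 1) * t ^ i * R t ^ Suc (Suc n) + t ^ (i + 1) * (real (Suc (Suc n)) * R t ^ Suc n * R')) (at t)"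
    if "(R has_real_derivative R') (at t)" for R :: "real \<Rightarrow> real" and R' t
    by (rule DERIV_cong[OF DERIV_mult[OF DERIV_power[OF DERIV_ident] DERIV_power[OF that]]])
      (simp add: algebra_simps)
  define F where "F = (\<lambda>t. t ^ (i + 1) * ?r t ^ Suc (Suc n))"
  have int: "(\<lambda>t. t ^ i * ?r t ^ k) integrable_on {-1..1}" for k
    by (intro integrable_continuous_real continuous_intros)
  have "((\<lambda>t. real (i + 1 + Suc (Suc n)) * (t ^ i * ?r t ^ Suc (Suc n)) - real (Suc (Suc n)) * (t ^ i * ?r t ^ n))
      has_integral (F 1 - F (-1))) {-1..1}"
  proof (rule fundamental_theorem_of_calculus_interior)
    show "continuous_on {-1..1} F" unfolding F_def by (intro continuous_intros)
    fix t :: real assume "t \<in> {-1<..<1}"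
    then have t: "t\<^sup>2 < 1" by (simp add: abs_square_less_1 abs_less_iff)
    then have r: "?r t > 0" "?r t * ?r t = 1 - t\<^sup>2" by simp_all
    have "(?r has_real_derivative - t / ?r t) (at t)"
      using t by (auto intro!: derivative_eq_intros simp: field_simps)
    then have "(F has_real_derivative
        real (i + 1) * t ^ i * ?r t ^ Suc (Suc n)
        + t ^ (i + 1) * (real (Suc (Suc n)) * ?r t ^ Suc n * (- t / ?r t))) (at t)"
      unfolding F_def by (rule deriv)
    also have "t ^ (i + 1) * (real (Suc (Suc n)) * ?r t ^ Suc n * (- t / ?r t))
        = real (Suc (Suc n)) * (t ^ i * (- t\<^sup>2) * ?r t ^ n)"
      using r(1) by (simp add: power2_eq_square)
    also have "- t\<^sup>2 = ?r t * ?r t - 1" unfolding r(2) by simp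
    also have "real (i + 1) * t ^ i * ?r t ^ Suc (Suc n)
        + real (Suc (Suc n)) * (t ^ i * (?r t * ?r t - 1) * ?r t ^ n)
      = real (i + 1 + Suc (Suc n)) * (t ^ i * ?r t ^ Suc (Suc n)) - real (Suc (Suc n)) * (t ^ i * ?r t ^ n)"
      by (rule alg)
    finally show "(F has_vector_derivative
       real (i + 1 + Suc (Suc n)) * (t ^ i * ?r t ^ Suc (Suc n)) - real (Suc (Suc n)) * (t ^ i * ?r t ^ n)) (at t)"
      by (simp only: has_real_derivative_iff_has_vector_derivative)
  qed simp
  moreover have "F 1 - F (-1) = 0" by (simp add: F_def)
  ultimately have "integral {-1..1} (\<lambda>t. real (i + 1 + Suc (Suc n)) * (t ^ i * ?r t ^ Suc (Suc n)) - real (Suc (Suc n)) * (t ^ i * ?r t ^ n)) = 0"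
    by (simp only: integral_unique)
  then show ?thesis
    unfolding beta_int_def
    by (subst (asm) integral_diff) (auto intro!: integrable_on_mult_right int simp del: power_Suc)
qed

text \<open>
  The slice of the ball at height \<open>s\<close> is a ball of radius \<open>sqrt (1 - s\<^sup>2)\<close>, and \<open>g\<close> is homogeneous.
\<close>

lemma integral_ball_slices:
  fixes g :: "'a::euclidean_space \<Rightarrow> real"
  assumes g: "continuous_on UNIV g" "homogeneous j g"
  shows "(LINT x:ball 0 1|lborel. g (fst x) * snd x ^ i) =
    (LINT y:ball 0 1|lborel. g y) * beta_int i (DIM('a) + j)"
proof -
  let ?D = "DIM('a)"
  define F where "F y s = indicator (ball 0 1) (y, s) *\<^sub>R (g y * s ^ i)" for y :: 'a and s :: real
  have [measurable]: "g \<in> borel_measurable borel"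
    using g(1) by (rule borel_measurable_continuous_onI)
  have mem: "(y, s) \<in> ball 0 1 \<longleftrightarrow> (norm y)\<^sup>2 + s\<^sup>2 < 1" for y :: 'a and s :: real
    by (simp add: norm_Pair)
  have "continuous_on (cball 0 1) (\<lambda>x :: 'a \<times> real. g (fst x) * snd x ^ i)"
    by (intro continuous_intros continuous_on_compose2[OF g(1)]) auto
  then have "set_integrable lborel (cball 0 1) (\<lambda>x :: 'a \<times> real. g (fst x) * snd x ^ i)"
    unfolding set_integrable_def by (intro borel_integrable_compact) auto
  then have "set_integrable lborel (ball 0 1) (\<lambda>x :: 'a \<times> real. g (fst x) * snd x ^ i)"
    by (rule set_integrable_subset) auto
  then have Fi: "integrable (lborel \<Otimes>\<^sub>M lborel) (\<lambda>(y, s). F y s)"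
    by (simp add: lborel_prod set_integrable_def F_def case_prod_unfold)
  have inner: "(\<integral>y. F y s \<partial>lborel) =
      (LINT y:ball 0 1|lborel. g y) * (indicator {-1<..<1} s *\<^sub>R (s ^ i * sqrt (1 - s\<^sup>2) ^ (?D + j)))" for s
  proof (cases "s \<in> {-1<..<1}")
    case True
    then have s: "s\<^sup>2 < 1" by (simp add: abs_square_less_1 abs_less_iff)
    define r where "r = sqrt (1 - s\<^sup>2)"
    have r: "r > 0" "r\<^sup>2 = 1 - s\<^sup>2" using s by (simp_all add: r_def)
    have "(\<integral>y. F y s \<partial>lborel) = r ^ ?D * (\<integral>y. F (r *\<^sub>R y) s \<partial>lborel)"
    proof (rule lborel_integral_scale[OF r(1)])
      have "(\<lambda>y. (y, s)) \<in> borel_measurable (borel :: 'a measure)"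
        by (intro borel_measurable_continuous_onI continuous_intros)
      then have [measurable]: "(\<lambda>y :: 'a. indicat_real (ball 0 1) (y, s)) \<in> borel_measurable borel"
        by (rule measurable_compose[OF _ borel_measurable_indicator]) simp
      show "(\<lambda>y. F y s) \<in> borel_measurable borel" unfolding F_def by measurable
    qed
    also have "(\<integral>y. F (r *\<^sub>R y) s \<partial>lborel) = (\<integral>y. (s ^ i * r ^ j) * (indicator (ball 0 1) y *\<^sub>R g y) \<partial>lborel)"
    proof (rule Bochner_Integration.integral_cong[OF refl])
      fix y :: 'a
      have "(r *\<^sub>R y, s) \<in> ball 0 1 \<longleftrightarrow> r\<^sup>2 * (norm y)\<^sup>2 < r\<^sup>2 * 1"
        unfolding mem by (simp add: r(2) power_mult_distrib) (simp add: algebra_simps)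
      also have "\<dots> \<longleftrightarrow> (norm y)\<^sup>2 < 1" using r(1) by (subst mult_less_cancel_left_pos) auto
      also have "\<dots> \<longleftrightarrow> y \<in> ball 0 1" by (simp add: abs_square_less_1)
      finally show "F (r *\<^sub>R y) s = (s ^ i * r ^ j) * (indicator (ball 0 1) y *\<^sub>R g y)"
        using g(2) unfolding F_def homogeneous_def by (simp add: indicator_def)
    qed
    also have "\<dots> = s ^ i * r ^ j * (LINT y:ball 0 1|lborel. g y)"
      by (simp only: set_lebesgue_integral_def integral_mult_right_zero)
    finally show ?thesis using True by (simp add: r_def power_add)
  next
    case False
    then have "\<not> s\<^sup>2 < 1" by (auto simp: abs_square_less_1 abs_less_iff)
    then have "(y, s) \<notin> ball 0 1" for y :: 'a unfolding mem using zero_le_power2[of "norm y"] by linarith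
    then have "F y s = 0" for y unfolding F_def by simp
    with False show ?thesis by simp
  qed
  have si: "set_integrable lborel {-1<..<1} (\<lambda>s. s ^ i * sqrt (1 - s\<^sup>2) ^ (?D + j))"
    by (rule set_integrable_subset[of _ "{-1..1}"])
      (auto intro!: borel_integrable_atLeastAtMost' continuous_intros)
  have "(LINT x:ball 0 1|lborel. g (fst x) * snd x ^ i) = integral\<^sup>L (lborel \<Otimes>\<^sub>M lborel) (\<lambda>(y, s). F y s)"
    by (simp add: lborel_prod set_lebesgue_integral_def F_def case_prod_unfold)
  also have "\<dots> = (\<integral>s. (\<integral>y. F y s \<partial>lborel) \<partial>lborel)"
    by (rule lborel_pair.integral_snd[OF Fi, symmetric])
  also have "\<dots> = (LINT y:ball 0 1|lborel. g y) * (LINT s:{-1<..<1}|lborel. s ^ i * sqrt (1 - s\<^sup>2) ^ (?D + j))"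
    unfolding inner by (simp only: set_lebesgue_integral_def integral_mult_right_zero)
  also have "(LINT s:{-1<..<1}|lborel. s ^ i * sqrt (1 - s\<^sup>2) ^ (?D + j)) = beta_int i (?D + j)"
    unfolding beta_int_def set_borel_integral_eq_integral(2)[OF si]
    by (rule integral_open_interval_real[symmetric])
  finally show ?thesis .
qed

text \<open>
  Integrals over spheres become integrals over balls by homogeneity, in both dimensions, and the
  reduction formula for the Beta integrals absorbs the three factors that depend on the degrees. What
  remains is the same constant for all slices, whence by linearity for all polynomials.
\<close>

lemma radial_int_slices:
  fixes g :: "'a::euclidean_space \<Rightarrow> real"
  assumes g: "continuous_on UNIV g" "homogeneous j g" and D: "DIM('a) \<ge> 2"
  shows "radial_int (\<lambda>x. g (fst x) * snd x ^ i) =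
    real DIM('a) / real (DIM('a) + 1) * (radial_int g * beta_int i (DIM('a) + j - 2))"
proof -
  let ?D = "DIM('a)"
  define f where "f = (\<lambda>x :: 'a \<times> real. g (fst x) * snd x ^ i)"
  have "continuous_on UNIV f"
    unfolding f_def by (intro continuous_intros continuous_on_compose2[OF g(1)]) auto
  moreover have "homogeneous (i + j) f"
    using g(2) unfolding homogeneous_def f_def by (simp add: power_add power_mult_distrib)
  ultimately have 1: "real (?D + 1 + (i + j)) * (LINT x:ball 0 1|lborel. f x) = real (?D + 1) * radial_int f"
    using integral_ball_homogeneous[of f "i + j"] by simp
  have 2: "(LINT x:ball 0 1|lborel. f x) = (LINT y:ball 0 1|lborel. g y) * beta_int i (?D + j)"
    unfolding f_def by (rule integral_ball_slices[OF g])
  have 3: "real (?D + j) * (LINT y:ball 0 1|lborel. g y) = real ?D * radial_int g"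
    by (rule integral_ball_homogeneous[OF g])
  have "Suc (Suc (?D + j - 2)) = ?D + j" using D by simp
  then have 4: "real (?D + 1 + (i + j)) * beta_int i (?D + j) = real (?D + j) * beta_int i (?D + j - 2)"
    using beta_int_reduce[of i "?D + j - 2"] by (simp add: algebra_simps)
  have "real (?D + 1) * radial_int f
      = (LINT y:ball 0 1|lborel. g y) * (real (?D + 1 + (i + j)) * beta_int i (?D + j))"
    unfolding 1[symmetric] 2 by simp
  also have "\<dots> = real (?D + j) * (LINT y:ball 0 1|lborel. g y) * beta_int i (?D + j - 2)"
    unfolding 4 by simp
  also have "\<dots> = real ?D * (radial_int g * beta_int i (?D + j - 2))"
    unfolding 3 by simp
  finally show ?thesis unfolding f_def[symmetric] by (simp add: field_simps)
qed

section \<open>Averages over the latitudes of the sphere\<close>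

lemma radial_int_add:
  fixes f g :: "'a::euclidean_space \<Rightarrow> real"
  assumes "continuous_on UNIV f" "continuous_on UNIV g"
  shows "radial_int (\<lambda>x. f x + g x) = radial_int f + radial_int g"
  unfolding radial_int_def
  by (rule set_integral_add(2)[OF set_integrable_radial[OF assms(1)] set_integrable_radial[OF assms(2)]])

lemma radial_int_mult: "radial_int (\<lambda>x. c * f x) = c * radial_int f"
  unfolding radial_int_def by simp

lemma radial_int_nonneg:
  fixes f :: "'a::euclidean_space \<Rightarrow> real"
  assumes "\<And>x. norm x = 1 \<Longrightarrow> f x \<ge> 0"
  shows "radial_int f \<ge> 0"
  unfolding radial_int_def set_lebesgue_integral_def
proof (rule integral_nonneg_AE)
  show "AE x in lborel. 0 \<le> indicat_real (ball 0 1) x *\<^sub>R f (sgn x)"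
    using AE_lborel_singleton[of 0] by eventually_elim (simp add: assms norm_sgn)
qed

lemma radial_int_cong:
  fixes f g :: "'a::euclidean_space \<Rightarrow> real"
  assumes f: "continuous_on UNIV f" and g: "continuous_on UNIV g"
    and eq: "\<And>u. norm u = 1 \<Longrightarrow> f u = g u"
  shows "radial_int f = radial_int g"
proof -
  have "radial_int f = radial_int g + radial_int (\<lambda>u. f u - g u)"
    using radial_int_add[OF g continuous_on_diff[OF f g]] by simp
  moreover have "radial_int (\<lambda>u. f u - g u) \<ge> 0" "radial_int (\<lambda>u. - 1 * (f u - g u)) \<ge> 0"
    by (intro radial_int_nonneg; simp add: eq)+
  ultimately show ?thesis unfolding radial_int_mult by simp
qed

text \<open>
  If \<open>f u > 0\<close>, then \<open>f\<close> is positive on an open cone around \<open>u\<close>, which meets the ball in a set of positive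
  measure.
\<close>

lemma radial_int_eq_0_imp:
  fixes f :: "'a::euclidean_space \<Rightarrow> real"
  assumes f: "continuous_on UNIV f" and nn: "\<And>x. norm x = 1 \<Longrightarrow> f x \<ge> 0"
    and 0: "radial_int f = 0" and u: "norm u = 1"
  shows "f u = 0"
proof (rule ccontr)
  assume "f u \<noteq> 0"
  then have fu: "f u > 0" using nn[OF u] by simp
  define U where "U = (ball 0 1 - {0}) \<inter> (\<lambda>x. f (sgn x)) -` {0<..}"
  have "continuous_on (ball 0 1 - {0}) (\<lambda>x. f (sgn x))"
    by (rule continuous_on_compose2[OF f]) (auto intro!: continuous_on_sgn)
  then have "open U" unfolding U_def by (rule continuous_open_preimage) (auto intro: open_delete)
  have "(1/2) *\<^sub>R u \<in> U"
    using u fu by (auto simp: U_def sgn_scaleR sgn_div_norm)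
  have "AE x in lborel. 0 \<le> indicat_real (ball 0 1) x *\<^sub>R f (sgn x)"
    using AE_lborel_singleton[of 0] by eventually_elim (simp add: nn norm_sgn)
  then have "AE x in lborel. indicat_real (ball 0 1) x *\<^sub>R f (sgn x) = 0"
    using set_integrable_radial[OF f] 0
    unfolding radial_int_def set_lebesgue_integral_def set_integrable_def
    by (subst (asm) integral_nonneg_eq_0_iff_AE) auto
  then have "AE x \<in> U in lborel. x \<in> {}"
    by eventually_elim (auto simp: U_def)
  then have "AE x \<in> U in lebesgue. x \<in> {}"
    by (rule AE_completion)
  then show False
    using mem_closed_if_AE_lebesgue_open[OF \<open>open U\<close> closed_empty _ \<open>(1/2) *\<^sub>R u \<in> U\<close>] by blast
qed

lemma radial_int_odd:
  fixes g :: "'a::euclidean_space \<Rightarrow> real"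
  assumes g: "continuous_on UNIV g" "homogeneous j g" and j: "odd j"
  shows "radial_int g = 0"
proof -
  have [measurable]: "g \<in> borel_measurable borel"
    using g(1) by (rule borel_measurable_continuous_onI)
  have neg: "g (- x) = - g x" for x
    using g(2)[unfolded homogeneous_def, rule_format, of "-1" x] j by simp
  have "lborel = distr lborel borel (\<lambda>x :: 'a. 0 + (-1) *\<^sub>R x)"
    using lborel_affine[of "-1" "0 :: 'a"] by (simp add: density_1)
  then have "radial_int g = (\<integral>x. indicator (ball 0 1) x *\<^sub>R g (sgn x) \<partial>distr lborel borel (\<lambda>x :: 'a. - x))"
    unfolding radial_int_def set_lebesgue_integral_def by simp
  also have "\<dots> = (\<integral>x. indicator (ball 0 1) (- x) *\<^sub>R g (sgn (- x)) \<partial>lborel)"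
    by (subst integral_distr; measurable; simp)
  also have "\<dots> = (\<integral>x. - (indicator (ball 0 1) x *\<^sub>R g (sgn x)) \<partial>lborel)"
    by (intro Bochner_Integration.integral_cong) (auto simp: sgn_minus neg indicator_def)
  also have "\<dots> = - radial_int g"
    unfolding radial_int_def set_lebesgue_integral_def by simp
  finally show ?thesis by simp
qed

lemma measure_ball_pos: "measure lborel (ball (0 :: 'a::euclidean_space) 1) > 0"
  using content_ball_pos[of 1 "0 :: 'a"] by simp

text \<open>
  The function \<open>f\<close> is arbitrary off the sphere; \<open>F\<close> is a continuous representative.
\<close>

lemma integral_surface_measure:
  fixes F :: "'a::euclidean_space \<Rightarrow> real"
  assumes F: "continuous_on UNIV F" and f: "\<And>x. x \<in> sphere 0 1 \<Longrightarrow> f x = F x"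
  shows "(\<integral>x. f x \<partial>surface_measure) = radial_int F / measure lborel (ball (0 :: 'a) 1)"
proof -
  let ?B = "ball (0 :: 'a) 1"
  define b where "b = measure lborel ?B"
  have b: "b > 0" unfolding b_def by (rule measure_ball_pos)
  have [measurable]: "F \<in> borel_measurable borel"
    using F by (rule borel_measurable_continuous_onI)
  have [measurable]: "?B \<in> sets borel" "sphere (0 :: 'a) 1 \<in> sets borel" by auto
  have eb: "emeasure lborel ?B = ennreal b"
    using emeasure_lborel_ball_finite[of "0 :: 'a" 1] unfolding b_def
    by (intro emeasure_eq_ennreal_measure) auto
  have um: "uniform_measure lborel ?B = density lborel (\<lambda>x. ennreal (indicator ?B x / b))"
    unfolding uniform_measure_def eb
  proof (rule density_cong)
    show "AE x in lborel. indicator ?B x / ennreal b = ennreal (indicator ?B x / b)"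
      using b by (auto simp: divide_ennreal[symmetric] ennreal_indicator)
    show "(\<lambda>x. indicator ?B x / ennreal b) \<in> borel_measurable lborel"
      by simp
    show "(\<lambda>x. ennreal (indicator ?B x / b)) \<in> borel_measurable lborel"
      by simp
  qed
  have "(\<integral>x. f x \<partial>surface_measure) = (\<integral>x. F x \<partial>surface_measure)"
    by (intro Bochner_Integration.integral_cong refl) (simp add: f space_surface_measure)
  also have "\<dots> = (\<integral>x. indicator (sphere 0 1) x *\<^sub>R F x \<partial>distr (uniform_measure lborel ?B) borel sgn)"
    unfolding surface_measure_def by (rule integral_restrict_space) simp
  also have "\<dots> = (\<integral>x. indicator (sphere 0 1) (sgn x) *\<^sub>R F (sgn x) \<partial>uniform_measure lborel ?B)"
    by (rule integral_distr; measurable)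
  also have "\<dots> = (\<integral>x. (indicator ?B x / b) *\<^sub>R (indicator (sphere 0 1) (sgn x) *\<^sub>R F (sgn x)) \<partial>lborel)"
    unfolding um
  proof (rule integral_density)
    show "AE x in lborel. 0 \<le> indicator ?B x / b" using b by auto
    show "(\<lambda>x. indicator (sphere 0 1) (sgn x) *\<^sub>R F (sgn x)) \<in> borel_measurable lborel"
      by measurable
    show "(\<lambda>x. indicat_real ?B x / b) \<in> borel_measurable lborel"
      by simp
  qed
  also have "\<dots> = (\<integral>x. (indicator ?B x *\<^sub>R F (sgn x)) / b \<partial>lborel)"
  proof (rule integral_cong_AE)
    show "AE x in lborel. (indicator ?B x / b) *\<^sub>R (indicator (sphere 0 1) (sgn x) *\<^sub>R F (sgn x))
        = (indicator ?B x *\<^sub>R F (sgn x)) / b"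
      using AE_lborel_singleton[of "0 :: 'a"] by eventually_elim (simp add: norm_sgn)
    show "(\<lambda>x. (indicator ?B x / b) *\<^sub>R (indicator (sphere 0 1) (sgn x) *\<^sub>R F (sgn x)))
        \<in> borel_measurable lborel" by measurable
    show "(\<lambda>x. (indicator ?B x *\<^sub>R F (sgn x)) / b) \<in> borel_measurable lborel"
      by measurable
  qed
  also have "\<dots> = radial_int F / b"
    unfolding radial_int_def set_lebesgue_integral_def by simp
  finally show ?thesis unfolding b_def .
qed

text \<open>
  The mean of \<open>f\<close> over the latitude at height \<open>t\<close> is, up to a constant, a polynomial \<open>p\<close> in \<open>t\<close>, and the
  integral of \<open>f\<close> over the sphere is a multiple of the weighted integral of \<open>p\<close>. The constants are independent
  of \<open>f\<close>, so the property is additive.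
\<close>

definition latitude_average ::
  "nat \<Rightarrow> ('a::euclidean_space \<times> real \<Rightarrow> real) \<Rightarrow> real poly \<Rightarrow> bool"
  where "latitude_average N f p \<longleftrightarrow> continuous_on UNIV f \<and> degree p \<le> N
    \<and> (\<forall>t\<in>{-1..1}. radial_int (\<lambda>u. f (sqrt (1 - t\<^sup>2) *\<^sub>R u, t)) = poly p t)
    \<and> radial_int f = real DIM('a) / real (DIM('a) + 1) * weighted_integral (zonal_weight (DIM('a) - 2)) p"

text \<open>
  Along the meridians in the directions \<open>u\<close> and \<open>- u\<close>, which form a great circle through the poles, \<open>f\<close>
  is a trigonometric polynomial of the distance to the pole; the two signs of the square root distinguish
  the half circles.
\<close>

definition meridian_poly :: "('a::real_vector \<times> real \<Rightarrow> real) \<Rightarrow> bool"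
  where "meridian_poly f \<longleftrightarrow> (\<forall>u. \<exists>p q. \<forall>t\<in>{-1..1}.
    f (sqrt (1 - t\<^sup>2) *\<^sub>R u, t) = poly p t + sqrt (1 - t\<^sup>2) * poly q t
    \<and> f ((- sqrt (1 - t\<^sup>2)) *\<^sub>R u, t) = poly p t - sqrt (1 - t\<^sup>2) * poly q t)"

lemma latitude_average_mono: "latitude_average M f p \<Longrightarrow> M \<le> N \<Longrightarrow> latitude_average N f p"
  unfolding latitude_average_def by auto

lemma latitude_average_0: "latitude_average N (\<lambda>x. 0) 0"
  by (simp add: latitude_average_def radial_int_def weighted_integral_0)

lemma latitude_average_continuous:
  assumes "latitude_average N F P"
  shows "continuous_on UNIV (\<lambda>u. F (r *\<^sub>R u, t))"
proof -
  have F: "continuous_on UNIV F" using assms unfolding latitude_average_def by blast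
  show ?thesis by (intro continuous_on_compose2[OF F] continuous_intros) auto
qed

lemma latitude_average_add:
  assumes f: "latitude_average N f p" and g: "latitude_average N g q"
  shows "latitude_average N (\<lambda>x. f x + g x) (p + q)"
proof -
  have c: "continuous_on UNIV f" "continuous_on UNIV g"
    using f g unfolding latitude_average_def by blast+
  show ?thesis
    using f g unfolding latitude_average_def
    by (auto simp: radial_int_add latitude_average_continuous[OF f] latitude_average_continuous[OF g] c
        weighted_integral_add[OF weight_zonal_weight] ring_distribs
        intro: degree_add_le continuous_on_add)
qed

lemma meridian_poly_0: "meridian_poly (\<lambda>x. 0)"
  unfolding meridian_poly_def by (intro allI exI[of _ 0]) simp

lemma meridian_poly_add:
  assumes f: "meridian_poly f" and g: "meridian_poly g"
  shows "meridian_poly (\<lambda>x. f x + g x)"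
  unfolding meridian_poly_def
proof
  fix u
  obtain p1 q1 where 1: "\<forall>t\<in>{-1..1}.
      f (sqrt (1 - t\<^sup>2) *\<^sub>R u, t) = poly p1 t + sqrt (1 - t\<^sup>2) * poly q1 t
    \<and> f ((- sqrt (1 - t\<^sup>2)) *\<^sub>R u, t) = poly p1 t - sqrt (1 - t\<^sup>2) * poly q1 t"
    using f unfolding meridian_poly_def by blast
  obtain p2 q2 where 2: "\<forall>t\<in>{-1..1}.
      g (sqrt (1 - t\<^sup>2) *\<^sub>R u, t) = poly p2 t + sqrt (1 - t\<^sup>2) * poly q2 t
    \<and> g ((- sqrt (1 - t\<^sup>2)) *\<^sub>R u, t) = poly p2 t - sqrt (1 - t\<^sup>2) * poly q2 t"
    using g unfolding meridian_poly_def by blast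
  show "\<exists>p q. \<forall>t\<in>{-1..1}.
      f (sqrt (1 - t\<^sup>2) *\<^sub>R u, t) + g (sqrt (1 - t\<^sup>2) *\<^sub>R u, t) = poly p t + sqrt (1 - t\<^sup>2) * poly q t
    \<and> f ((- sqrt (1 - t\<^sup>2)) *\<^sub>R u, t) + g ((- sqrt (1 - t\<^sup>2)) *\<^sub>R u, t) = poly p t - sqrt (1 - t\<^sup>2) * poly q t"
    using 1 2 by (intro exI[of _ "p1 + p2"] exI[of _ "q1 + q2"]) (simp add: algebra_simps)
qed

text \<open>
  The polynomial part of \<open>t ^ i * sqrt (1 - t\<^sup>2) ^ j\<close>: for odd \<open>j\<close> one factor \<open>sqrt (1 - t\<^sup>2)\<close> is left out.
\<close>

definition slice_poly :: "nat \<Rightarrow> nat \<Rightarrow> real poly"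
  where "slice_poly i j = monom 1 i * [:1, 0, -1:] ^ (j div 2)"

lemma poly_slice_poly:
  assumes t: "t \<in> {-1..1}"
  shows "t ^ i * sqrt (1 - t\<^sup>2) ^ j = (if even j then 1 else sqrt (1 - t\<^sup>2)) * poly (slice_poly i j) t"
proof -
  have "t\<^sup>2 \<le> 1" using t by (simp add: abs_square_le_1 abs_le_iff)
  then have sq: "sqrt (1 - t\<^sup>2) ^ 2 = 1 - t * t" by (simp add: power2_eq_square)
  have "sqrt (1 - t\<^sup>2) ^ j = (sqrt (1 - t\<^sup>2) ^ 2) ^ (j div 2) * sqrt (1 - t\<^sup>2) ^ (j mod 2)"
    by (simp only: power_mult[symmetric] power_add[symmetric]) simp
  then have "sqrt (1 - t\<^sup>2) ^ j = (1 - t * t) ^ (j div 2) * (if even j then 1 else sqrt (1 - t\<^sup>2))"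
    unfolding sq by (simp add: odd_iff_mod_2_eq_one)
  moreover have "poly (slice_poly i j) t = t ^ i * (1 - t * t) ^ (j div 2)"
    by (simp add: slice_poly_def poly_monom)
  ultimately show ?thesis by (simp only: mult_ac)
qed

lemma degree_slice_poly: "degree (slice_poly i j) \<le> i + j"
proof -
  have "degree (slice_poly i j) \<le> i + 2 * (j div 2)"
    unfolding slice_poly_def
    by (rule order_trans[OF degree_mult_le])
      (auto intro!: add_mono degree_monom_le order_trans[OF degree_power_le])
  then show ?thesis by linarith
qed

text \<open>
  For odd \<open>j\<close> the mean vanishes by the antipodal symmetry; this is why the averages are polynomials although
  square roots occur on each meridian.
\<close>

lemma latitude_average_slice:
  fixes g :: "'a::euclidean_space \<Rightarrow> real"
  assumes g: "continuous_on UNIV g" "homogeneous j g" and D: "DIM('a) \<ge> 2"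
  shows "latitude_average (i + j) (\<lambda>x. g (fst x) * snd x ^ i) (smult (radial_int g) (slice_poly i j))"
  unfolding latitude_average_def
proof (intro conjI ballI)
  show "continuous_on UNIV (\<lambda>x :: 'a \<times> real. g (fst x) * snd x ^ i)"
    by (intro continuous_intros continuous_on_compose2[OF g(1)]) auto
  show "degree (smult (radial_int g) (slice_poly i j)) \<le> i + j"
    by (rule order_trans[OF degree_smult_le degree_slice_poly])
next
  fix t :: real assume t: "t \<in> {-1..1}"
  have "radial_int (\<lambda>u. g (sqrt (1 - t\<^sup>2) *\<^sub>R u) * t ^ i) = t ^ i * sqrt (1 - t\<^sup>2) ^ j * radial_int g"
    using g(2) unfolding homogeneous_def by (subst radial_int_mult[symmetric]) (simp add: mult_ac)
  also have "\<dots> = poly (smult (radial_int g) (slice_poly i j)) t"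
    using radial_int_odd[OF g] unfolding poly_slice_poly[OF t] by auto
  finally show "radial_int (\<lambda>u. g (fst (sqrt (1 - t\<^sup>2) *\<^sub>R u, t)) * snd (sqrt (1 - t\<^sup>2) *\<^sub>R u, t) ^ i)
      = poly (smult (radial_int g) (slice_poly i j)) t" by simp
next
  have "radial_int g * beta_int i (DIM('a) + j - 2) =
      weighted_integral (zonal_weight (DIM('a) - 2)) (smult (radial_int g) (slice_poly i j))"
  proof (cases "even j")
    case True
    have "beta_int i (DIM('a) + j - 2) = weighted_integral (zonal_weight (DIM('a) - 2)) (slice_poly i j)"
      unfolding beta_int_def weighted_integral_def
    proof (rule Henstock_Kurzweil_Integration.integral_cong)
      fix t :: real assume t: "t \<in> {-1..1}"
      have "DIM('a) + j - 2 = j + (DIM('a) - 2)" using D by simp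
      then have "t ^ i * sqrt (1 - t\<^sup>2) ^ (DIM('a) + j - 2) = t ^ i * sqrt (1 - t\<^sup>2) ^ j * zonal_weight (DIM('a) - 2) t"
        by (simp only: power_add zonal_weight_def mult.assoc)
      then show "t ^ i * sqrt (1 - t\<^sup>2) ^ (DIM('a) + j - 2) = poly (slice_poly i j) t * zonal_weight (DIM('a) - 2) t"
        unfolding poly_slice_poly[OF t] using True by simp
    qed
    then show ?thesis by (simp add: weighted_integral_smult)
  next
    case False
    then show ?thesis using radial_int_odd[OF g] by (simp add: weighted_integral_0)
  qed
  then show "radial_int (\<lambda>x. g (fst x) * snd x ^ i) = real DIM('a) / real (DIM('a) + 1)
      * weighted_integral (zonal_weight (DIM('a) - 2)) (smult (radial_int g) (slice_poly i j))"
    using radial_int_slices[OF g D, of i] by simp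
qed

lemma meridian_poly_slice:
  fixes g :: "'a::euclidean_space \<Rightarrow> real"
  assumes g: "homogeneous j g"
  shows "meridian_poly (\<lambda>x. g (fst x) * snd x ^ i)"
  unfolding meridian_poly_def
proof
  fix u
  define P where "P = smult (g u) (slice_poly i j)"
  have eq: "g (sqrt (1 - t\<^sup>2) *\<^sub>R u) * t ^ i = (if even j then 1 else sqrt (1 - t\<^sup>2)) * poly P t"
    "g ((- sqrt (1 - t\<^sup>2)) *\<^sub>R u) * t ^ i = (if even j then 1 else - sqrt (1 - t\<^sup>2)) * poly P t"
    if t: "t \<in> {-1..1}" for t
  proof -
    have hom: "g (c *\<^sub>R u) = c ^ j * g u" for c using g unfolding homogeneous_def by blast
    have "g (sqrt (1 - t\<^sup>2) *\<^sub>R u) * t ^ i = g u * (t ^ i * sqrt (1 - t\<^sup>2) ^ j)"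
      "g ((- sqrt (1 - t\<^sup>2)) *\<^sub>R u) * t ^ i = g u * (-1) ^ j * (t ^ i * sqrt (1 - t\<^sup>2) ^ j)"
      unfolding hom power_minus[of "sqrt (1 - t\<^sup>2)" j] by (simp_all only: mult_ac)
    then show "g (sqrt (1 - t\<^sup>2) *\<^sub>R u) * t ^ i = (if even j then 1 else sqrt (1 - t\<^sup>2)) * poly P t"
      "g ((- sqrt (1 - t\<^sup>2)) *\<^sub>R u) * t ^ i = (if even j then 1 else - sqrt (1 - t\<^sup>2)) * poly P t"
      unfolding poly_slice_poly[OF t] by (auto simp: P_def)
  qed
  show "\<exists>p q. \<forall>t\<in>{-1..1}.
      g (fst (sqrt (1 - t\<^sup>2) *\<^sub>R u, t)) * snd (sqrt (1 - t\<^sup>2) *\<^sub>R u, t) ^ i = poly p t + sqrt (1 - t\<^sup>2) * poly q t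
    \<and> g (fst ((- sqrt (1 - t\<^sup>2)) *\<^sub>R u, t)) * snd ((- sqrt (1 - t\<^sup>2)) *\<^sub>R u, t) ^ i = poly p t - sqrt (1 - t\<^sup>2) * poly q t"
  proof (cases "even j")
    case True
    with eq show ?thesis by (intro exI[of _ P] exI[of _ 0]) simp
  next
    case False
    with eq show ?thesis by (intro exI[of _ 0] exI[of _ P]) simp
  qed
qed

lemma homogeneous_latitude_average:
  fixes f :: "'a::euclidean_space \<times> real \<Rightarrow> real"
  assumes f: "real_polynomial_function f" "homogeneous k f" and D: "DIM('a) \<ge> 2"
  shows "\<exists>P. latitude_average k f P" "meridian_poly f"
proof -
  obtain L where L: "\<And>i j g. (i, j, g) \<in> set L \<Longrightarrow> i + j = k \<and> continuous_on UNIV g \<and> homogeneous j g"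
    "\<And>y s. f (y, s) = (\<Sum>(i, j, g)\<leftarrow>L. g y * s ^ i)"
    using homogeneous_slices_degree[OF f] by blast
  have f_eq: "f = (\<lambda>x. \<Sum>(i, j, g)\<leftarrow>L. g (fst x) * snd x ^ i)"
  proof
    fix x show "f x = (\<Sum>(i, j, g)\<leftarrow>L. g (fst x) * snd x ^ i)"
      using L(2)[of "fst x" "snd x"] by simp
  qed
  have "(\<exists>P. latitude_average k (\<lambda>x. \<Sum>(i, j, g)\<leftarrow>L. g (fst x) * snd x ^ i) P)
    \<and> meridian_poly (\<lambda>x. \<Sum>(i, j, g)\<leftarrow>L. g (fst x) * snd x ^ i)"
    using L(1)
  proof (induction L)
    case Nil
    show ?case using latitude_average_0 meridian_poly_0 by auto
  next
    case (Cons u L)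
    obtain i j g where u: "u = (i, j, g)" by (rule prod_cases3)
    have g: "i + j = k" "continuous_on UNIV g" "homogeneous j g"
      using Cons.prems[of i j g] u by auto
    obtain P where "latitude_average k (\<lambda>x. \<Sum>(i, j, g)\<leftarrow>L. g (fst x) * snd x ^ i) P"
      "meridian_poly (\<lambda>x. \<Sum>(i, j, g)\<leftarrow>L. g (fst x) * snd x ^ i)"
      using Cons.IH Cons.prems by (meson list.set_intros(2))
    then show ?case
      using latitude_average_add[OF latitude_average_slice[OF g(2,3) D, of i, unfolded g(1)]]
        meridian_poly_add[OF meridian_poly_slice[OF g(3)]]
      by (auto simp: u)
  qed
  then show "\<exists>P. latitude_average k f P" "meridian_poly f" unfolding f_eq by blast+
qed

lemma spherical_harmonics_latitude_average:
  fixes Y :: "nat \<Rightarrow> 'a::euclidean_space \<times> real \<Rightarrow> real"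
  assumes Y: "\<And>k. k \<le> N \<Longrightarrow> spherical_harmonic k (Y k)" and D: "DIM('a) \<ge> 2"
  shows "\<exists>F P. latitude_average N F P \<and> meridian_poly F
    \<and> (\<forall>x\<in>sphere 0 1. (\<Sum>k\<le>N. Y k x) = F x)"
proof -
  have "\<exists>F P. latitude_average N F P \<and> meridian_poly F \<and> (\<forall>x\<in>sphere 0 1. (\<Sum>k\<le>M. Y k x) = F x)"
    if "M \<le> N" for M
    using that
  proof (induction M)
    case 0
    obtain p where p: "real_polynomial_function p" "homogeneous 0 p" "\<forall>x\<in>sphere 0 1. Y 0 x = p x"
      using Y[of 0] unfolding spherical_harmonic_def homogeneous_def by auto
    show ?case
      using homogeneous_latitude_average[OF p(1,2) D] p(3) latitude_average_mono[of 0 p _ N] by auto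
  next
    case (Suc M)
    then obtain F P where F: "latitude_average N F P" "meridian_poly F"
      "\<forall>x\<in>sphere 0 1. (\<Sum>k\<le>M. Y k x) = F x" by auto
    obtain p where p: "real_polynomial_function p" "homogeneous (Suc M) p"
      "\<forall>x\<in>sphere 0 1. Y (Suc M) x = p x"
      using Y[OF Suc.prems] unfolding spherical_harmonic_def homogeneous_def by blast
    obtain Q where Q: "latitude_average (Suc M) p Q" "meridian_poly p"
      using homogeneous_latitude_average[OF p(1,2) D] by blast
    have "latitude_average N (\<lambda>x. F x + p x) (P + Q)"
      using F(1) latitude_average_mono[OF Q(1) Suc.prems] by (rule latitude_average_add)
    moreover have "meridian_poly (\<lambda>x. F x + p x)"
      using F(2) Q(2) by (rule meridian_poly_add)
    ultimately show ?case using F(3) p(3) by (intro exI[of _ "\<lambda>x. F x + p x"] exI[of _ "P + Q"]) simp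
  qed
  from this[OF order_refl] show ?thesis .
qed

section \<open>Zonal harmonics\<close>

text \<open>
  The recursion that makes the Laplacian of the sum defining \<open>zonal_harmonic\<close> telescope to zero. The truncated
  subtractions turn the factor after the last term into zero.
\<close>

fun zonal_coeff :: "nat \<Rightarrow> nat \<Rightarrow> nat \<Rightarrow> real" where
  "zonal_coeff m k 0 = 1"
| "zonal_coeff m k (Suc j) =
    - (real (k - 2 * j) * real (k - 2 * j - 1)) / (2 * real (Suc j) * (2 * real j + real m)) * zonal_coeff m k j"

text \<open>
  The homogeneous harmonic polynomial of degree \<open>k\<close> that is invariant under the rotations fixing the pole;
  on the sphere it is a multiple of a Gegenbauer polynomial of the last coordinate.
\<close>

definition zonal_harmonic :: "nat \<Rightarrow> 'a::euclidean_space \<times> real \<Rightarrow> real"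
  where "zonal_harmonic k x =
    (\<Sum>j\<le>k div 2. zonal_coeff DIM('a) k j * snd x ^ (k - 2 * j) * (fst x \<bullet> fst x) ^ j)"

lemma real_polynomial_function_zonal_harmonic:
  "real_polynomial_function (zonal_harmonic k :: 'a::euclidean_space \<times> real \<Rightarrow> real)"
proof -
  have 1: "real_polynomial_function (\<lambda>x :: 'a \<times> real. snd x)"
    by (rule real_polynomial_function.intros(1)[OF bounded_linear_snd])
  have "real_polynomial_function (\<lambda>x :: 'a \<times> real. fst x \<bullet> b)" for b
    by (intro real_polynomial_function.intros(1) bounded_linear_inner_left_comp bounded_linear_fst)
  then have "real_polynomial_function (\<lambda>x :: 'a \<times> real. \<Sum>b\<in>Basis. (fst x \<bullet> b) * (fst x \<bullet> b))"
    by (intro real_polynomial_function_sum real_polynomial_function.intros(4)) auto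
  then have 2: "real_polynomial_function (\<lambda>x :: 'a \<times> real. fst x \<bullet> fst x)"
    by (subst euclidean_inner)
  show ?thesis
    unfolding zonal_harmonic_def[abs_def]
    by (intro real_polynomial_function_sum real_polynomial_function.intros(4) real_polynomial_function_power
        real_polynomial_function.intros(2) 1 2) auto
qed

lemma zonal_harmonic_scaleR: "zonal_harmonic k (c *\<^sub>R x) = c ^ k * zonal_harmonic k x"
proof -
  have "zonal_coeff m k j * (c * s) ^ (k - 2 * j) * (c * (c * q)) ^ j
      = c ^ k * (zonal_coeff m k j * s ^ (k - 2 * j) * q ^ j)" if "j \<le> k div 2" for j m s q
  proof -
    have "k = (k - 2 * j) + 2 * j" using that by simp
    then have "c ^ k = c ^ (k - 2 * j) * (c * c) ^ j"
      by (metis power_add power_mult power2_eq_square)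
    then show ?thesis by (simp add: power_mult_distrib)
  qed
  then show ?thesis
    unfolding zonal_harmonic_def sum_distrib_left by (intro sum.cong) simp_all
qed

lemma deriv2_poly: "(deriv ^^ 2) (poly p) x = poly (pderiv (pderiv p)) x" for p :: "real poly"
proof -
  have "deriv (poly q) = poly (pderiv q)" for q :: "real poly"
    by (rule ext) (rule DERIV_imp_deriv[OF poly_DERIV])
  then show ?thesis by (simp add: numeral_2_eq_2)
qed

lemma pderiv2_power:
  fixes p :: "real poly"
  shows "pderiv (pderiv (p ^ j)) = smult (real j)
    (smult (real (j - 1)) (p ^ (j - 2) * pderiv p) * pderiv p + p ^ (j - 1) * pderiv (pderiv p))"
proof -
  have "j - 1 - 1 = j - 2" by simp
  then show ?thesis by (simp add: pderiv_power pderiv_mult pderiv_smult algebra_simps)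
qed

lemma pderiv2_quadratic_power:
  "poly (pderiv (pderiv ([:q, 2 * c, 1:] ^ j))) 0
    = real j * (real (j - 1) * (4 * c\<^sup>2) * q ^ (j - 2) + 2 * q ^ (j - 1))" for q c :: real
  unfolding pderiv2_power by (simp add: pderiv_pCons power2_eq_square algebra_simps)

lemma pderiv2_linear_power:
  "poly (pderiv (pderiv ([:s, 1:] ^ i))) 0 = real i * real (i - 1) * s ^ (i - 2)" for s :: real
  unfolding pderiv2_power by (simp add: pderiv_pCons algebra_simps)

lemma pderiv_sum: "pderiv (\<Sum>i\<in>I. p i) = (\<Sum>i\<in>I. pderiv (p i))" for p :: "'b \<Rightarrow> real poly"
  by (induction I rule: infinite_finite_induct) (auto simp: pderiv_add)

text \<open>
  Restricted to a line in a coordinate direction, the function is a polynomial, so that its second derivative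
  can be computed by \<open>pderiv\<close>. The \<open>j\<close>-th summand contributes \<open>A j\<close> from the directions orthogonal to
  the pole and \<open>B j\<close> from the direction of the pole, and \<open>A (j + 1) = - B j\<close>.
\<close>

lemma laplacian_zonal_harmonic:
  fixes x :: "'a::euclidean_space \<times> real"
  assumes "DIM('a) \<ge> 1"
  shows "laplacian (\<lambda>x. c * zonal_harmonic k x) x = 0"
proof -
  obtain y s where x: "x = (y, s)" by (rule prod.exhaust)
  let ?m = "DIM('a)" and ?n = "k div 2"
  define q where "q = y \<bullet> y"
  define a where "a = zonal_coeff ?m k"
  define D where "D b = (deriv ^^ 2) (\<lambda>t. c * zonal_harmonic k (x + t *\<^sub>R b)) 0" for b
  have D1: "D (e, 0) = c * (\<Sum>j\<le>?n. a j * s ^ (k - 2 * j) *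
      (real j * (real (j - 1) * (4 * (y \<bullet> e)\<^sup>2) * q ^ (j - 2) + 2 * q ^ (j - 1))))"
    if e: "e \<in> Basis" for e
  proof -
    define R where "R = smult c (\<Sum>j\<le>?n. smult (a j * s ^ (k - 2 * j)) ([:q, 2 * (y \<bullet> e), 1:] ^ j))"
    have "(y + t *\<^sub>R e) \<bullet> (y + t *\<^sub>R e) = q + t * (2 * (y \<bullet> e) + t)" for t
      using e by (simp add: inner_add_left inner_add_right inner_commute[of e y] q_def algebra_simps)
    then have "(\<lambda>t. c * zonal_harmonic k (x + t *\<^sub>R (e, 0))) = poly R"
      by (intro ext) (simp add: x R_def zonal_harmonic_def poly_sum a_def)
    then have "D (e, 0) = poly (pderiv (pderiv R)) 0"
      unfolding D_def by (simp only: deriv2_poly)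
    also have "\<dots> = c * (\<Sum>j\<le>?n. a j * s ^ (k - 2 * j) *
        poly (pderiv (pderiv ([:q, 2 * (y \<bullet> e), 1:] ^ j))) 0)"
      unfolding R_def by (simp only: pderiv_smult pderiv_sum poly_smult poly_sum)
    finally show ?thesis unfolding pderiv2_quadratic_power .
  qed
  have D2: "D (0, 1) = c * (\<Sum>j\<le>?n. a j * q ^ j * (real (k - 2 * j) * real (k - 2 * j - 1) * s ^ (k - 2 * j - 2)))"
  proof -
    define R where "R = smult c (\<Sum>j\<le>?n. smult (a j * q ^ j) ([:s, 1:] ^ (k - 2 * j)))"
    have "(\<lambda>t. c * zonal_harmonic k (x + t *\<^sub>R (0, 1))) = poly R"
      by (intro ext) (simp add: x R_def zonal_harmonic_def poly_sum a_def q_def mult_ac)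
    then have "D (0, 1) = poly (pderiv (pderiv R)) 0"
      unfolding D_def by (simp only: deriv2_poly)
    also have "\<dots> = c * (\<Sum>j\<le>?n. a j * q ^ j * poly (pderiv (pderiv ([:s, 1:] ^ (k - 2 * j)))) 0)"
      unfolding R_def by (simp only: pderiv_smult pderiv_sum poly_smult poly_sum)
    finally show ?thesis unfolding pderiv2_linear_power .
  qed
  define A where "A j = a j * s ^ (k - 2 * j) * (2 * real j * (2 * real (j - 1) + real ?m) * q ^ (j - 1))" for j
  define B where "B j = a j * q ^ j * (real (k - 2 * j) * real (k - 2 * j - 1) * s ^ (k - 2 * j - 2))" for j
  have q_sum: "(\<Sum>e\<in>Basis. (y \<bullet> e)\<^sup>2) = q"
    unfolding q_def euclidean_inner[of y y] by (simp add: power2_eq_square)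
  have inner_sum: "(\<Sum>e\<in>Basis. real j * (real (j - 1) * (4 * (y \<bullet> e)\<^sup>2) * q ^ (j - 2) + 2 * q ^ (j - 1)))
      = 2 * real j * (2 * real (j - 1) + real ?m) * q ^ (j - 1)" for j
  proof -
    have "(\<Sum>e\<in>Basis. real j * (real (j - 1) * (4 * (y \<bullet> e)\<^sup>2) * q ^ (j - 2) + 2 * q ^ (j - 1)))
        = real j * (real (j - 1) * 4 * (\<Sum>e\<in>Basis. (y \<bullet> e)\<^sup>2) * q ^ (j - 2) + real ?m * (2 * q ^ (j - 1)))"
      by (simp add: sum_distrib_left[symmetric] sum_distrib_right[symmetric] sum.distrib algebra_simps)
    also have "real (j - 1) * 4 * (\<Sum>e\<in>Basis. (y \<bullet> e)\<^sup>2) * q ^ (j - 2) = real (j - 1) * 4 * q ^ (j - 1)"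
    proof (cases "j \<ge> 2")
      case True
      then obtain i where "j = 2 + i" using le_Suc_ex by blast
      then have "q * q ^ (j - 2) = q ^ (j - 1)" by simp
      then show ?thesis unfolding q_sum by simp
    qed simp
    finally show ?thesis by (simp add: algebra_simps)
  qed
  have "(\<Sum>e\<in>Basis. D (e, 0)) = c * (\<Sum>j\<le>?n. A j)"
  proof -
    have "(\<Sum>e\<in>Basis. D (e, 0)) = (\<Sum>e\<in>Basis. c * (\<Sum>j\<le>?n. a j * s ^ (k - 2 * j) *
        (real j * (real (j - 1) * (4 * (y \<bullet> e)\<^sup>2) * q ^ (j - 2) + 2 * q ^ (j - 1)))))"
      by (intro sum.cong refl D1)
    also have "\<dots> = c * (\<Sum>j\<le>?n. a j * s ^ (k - 2 * j) * (\<Sum>e\<in>Basis.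
        (real j * (real (j - 1) * (4 * (y \<bullet> e)\<^sup>2) * q ^ (j - 2) + 2 * q ^ (j - 1)))))"
      unfolding sum_distrib_left by (subst sum.swap) (rule refl)
    finally show ?thesis unfolding inner_sum A_def .
  qed
  moreover have "D (0, 1) = c * (\<Sum>j\<le>?n. B j)" unfolding D2 B_def ..
  moreover have "laplacian (\<lambda>x. c * zonal_harmonic k x) x = (\<Sum>e\<in>Basis. D (e, 0)) + D (0, 1)"
  proof -
    have "laplacian (\<lambda>x. c * zonal_harmonic k x) x = (\<Sum>b\<in>Basis. D b)"
      unfolding laplacian_def D_def ..
    also have "\<dots> = (\<Sum>b\<in>(\<lambda>u. (u, 0)) ` Basis. D b) + (\<Sum>b\<in>(\<lambda>v. (0, v)) ` Basis. D b)"
      unfolding Basis_prod_def by (rule sum.union_disjoint) auto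
    also have "(\<Sum>b\<in>(\<lambda>u. (u, 0)) ` Basis. D b) = (\<Sum>e\<in>Basis. D (e, 0))"
      by (subst sum.reindex) (auto simp: inj_on_def)
    finally show ?thesis by simp
  qed
  moreover have "(\<Sum>j\<le>M. A j + B j) = B M" for M
  proof (induction M)
    case 0
    show ?case by (simp add: A_def)
  next
    case (Suc M)
    have "2 * real M + real ?m > 0" using assms by linarith
    then have pos: "2 * real (Suc M) * (2 * real M + real ?m) \<noteq> 0" by simp
    have cancel: "(- p / d * b) * d = - p * b" if "d \<noteq> 0" for p d b :: real
      using that by simp
    have e: "a (Suc M) * (2 * real (Suc M) * (2 * real M + real ?m)) =
        - (real (k - 2 * M) * real (k - 2 * M - 1)) * a M"
      unfolding a_def zonal_coeff.simps by (rule cancel[OF pos])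
    have k: "k - 2 * Suc M = k - 2 * M - 2" by simp
    have "A (Suc M) = (a (Suc M) * (2 * real (Suc M) * (2 * real M + real ?m))) * (s ^ (k - 2 * M - 2) * q ^ M)"
      unfolding A_def k diff_Suc_1 by (simp only: mult_ac)
    also have "\<dots> = - B M"
      unfolding e B_def by (simp only: mult_minus_left mult_minus_right mult_ac)
    finally have "A (Suc M) = - B M" .
    with Suc show ?case by simp
  qed
  moreover have "B ?n = 0"
  proof -
    have "k - 2 * ?n = 0 \<or> k - 2 * ?n = 1" by linarith
    then show ?thesis unfolding B_def by auto
  qed
  ultimately show ?thesis
    by (simp add: sum.distrib distrib_left[symmetric])
qed

lemma spherical_harmonic_zonal:
  "spherical_harmonic k (\<lambda>x :: 'a::euclidean_space \<times> real. c * zonal_harmonic k x)"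
  unfolding spherical_harmonic_def
proof (intro exI conjI allI ballI)
  show "real_polynomial_function (\<lambda>x :: 'a \<times> real. c * zonal_harmonic k x)"
    by (intro real_polynomial_function.intros(4) real_polynomial_function.intros(2) real_polynomial_function_zonal_harmonic)
  show "c * zonal_harmonic k (r *\<^sub>R x) = r ^ k * (c * zonal_harmonic k x)" for r and x :: "'a \<times> real"
    by (simp add: zonal_harmonic_scaleR)
  show "laplacian (\<lambda>x :: 'a \<times> real. c * zonal_harmonic k x) x = 0" for x
    by (rule laplacian_zonal_harmonic) (simp add: Suc_le_eq)
qed (rule refl)

definition zonal_poly :: "nat \<Rightarrow> nat \<Rightarrow> real poly"
  where "zonal_poly m k = (\<Sum>j\<le>k div 2. smult (zonal_coeff m k j) (slice_poly (k - 2 * j) (2 * j)))"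

lemma zonal_harmonic_sphere:
  fixes x :: "'a::euclidean_space \<times> real"
  assumes "x \<in> sphere 0 1"
  shows "zonal_harmonic k x = poly (zonal_poly DIM('a) k) (snd x)"
proof -
  obtain y s where x: "x = (y, s)" by (rule prod.exhaust)
  have "y \<bullet> y = 1 - s * s"
    using assms dot_square_norm[of y] by (simp add: x norm_Pair power2_eq_square)
  then show ?thesis
    unfolding zonal_harmonic_def zonal_poly_def poly_sum
    by (simp add: x slice_poly_def poly_monom mult_ac)
qed

lemma degree_zonal_poly: "degree (zonal_poly m k) \<le> k"
  unfolding zonal_poly_def
proof (intro degree_sum_le)
  fix j assume "j \<in> {..k div 2}"
  then have "k - 2 * j + 2 * j = k" by auto
  then show "degree (smult (zonal_coeff m k j) (slice_poly (k - 2 * j) (2 * j))) \<le> k"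
    using degree_slice_poly[of "k - 2 * j" "2 * j"] by (intro order_trans[OF degree_smult_le]) simp
qed simp

text \<open>
  The signs alternate, so no cancellation occurs in the leading coefficient of the zonal polynomials.
\<close>

lemma zonal_coeff_sign: "(-1) ^ j * zonal_coeff m k j \<ge> 0"
proof (induction j)
  case (Suc j)
  have "(-1) ^ Suc j * zonal_coeff m k (Suc j) =
      (real (k - 2 * j) * real (k - 2 * j - 1)) / (2 * real (Suc j) * (2 * real j + real m)) * ((-1) ^ j * zonal_coeff m k j)"
    by simp
  also have "\<dots> \<ge> 0" by (rule mult_nonneg_nonneg[OF _ Suc], rule divide_nonneg_nonneg) simp_all
  finally show ?case .
qed simp

lemma coeff_zonal_poly: "coeff (zonal_poly m k) k > 0"
proof -
  have lc: "coeff ([:1, 0, -1:] ^ j) (2 * j) = (-1 :: real) ^ j" for j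
  proof -
    have "degree ([:1, 0, -1 :: real:] ^ j) = 2 * j" by (simp add: degree_power_eq)
    then show ?thesis using lead_coeff_power[of "[:1, 0, -1 :: real:]" j] by simp
  qed
  have "coeff (zonal_poly m k) k = (\<Sum>j\<le>k div 2. zonal_coeff m k j * coeff (slice_poly (k - 2 * j) (2 * j)) k)"
    unfolding zonal_poly_def by (simp add: coeff_sum)
  also have "\<dots> = (\<Sum>j\<le>k div 2. (-1) ^ j * zonal_coeff m k j)"
  proof (intro sum.cong refl)
    fix j assume "j \<in> {..k div 2}"
    then have "2 * j \<le> k" by auto
    then have "coeff (slice_poly (k - 2 * j) (2 * j)) k = (-1) ^ j"
      by (simp add: slice_poly_def coeff_monom_mult lc)
    then show "zonal_coeff m k j * coeff (slice_poly (k - 2 * j) (2 * j)) k = (-1) ^ j * zonal_coeff m k j"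
      by simp
  qed
  also have "\<dots> \<ge> (\<Sum>j\<in>{0}. (-1) ^ j * zonal_coeff m k j)"
    by (intro sum_mono2) (auto simp: zonal_coeff_sign)
  finally show ?thesis by simp
qed

text \<open>
  There is one zonal polynomial of each exact degree.
\<close>

lemma zonal_poly_span:
  "degree p \<le> N \<Longrightarrow> \<exists>c. p = (\<Sum>k\<le>N. smult (c k) (zonal_poly m k))"
proof (induction N arbitrary: p)
  case 0
  then obtain a where "p = [:a:]" using degree_eq_zeroE by blast
  then show ?case by (intro exI[of _ "\<lambda>_. a"]) (simp add: zonal_poly_def slice_poly_def)
next
  case (Suc N)
  define a where "a = coeff p (Suc N) / coeff (zonal_poly m (Suc N)) (Suc N)"
  define q where "q = p - smult a (zonal_poly m (Suc N))"
  have "coeff q (Suc N) = 0"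
    using coeff_zonal_poly[of m "Suc N"] by (simp add: q_def a_def)
  moreover have "degree q \<le> Suc N"
    unfolding q_def by (intro degree_diff_le Suc.prems order_trans[OF degree_smult_le degree_zonal_poly])
  ultimately have "degree q \<le> N"
    using coeff_eq_0[of q] by (intro degree_le allI impI) (metis Suc_lessI le_less_trans)
  then obtain c where c: "q = (\<Sum>k\<le>N. smult (c k) (zonal_poly m k))" using Suc.IH by blast
  have "p = q + smult a (zonal_poly m (Suc N))" by (simp add: q_def)
  also have "\<dots> = (\<Sum>k\<le>Suc N. smult ((c(Suc N := a)) k) (zonal_poly m k))"
    unfolding c by simp
  finally show ?case by blast
qed

lemma poly_snd_sum_spherical_harmonics:
  assumes "degree p \<le> N"
  shows "\<exists>Y :: nat \<Rightarrow> 'a::euclidean_space \<times> real \<Rightarrow> real. (\<forall>k\<le>N. spherical_harmonic k (Y k))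
    \<and> (\<forall>x\<in>sphere 0 1. poly p (snd x) = (\<Sum>k\<le>N. Y k x))"
proof -
  obtain c where c: "p = (\<Sum>k\<le>N. smult (c k) (zonal_poly DIM('a) k))"
    using zonal_poly_span[OF assms] by blast
  have "poly p (snd x) = (\<Sum>k\<le>N. c k * zonal_harmonic k x)" if "x \<in> sphere 0 1" for x :: "'a \<times> real"
    by (subst c) (simp add: poly_sum zonal_harmonic_sphere[OF that])
  then show ?thesis
    by (intro exI[of _ "\<lambda>k x. c k * zonal_harmonic k x"]) (simp add: spherical_harmonic_zonal)
qed

section \<open>The sphere\<close>

text \<open>
  The lower bound comes from the latitude averages, as in the case of the circle; a function whose averages
  vanish is recovered from its values near the opposite pole along the meridians.
\<close>

lemma sphere_rho_eq:
  assumes D: "CARD('d::finite) \<ge> 2" and z: "extremal (zonal_weight (CARD('d) - 2)) N z"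
  shows "sphere_rho (surface_measure :: ((real ^ 'd) \<times> real) measure) N = arccos z"
proof -
  let ?S = "sphere 0 1 :: ((real ^ 'd) \<times> real) set"
  let ?w = "zonal_weight (CARD('d) - 2)"
  define \<sigma> where "\<sigma> = (surface_measure :: ((real ^ 'd) \<times> real) measure)"
  define b where "b = measure lborel (ball (0 :: (real ^ 'd) \<times> real) 1)"
  have b: "b > 0" unfolding b_def by (rule measure_ball_pos)
  have D': "DIM(real ^ 'd) \<ge> 2" using D by simp
  have z1: "-1 < z" "z < 1" using z unfolding extremal_def by blast+
  have pos: "arccos z > 0" using z1 arccos_less_arccos[of z 1] by simp
  have le_pi: "arccos z \<le> pi" using z1 by (intro arccos_ubound) auto
  have pole: "geodesic_dist pole x = arccos (snd x)" for x :: "(real ^ 'd) \<times> real"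
    by (simp add: geodesic_dist_def pole_def inner_prod_def)
  have snd_bound: "snd x \<in> {-1..1}" if "x \<in> ?S" for x
  proof -
    have "\<bar>snd x\<bar> \<le> 1" using norm_snd_le[of "snd x" "fst x"] that by simp
    then show ?thesis by auto
  qed
  have latitude: "(sqrt (1 - t\<^sup>2) *\<^sub>R u, t) \<in> ?S" if "t \<in> {-1..1}" "norm u = 1" for t u
  proof -
    have "t\<^sup>2 \<le> 1" using that by (simp add: abs_square_le_1 abs_le_iff)
    then show ?thesis using that(2) by (simp add: norm_Pair power_mult_distrib)
  qed
  have surface: "(\<integral>x. f x \<partial>\<sigma>) = real CARD('d) / real (CARD('d) + 1) * weighted_integral ?w P / b"
    if "latitude_average N F P" "\<And>x. x \<in> ?S \<Longrightarrow> f x = F x" for f F P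
    using that integral_surface_measure[of F f] unfolding latitude_average_def \<sigma>_def b_def
    by simp
  have c: "real CARD('d) / real (CARD('d) + 1) > 0" using D by simp
  have sign: "(\<integral>x. f x \<partial>\<sigma>) \<le> 0 \<longleftrightarrow> weighted_integral ?w P \<le> 0"
    if "latitude_average N F P" "\<And>x. x \<in> ?S \<Longrightarrow> f x = F x" for f F P
  proof -
    have "(\<integral>x. f x \<partial>\<sigma>) = real CARD('d) / real (CARD('d) + 1) / b * weighted_integral ?w P"
      using surface[OF that] by simp
    moreover have "K * r \<le> 0 \<longleftrightarrow> r \<le> 0" if "K > 0" for K r :: real
      using that by (auto simp: mult_le_0_iff)
    ultimately show ?thesis using divide_pos_pos[OF c b] by (simp only:)
  qed

  obtain g where g: "g \<noteq> 0" "degree g \<le> N" "weighted_integral ?w g \<le> 0"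
    "\<And>t. t \<in> {-1..1} \<Longrightarrow> t \<le> z \<Longrightarrow> poly g t \<ge> 0"
    using z unfolding extremal_def by blast
  define G where "G = (\<lambda>x :: (real ^ 'd) \<times> real. poly g (snd x))"
  have nn: "nonneg_outside ?S geodesic_dist pole G (arccos z)"
    unfolding nonneg_outside_def
  proof
    fix x assume "x \<in> ?S - {y \<in> ?S. geodesic_dist pole y < arccos z}"
    then have x: "x \<in> ?S" "arccos z \<le> arccos (snd x)" by (auto simp: pole)
    have "snd x \<le> z"
    proof (rule ccontr)
      assume "\<not> snd x \<le> z"
      then have "arccos (snd x) < arccos z"
        using z1 snd_bound[OF x(1)] by (intro arccos_less_arccos) auto
      with x(2) show False by simp
    qed
    then show "G x \<ge> 0" unfolding G_def using snd_bound[OF x(1)] by (intro g(4)) auto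
  qed
  obtain Y :: "nat \<Rightarrow> (real ^ 'd) \<times> real \<Rightarrow> real" where
    Y: "\<forall>k\<le>N. spherical_harmonic k (Y k)" "\<forall>x\<in>?S. poly g (snd x) = (\<Sum>k\<le>N. Y k x)"
    using poly_snd_sum_spherical_harmonics[OF g(2), where 'a = "real ^ 'd"] by blast
  have "\<exists>F P. latitude_average N F P \<and> meridian_poly F \<and> (\<forall>x\<in>?S. (\<Sum>k\<le>N. Y k x) = F x)"
    using Y(1) by (intro spherical_harmonics_latitude_average D') blast
  then obtain F P where F: "latitude_average N F P" and FG: "\<forall>x\<in>?S. (\<Sum>k\<le>N. Y k x) = F x"
    by blast
  have GF: "G x = F x" if "x \<in> ?S" for x
    using Y(2) FG that unfolding G_def by simp
  obtain e :: "real ^ 'd" where e: "norm e = 1" using vector_choose_size[of 1] by auto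
  \<comment> \<open>\<open>G\<close> is constant on latitudes, so its unnormalised latitude average is \<open>g\<close> up to a factor\<close>
  define \<beta> where "\<beta> = measure lborel (ball (0 :: real ^ 'd) 1)"
  have P: "P = smult \<beta> g"
  proof -
    have "poly (P - smult \<beta> g) t = 0" if t: "t \<in> {-1..1}" for t
    proof -
      have cF: "continuous_on UNIV (\<lambda>u. F (sqrt (1 - t\<^sup>2) *\<^sub>R u, t))"
        by (rule latitude_average_continuous[OF F])
      have "poly P t = radial_int (\<lambda>u. F (sqrt (1 - t\<^sup>2) *\<^sub>R u, t))"
        using F t unfolding latitude_average_def by simp
      also have "\<dots> = radial_int (\<lambda>u :: real ^ 'd. poly g t)"
      proof (rule radial_int_cong)
        fix u :: "real ^ 'd" assume "norm u = 1"
        then show "F (sqrt (1 - t\<^sup>2) *\<^sub>R u, t) = poly g t"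
          using GF[OF latitude[OF t]] by (simp add: G_def)
      qed (use cF in auto)
      also have "\<dots> = \<beta> * poly g t"
        by (simp add: radial_int_def set_lebesgue_integral_def \<beta>_def)
      finally show ?thesis by simp
    qed
    then have "P - smult \<beta> g = 0" by (intro poly_zero_on_interval[of "-1" 1]) auto
    then show ?thesis by simp
  qed
  have "(\<integral>x. G x \<partial>\<sigma>) \<le> 0"
    using sign[OF F GF] g(3) measure_ball_pos[where 'a = "real ^ 'd"]
    by (simp add: P weighted_integral_smult \<beta>_def mult_le_0_iff not_le)
  moreover have "eventually_nonneg ?S geodesic_dist pole G"
    unfolding eventually_nonneg_def using nn pos by blast
  moreover have "\<exists>x\<in>?S. G x \<noteq> 0"
  proof (rule ccontr)
    assume "\<not> (\<exists>x\<in>?S. G x \<noteq> 0)"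
    then have 0: "G x = 0" if "x \<in> ?S" for x using that by blast
    have "poly g t = 0" if "t \<in> {-1..1}" for t
      using 0[OF latitude[OF that e]] by (simp add: G_def)
    then have "g = 0" by (intro poly_zero_on_interval[of "-1" 1]) auto
    with g(1) show False ..
  qed
  moreover have "\<exists>Y. (\<forall>k\<le>N. spherical_harmonic k (Y k)) \<and> (\<forall>x\<in>?S. G x = (\<Sum>k\<le>N. Y k x))"
    using Y unfolding G_def by blast
  ultimately have "G \<in> {f \<in> sphere_class \<sigma> N. \<exists>x\<in>?S. f x \<noteq> 0}"
    unfolding sphere_class_def by blast
  note attained = this pos nn

  have lower: "arccos z \<le> r"
    if f: "f \<in> {f \<in> sphere_class \<sigma> N. \<exists>x\<in>?S. f x \<noteq> 0}"
      and r: "r > 0" and nn: "nonneg_outside ?S geodesic_dist pole f r" for f r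
  proof (rule ccontr)
    assume "\<not> arccos z \<le> r"
    then have rz: "r < arccos z" by simp
    have "r \<le> pi" using rz le_pi by linarith
    define s where "s = cos r"
    have "z < s"
      using cos_monotone_0_pi[of r "arccos z"] rz r z1 le_pi by (simp add: s_def)
    have arccos_s: "arccos s = r" using r \<open>r \<le> pi\<close> by (simp add: s_def arccos_cos)
    obtain Y where Y: "\<forall>k\<le>N. spherical_harmonic k (Y k)" "\<forall>x\<in>?S. f x = (\<Sum>k\<le>N. Y k x)"
      and int: "(\<integral>x. f x \<partial>\<sigma>) \<le> 0" and f0: "\<exists>x\<in>?S. f x \<noteq> 0"
      using f unfolding sphere_class_def by blast
    have "\<exists>F P. latitude_average N F P \<and> meridian_poly F \<and> (\<forall>x\<in>?S. (\<Sum>k\<le>N. Y k x) = F x)"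
      using Y(1) by (intro spherical_harmonics_latitude_average D') blast
    then obtain F P where F: "latitude_average N F P" "meridian_poly F"
      and YF: "\<forall>x\<in>?S. (\<Sum>k\<le>N. Y k x) = F x"
      by blast
    have fF: "f x = F x" if "x \<in> ?S" for x using Y(2) YF that by simp
    have nnF: "F (sqrt (1 - t\<^sup>2) *\<^sub>R u, t) \<ge> 0" if t: "t \<in> {-1..1}" "t \<le> s" and u: "norm u = 1" for t u
    proof -
      have "r \<le> arccos t"
        unfolding arccos_s[symmetric] using t by (intro arccos_le_arccos) (auto simp: s_def)
      then have "f (sqrt (1 - t\<^sup>2) *\<^sub>R u, t) \<ge> 0"
        using nn latitude[OF t(1) u] unfolding nonneg_outside_def by (simp add: pole)
      then show ?thesis using fF[OF latitude[OF t(1) u]] by simp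
    qed
    have avg: "radial_int (\<lambda>u. F (sqrt (1 - t\<^sup>2) *\<^sub>R u, t)) = poly P t" if "t \<in> {-1..1}" for t
      using F(1) that unfolding latitude_average_def by blast
    have "weighted_integral ?w P \<le> 0" using sign[OF F(1) fF] int by simp
    moreover have "\<forall>t\<in>{-1..1}. t \<le> s \<longrightarrow> poly P t \<ge> 0"
      by (intro ballI impI, subst avg[symmetric]) (auto intro!: radial_int_nonneg nnF)
    moreover have "degree P \<le> N" using F(1) unfolding latitude_average_def by blast
    ultimately have "P = 0"
      using z \<open>z < s\<close> unfolding extremal_def by blast
    have zero: "F (sqrt (1 - t\<^sup>2) *\<^sub>R u, t) = 0" if t: "t \<in> {-1..1}" "t \<le> s" and u: "norm u = 1" for t u
    proof (rule radial_int_eq_0_imp[where f = "\<lambda>u. F (sqrt (1 - t\<^sup>2) *\<^sub>R u, t)"])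
      show "continuous_on UNIV (\<lambda>u. F (sqrt (1 - t\<^sup>2) *\<^sub>R u, t))"
        by (rule latitude_average_continuous[OF F(1)])
      show "radial_int (\<lambda>u. F (sqrt (1 - t\<^sup>2) *\<^sub>R u, t)) = 0"
        unfolding avg[OF t(1)] \<open>P = 0\<close> by simp
      show "F (sqrt (1 - t\<^sup>2) *\<^sub>R u, t) \<ge> 0" if "norm u = 1" for u
        by (rule nnF[OF t that])
    qed (rule u)
    \<comment> \<open>the zeros at low heights on the meridians of \<open>u\<close> and \<open>- u\<close> spread over the whole great circle\<close>
    have zero': "F (sqrt (1 - t\<^sup>2) *\<^sub>R u, t) = 0" if t: "t \<in> {-1..1}" and u: "norm u = 1" for t u
    proof -
      obtain p q where pq: "\<forall>t\<in>{-1..1}. F (sqrt (1 - t\<^sup>2) *\<^sub>R u, t) = poly p t + sqrt (1 - t\<^sup>2) * poly q t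
        \<and> F ((- sqrt (1 - t\<^sup>2)) *\<^sub>R u, t) = poly p t - sqrt (1 - t\<^sup>2) * poly q t"
        using F(2)[unfolded meridian_poly_def, rule_format, of u] by blast
      have 0: "poly p t = 0" "poly q t = 0" if t: "t \<in> {-1<..<z}" for t
      proof -
        have "t \<in> {-1..1}" "t \<le> s" "t\<^sup>2 < 1"
          using t z1 \<open>z < s\<close> by (auto simp: abs_square_less_1 abs_less_iff)
        moreover have "norm (- u) = 1" using u by simp
        ultimately have "poly p t + sqrt (1 - t\<^sup>2) * poly q t = 0" "poly p t - sqrt (1 - t\<^sup>2) * poly q t = 0"
          using zero[of t u] zero[of t "- u"] pq u by simp_all
        moreover have "sqrt (1 - t\<^sup>2) \<noteq> 0" using \<open>t\<^sup>2 < 1\<close> by simp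
        ultimately show "poly p t = 0" "poly q t = 0" by simp_all
      qed
      have "p = 0" by (rule poly_zero_on_interval[OF z1(1)]) (rule 0(1))
      moreover have "q = 0" by (rule poly_zero_on_interval[OF z1(1)]) (rule 0(2))
      ultimately show ?thesis using pq t by simp
    qed
    have "f x = 0" if x: "x \<in> ?S" for x
    proof -
      obtain y t where xy: "x = (y, t)" by (rule prod.exhaust)
      have t: "t \<in> {-1..1}" using snd_bound[OF x] by (simp add: xy)
      have "(norm y)\<^sup>2 + t\<^sup>2 = 1" using x by (simp add: xy norm_Pair)
      then have ny: "norm y = sqrt (1 - t\<^sup>2)" by (intro real_sqrt_unique[symmetric]) auto
      \<comment> \<open>the two poles lie on every meridian\<close>
      define u where "u = (if y = 0 then e else sgn y)"
      have "norm u = 1" using e by (simp add: u_def norm_sgn)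
      moreover have "y = sqrt (1 - t\<^sup>2) *\<^sub>R u"
        unfolding ny[symmetric] by (simp add: u_def sgn_div_norm)
      ultimately show ?thesis using zero'[OF t, of u] fF[OF x] by (simp add: xy)
    qed
    with f0 show False by blast
  qed
  show ?thesis
    unfolding sphere_rho_def \<sigma>_def[symmetric]
    by (rule INF_last_sign_change_eq[OF lower _ attained]) (auto simp: sphere_class_def)
qed

section \<open>The radii of last sign change as zeros of Jacobi polynomials\<close>

theorem corollary4:
  fixes n :: nat and C \<alpha> :: real
  assumes "CARD('d::finite) \<ge> 2" and "n \<ge> 1" and "C > 0"
    and "\<alpha> = (real CARD('d) - 2) / 2"
  shows "sphere_rho (surface_measure :: ((real ^ 'd) \<times> real) measure) (2 * n - 1)
           = 2 * pi * circle_rho (polar_measure C (CARD('d) - 1)) (2 * n - 1)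
       \<and> 2 * pi * circle_rho (polar_measure C (CARD('d) - 1)) (2 * n - 1)
           = arccos (largest_zero (jacobi_poly n \<alpha> \<alpha>))
       \<and> sphere_rho (surface_measure :: ((real ^ 'd) \<times> real) measure) (2 * n)
           = 2 * pi * circle_rho (polar_measure C (CARD('d) - 1)) (2 * n)
       \<and> 2 * pi * circle_rho (polar_measure C (CARD('d) - 1)) (2 * n)
           = arccos (largest_zero (jacobi_poly n \<alpha> (\<alpha> + 1)))"
proof -
  define m where "m = CARD('d) - 2"
  have m: "CARD('d) - 1 = Suc m" "\<alpha> = real m / 2" using assms(1,4) by (auto simp: m_def)
  then have \<alpha>: "\<alpha> > -1" "\<alpha> + 1 > -1" by auto
  have gauss: "extremal (zonal_weight m) (2 * n - 1) (largest_zero (jacobi_poly n \<alpha> \<alpha>))"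
  proof (rule extremal_gauss[OF weight_zonal_weight jacobi_poly_neq_0[OF \<alpha>(1)] degree_jacobi_poly assms(2)])
    show "weighted_integral (zonal_weight m) (jacobi_poly n \<alpha> \<alpha> * q) = 0" if "degree q < n" for q
      using that by (intro weighted_integral_jacobi_eq_0[OF \<alpha>(1,1)]) (simp_all add: powr_half_zonal_weight[OF _ m(2)])
  qed
  have radau: "extremal (zonal_weight m) (2 * n) (largest_zero (jacobi_poly n \<alpha> (\<alpha> + 1)))"
  proof (rule extremal_radau[OF weight_zonal_weight jacobi_poly_neq_0[OF \<alpha>(1)] degree_jacobi_poly assms(2)])
    show "weighted_integral (\<lambda>t. (1 + t) * zonal_weight m t) (jacobi_poly n \<alpha> (\<alpha> + 1) * q) = 0"
      if "degree q < n" for q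
    proof (rule weighted_integral_jacobi_eq_0[OF \<alpha> that])
      fix t :: real assume t: "t \<in> {-1<..<1}"
      then show "(1 + t) * zonal_weight m t = (1 - t) powr \<alpha> * (1 + t) powr (\<alpha> + 1)"
        by (simp add: powr_half_zonal_weight[OF t m(2), symmetric] powr_add)
    qed
  qed
  show ?thesis
    unfolding m(1) circle_rho_eq[OF assms(3) gauss] circle_rho_eq[OF assms(3) radau]
      sphere_rho_eq[OF assms(1) gauss[unfolded m_def]] sphere_rho_eq[OF assms(1) radau[unfolded m_def]]
    by simp
qed

end
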